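(* Let $1\le n_1<n_2<\cdots<n_l$ and $m_1,\dots,m_l\ge 1$ be integers, put $n=\sum_{i=1}^l n_im_i$ and $m=\sum_{i=1}^l m_i$, and let $P=\prod_{i=1}^l P_i$, where $P_i$ is the product of $m_i$ copies of the $n_i$-dimensional simplex $\Delta^{n_i}$. Let $\omega$ be the dimension function of $P$. Then the set of Davis-Januszkiewicz equivalence classes of small covers over $P$ is in one-to-one correspondence with the set of acyclic $\omega$-vector weighted digraphs with $m$ labeled vertices.
   Context: For a simple convex polytope $P$ of dimension $n$, a small cover over $P$ is an $n$-dimensional smooth closed manifold with a locally standard $\mathbb{Z}_2^n$-action (locally modelled on the action of $\mathbb{Z}_2^n$ on $\mathbb{R}^n$ by sign changes of coordinates) whose orbit space is $P$. A homeomorphism $f:M\to M'$ of $\mathbb{Z}_2^n$-spaces is weakly $\mathbb{Z}_2^n$-equivariant if there is an automorphism $\theta$ of $\mathbb{Z}_2^n$ with $f(g\cdot x)=\theta(g)\cdot f(x)$ for all $g,x$. Two small covers over $P$ are Davis-Januszkiewicz equivalent if there is a weakly $\mathbb{Z}_2^n$-equivariant homeomorphism between them covering the identity on $P$. Dimension function of $P$: for $1\le i\le l$, $1\le j\le m_i$ put $N^i_j=\big(\sum_{\alpha=1}^{i-1}m_\alpha\big)+j$; the function $\omega:\{1,\dots,m\}\to\mathbb{N}$ is given by $\omega(N^i_j)=n_i$. A digraph with labeled vertices $v_1,\dots,v_m$ is $\omega$-vector weighted if every edge $(v_i,v_j)$ (if it exists) is assigned a non-zero vector in $\mathbb{Z}_2^{\omega(i)}$.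 It is acyclic if it contains no directed cycle. Digraphs with labeled vertices are considered on the fixed vertex set $\{v_1,\dots,v_m\}$ and not up to isomorphism. *)

theory Defs
  imports
    "HOL-Homology.Simplices"
    "HOL-Algebra.Group_Action"
    "HOL-Algebra.Product_Groups"
    "HOL-Algebra.Elementary_Groups"
    "HOL-Library.Equipollence"
begin

section \<open>The group and its standard representation\<close>

definition Z2_pow :: "nat \<Rightarrow> (nat \<Rightarrow> int) monoid" where
  "Z2_pow n = product_group {..<n} (\<lambda>_. integer_mod_group 2)"

definition sign_change :: "nat \<Rightarrow> (nat \<Rightarrow> int) \<Rightarrow> (nat \<Rightarrow> real) \<Rightarrow> (nat \<Rightarrow> real)" where
  "sign_change n g x = (\<lambda>i. if i < n \<and> g i = 1 then - x i else x i)"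


section \<open>Smooth manifolds\<close>

text \<open>
  R^n is the library's \<^const>\<open>Euclidean_space\<close>, whose points are the sequences that vanish from
  index n on.  For U open in R^n, \<open>Ck_on n k U f\<close> says that all iterated partial
  derivatives of f of order at most k exist and are continuous on U.
\<close>

primrec Ck_on :: "nat \<Rightarrow> nat \<Rightarrow> (nat \<Rightarrow> real) set \<Rightarrow> ((nat \<Rightarrow> real) \<Rightarrow> real) \<Rightarrow> bool" where
  "Ck_on n 0 U f \<longleftrightarrow> continuous_map (subtopology (Euclidean_space n) U) euclideanreal f"
| "Ck_on n (Suc k) U f \<longleftrightarrow>
     continuous_map (subtopology (Euclidean_space n) U) euclideanreal f \<and>
     (\<forall>i<n. \<exists>f'. (\<forall>x\<in>U. ((\<lambda>t. f (x(i := t))) has_real_derivative f' x) (at (x i))) \<and>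
                Ck_on n k U f')"

definition smooth_on ::
  "nat \<Rightarrow> (nat \<Rightarrow> real) set \<Rightarrow> ((nat \<Rightarrow> real) \<Rightarrow> (nat \<Rightarrow> real)) \<Rightarrow> bool" where
  "smooth_on n U F \<longleftrightarrow> (\<forall>k. \<forall>i<n. Ck_on n k U (\<lambda>x. F x i))"

type_synonym 'a chart = "'a set \<times> ('a \<Rightarrow> nat \<Rightarrow> real)"

definition is_chart :: "nat \<Rightarrow> 'a topology \<Rightarrow> 'a chart \<Rightarrow> bool" where
  "is_chart n X c \<longleftrightarrow> (case c of (U, \<phi>) \<Rightarrow>
     openin X U \<and> openin (Euclidean_space n) (\<phi> ` U) \<and>
     homeomorphic_map (subtopology X U) (subtopology (Euclidean_space n) (\<phi> ` U)) \<phi>)"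

definition smooth_in_charts :: "nat \<Rightarrow> 'a chart \<Rightarrow> 'b chart \<Rightarrow> ('a \<Rightarrow> 'b) \<Rightarrow> bool" where
  "smooth_in_charts n c d f \<longleftrightarrow> (case (c, d) of ((U, \<phi>), (V, \<psi>)) \<Rightarrow>
     smooth_on n (\<phi> ` {x \<in> U. f x \<in> V}) (\<psi> \<circ> f \<circ> inv_into U \<phi>))"

definition smooth_atlas :: "nat \<Rightarrow> 'a topology \<Rightarrow> 'a chart set \<Rightarrow> bool" where
  "smooth_atlas n X A \<longleftrightarrow>
     (\<forall>c\<in>A. is_chart n X c) \<and> (\<Union>c\<in>A. fst c) = topspace X \<and>
     (\<forall>c\<in>A. \<forall>d\<in>A. smooth_in_charts n c d (\<lambda>x. x))"

text \<open>Second countability is implied by compactness together with the existence of charts.\<close>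

definition closed_smooth_manifold :: "nat \<Rightarrow> 'a topology \<Rightarrow> 'a chart set \<Rightarrow> bool" where
  "closed_smooth_manifold n X A \<longleftrightarrow>
     Hausdorff_space X \<and> compact_space X \<and> smooth_atlas n X A"

definition smooth_self_map ::
  "nat \<Rightarrow> 'a topology \<Rightarrow> 'a chart set \<Rightarrow> ('a \<Rightarrow> 'a) \<Rightarrow> bool" where
  "smooth_self_map n X A f \<longleftrightarrow>
     continuous_map X X f \<and> (\<forall>c\<in>A. \<forall>d\<in>A. smooth_in_charts n c d f)"

text \<open>The charts of the maximal atlas generated by A, i.e. the diffeomorphisms from open
  subsets of the manifold onto open subsets of R^n.\<close>

definition smooth_chart :: "nat \<Rightarrow> 'a topology \<Rightarrow> 'a chart set \<Rightarrow> 'a chart \<Rightarrow> bool" where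
  "smooth_chart n X A c \<longleftrightarrow>
     is_chart n X c \<and>
     (\<forall>d\<in>A. smooth_in_charts n c d (\<lambda>x. x) \<and> smooth_in_charts n d c (\<lambda>x. x))"


section \<open>Small covers\<close>

record ('a, 'p) small_cover =
  sc_top :: "'a topology"
  sc_atlas :: "'a chart set"
  sc_act :: "(nat \<Rightarrow> int) \<Rightarrow> 'a \<Rightarrow> 'a"
  sc_proj :: "'a \<Rightarrow> 'p"

text \<open>A standard chart is an invariant open set W with a diffeomorphism f onto an open subset of
  R^n that is equivariant up to an automorphism of the group.\<close>

definition standard_chart :: "nat \<Rightarrow> ('a, 'p) small_cover \<Rightarrow> 'a chart \<Rightarrow> bool" where
  "standard_chart n M c \<longleftrightarrow> smooth_chart n (sc_top M) (sc_atlas M) c \<and>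
     (case c of (W, f) \<Rightarrow>
       \<exists>\<theta> \<in> iso (Z2_pow n) (Z2_pow n). \<forall>g \<in> carrier (Z2_pow n). \<forall>x\<in>W.
         sc_act M g x \<in> W \<and> f (sc_act M g x) = sign_change n (\<theta> g) (f x))"

definition locally_standard :: "nat \<Rightarrow> ('a, 'p) small_cover \<Rightarrow> bool" where
  "locally_standard n M \<longleftrightarrow>
     (\<forall>x \<in> topspace (sc_top M). \<exists>c. standard_chart n M c \<and> x \<in> fst c)"

text \<open>
  A simple polytope P enters through its underlying space and its set \<open>Fs\<close> of facets.  The orbit
  space of a locally standard action is a manifold with corners, with local model the quotient of
  R^n by sign changes, i.e. the nonnegative orthant; the codimension of an orbit is the number of
  vanishing coordinates in a standard chart.  In a simple polytope the codimension of a point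
  (that of the smallest face containing it) is the number of facets containing it.  That the
  orbit space is P means that the projection induces a homeomorphism of the orbit space with P
  which is one of manifolds with corners, i.e. preserves codimension.  (Without the latter
  condition the face structure of P would be irrelevant, as P is only a ball topologically.)
\<close>

definition orbit_space_is ::
  "nat \<Rightarrow> 'p topology \<Rightarrow> 'p set set \<Rightarrow> ('a, 'p) small_cover \<Rightarrow> bool" where
  "orbit_space_is n P Fs M \<longleftrightarrow>
     quotient_map (sc_top M) P (sc_proj M) \<and>
     (\<forall>x \<in> topspace (sc_top M).
        {y \<in> topspace (sc_top M). sc_proj M y = sc_proj M x} = orbit (Z2_pow n) (sc_act M) x) \<and>
     (\<forall>W f. standard_chart n M (W, f) \<longrightarrow>
        (\<forall>x\<in>W. card {i. i < n \<and> f x i = 0} = card {F \<in> Fs. sc_proj M x \<in> F}))"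

definition small_covers ::
  "nat \<Rightarrow> 'p topology \<Rightarrow> 'p set set \<Rightarrow> ('a, 'p) small_cover set" where
  "small_covers n P Fs = {M.
     closed_smooth_manifold n (sc_top M) (sc_atlas M) \<and>
     group_action (Z2_pow n) (topspace (sc_top M)) (sc_act M) \<and>
     (\<forall>g \<in> carrier (Z2_pow n). smooth_self_map n (sc_top M) (sc_atlas M) (sc_act M g)) \<and>
     locally_standard n M \<and> orbit_space_is n P Fs M}"

definition DJ_equivalent ::
  "nat \<Rightarrow> ('a, 'p) small_cover \<Rightarrow> ('a, 'p) small_cover \<Rightarrow> bool" where
  "DJ_equivalent n M M' \<longleftrightarrow> (\<exists>f. homeomorphic_map (sc_top M) (sc_top M') f \<and>
     (\<exists>\<theta> \<in> iso (Z2_pow n) (Z2_pow n). \<forall>g \<in> carrier (Z2_pow n). \<forall>x \<in> topspace (sc_top M).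
        f (sc_act M g x) = sc_act M' (\<theta> g) (f x)) \<and>
     (\<forall>x \<in> topspace (sc_top M). sc_proj M' (f x) = sc_proj M x))"

definition DJ_classes ::
  "nat \<Rightarrow> 'p topology \<Rightarrow> 'p set set \<Rightarrow> ('a, 'p) small_cover set set" where
  "DJ_classes n P Fs = small_covers n P Fs //
     {(M, M'). M \<in> small_covers n P Fs \<and> M' \<in> small_covers n P Fs \<and> DJ_equivalent n M M'}"


section \<open>Products of simplices\<close>

definition simplex_space :: "nat \<Rightarrow> (nat \<Rightarrow> real) topology" where
  "simplex_space d = subtopology (powertop_real UNIV) (standard_simplex d)"

definition simplex_product ::
  "nat \<Rightarrow> (nat \<Rightarrow> nat) \<Rightarrow> (nat \<Rightarrow> nat) \<Rightarrow> (nat \<Rightarrow> nat \<Rightarrow> nat \<Rightarrow> real) topology" where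
  "simplex_product l ns ms =
     product_topology (\<lambda>i. product_topology (\<lambda>j. simplex_space (ns i)) {1..ms i}) {1..l}"

text \<open>A facet of a product is a facet of one factor times the other factors, and the facets of the
  standard simplex of positive dimension are given by the vanishing of one barycentric
  coordinate.\<close>

definition simplex_product_facets ::
  "nat \<Rightarrow> (nat \<Rightarrow> nat) \<Rightarrow> (nat \<Rightarrow> nat) \<Rightarrow> (nat \<Rightarrow> nat \<Rightarrow> nat \<Rightarrow> real) set set" where
  "simplex_product_facets l ns ms =
     {{p \<in> topspace (simplex_product l ns ms). p i j t = 0} | i j t.
        i \<in> {1..l} \<and> j \<in> {1..ms i} \<and> t \<le> ns i}"

definition block_index :: "(nat \<Rightarrow> nat) \<Rightarrow> nat \<Rightarrow> nat \<Rightarrow> nat" where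
  "block_index ms i j = (\<Sum>\<alpha>\<in>{1..<i}. ms \<alpha>) + j"


section \<open>Weighted digraphs\<close>

text \<open>The vertex \<open>v\<^sub>i\<close> is represented by its label i, the edges by a relation.\<close>

definition acyclic_weighted_digraphs ::
  "nat \<Rightarrow> (nat \<Rightarrow> nat) \<Rightarrow> ((nat \<times> nat) set \<times> (nat \<times> nat \<Rightarrow> nat \<Rightarrow> int)) set" where
  "acyclic_weighted_digraphs m \<omega> =
     {(E, w). E \<subseteq> {1..m} \<times> {1..m} \<and> acyclic E \<and>
        w \<in> (\<Pi>\<^sub>E (i, j)\<in>E. carrier (Z2_pow (\<omega> i)) - {\<one>\<^bsub>Z2_pow (\<omega> i)\<^esub>})}"

end

theory Submission
  imports Defs
begin

text \<open>
  A small cover over \<open>P\<close> is determined by the stabilizers of its points.  They are constant on the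
  relative interiors of the faces of \<open>P\<close>, by connectedness along segments, and the stabilizer over a
  point is freely generated by the characteristic vectors of the facets containing it.  The orbit
  projection has a global section: local sections exist in standard charts, and sections over
  adjacent boxes can be glued, since two sections over a convex set that agree at a point lying on
  as few facets as possible agree everywhere.  Spreading two sections by the group shows that small
  covers with the same characteristic function up to an automorphism are equivalent.  Conversely
  every characteristic function is realized by a quotient of \<open>P \<times> \<int>\<^sub>2\<^sup>n\<close>, whose charts at the
  vertices of \<open>P\<close> are quotients of homogeneous coordinates up to locally constant signs.

  After normalizing the characteristic vectors of the facets \<open>(k, t)\<close>, \<open>t \<ge> 1\<close>, to the standard basis,
  the vectors of the remaining facets \<open>(k, 0)\<close> form a vector matrix over \<open>\<int>\<^sub>2\<close> with all principal
  minors equal to 1.  Its off-diagonal part is the weighted digraph, and a minimal cycle would give a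
  vanishing minor.
\<close>

section \<open>The group of sign changes\<close>

text \<open>\<open>orbit_space_is\<close> counts the facets through a point but does not say which
  coordinate hyperplane of a chart lies over which facet. This matching is recovered by moving off
  all vanishing coordinates but one: the nearby point lies on a single facet, and since stabilizers
  are constant over its relative interior, different coordinates lead to different facets. Gluing of
  sections cannot rely on a free action: over a face the element that carries one section to another
  is determined only modulo the stabilizer. At a point on fewest facets this ambiguity is least. The
  charts of the models involve square roots because squaring folds a line onto a half-line; a root
  is not smooth at zero, but in a change of charts it only meets squares and leaves absolute values,
  whose signs are restored by those of the group element. The vectors at one vertex are normalized
  to a basis so that no freedom remains: an automorphism fixing a basis is the identity, and each
  class of small covers then has exactly one matrix.\<close>

lemma Z2_carrier: "g \<in> carrier (Z2_pow n) \<longleftrightarrow> g \<in> extensional {..<n} \<and> (\<forall>i<n. g i = 0 \<or> g i = 1)"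
proof -
  have "(x::int) \<in> {0..<2} \<longleftrightarrow> x = 0 \<or> x = 1" for x by auto
  then show ?thesis
    by (auto simp: Z2_pow_def carrier_integer_mod_group PiE_iff)
qed

lemma Z2_mult: "g \<otimes>\<^bsub>Z2_pow n\<^esub> h = (\<lambda>i\<in>{..<n}. (g i + h i) mod 2)"
  by (simp add: Z2_pow_def)

lemma Z2_one: "\<one>\<^bsub>Z2_pow n\<^esub> = (\<lambda>i\<in>{..<n}. 0)"
  by (simp add: Z2_pow_def)

lemma Z2_coord: "g \<in> carrier (Z2_pow n) \<Longrightarrow> i < n \<Longrightarrow> g i = 0 \<or> g i = 1"
  by (simp add: Z2_carrier)

lemma Z2_eqI:
  assumes "g \<in> carrier (Z2_pow n)" "h \<in> carrier (Z2_pow n)" "\<And>i. i < n \<Longrightarrow> g i = 1 \<longleftrightarrow> h i = 1"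
  shows "g = h"
proof (rule extensionalityI[where A="{..<n}"])
  show "g \<in> extensional {..<n}" "h \<in> extensional {..<n}" using assms by (auto simp: Z2_carrier)
  fix i assume "i \<in> {..<n}"
  then show "g i = h i" using assms(3)[of i] Z2_coord[OF assms(1), of i] Z2_coord[OF assms(2), of i] by auto
qed

lemma Z2_group: "group (Z2_pow n)"
  by (simp add: Z2_pow_def)

lemma Z2_closed [simp]:
  "g \<in> carrier (Z2_pow n) \<Longrightarrow> h \<in> carrier (Z2_pow n) \<Longrightarrow> g \<otimes>\<^bsub>Z2_pow n\<^esub> h \<in> carrier (Z2_pow n)"
  by (meson Z2_group group.is_monoid monoid.m_closed)

lemma Z2_one_closed [simp]: "\<one>\<^bsub>Z2_pow n\<^esub> \<in> carrier (Z2_pow n)"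
  by (meson Z2_group group.is_monoid monoid.one_closed)

lemma Z2_mult_coord:
  assumes "g \<in> carrier (Z2_pow n)" "h \<in> carrier (Z2_pow n)" "i < n"
  shows "(g \<otimes>\<^bsub>Z2_pow n\<^esub> h) i = 1 \<longleftrightarrow> (g i = 1) \<noteq> (h i = 1)"
  using Z2_coord[OF assms(1,3)] Z2_coord[OF assms(2,3)] assms(3) by (auto simp: Z2_mult)

lemma Z2_one_coord [simp]: "i < n \<Longrightarrow> \<one>\<^bsub>Z2_pow n\<^esub> i = 0"
  by (simp add: Z2_one)

lemma Z2_comm: "g \<otimes>\<^bsub>Z2_pow n\<^esub> h = h \<otimes>\<^bsub>Z2_pow n\<^esub> g"
  by (simp add: Z2_mult add.commute)

lemma Z2_square: "g \<in> carrier (Z2_pow n) \<Longrightarrow> g \<otimes>\<^bsub>Z2_pow n\<^esub> g = \<one>\<^bsub>Z2_pow n\<^esub>"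
  by (rule Z2_eqI[where n=n]) (auto simp: Z2_mult_coord)

lemma Z2_assoc:
  assumes "a \<in> carrier (Z2_pow n)" "b \<in> carrier (Z2_pow n)" "c \<in> carrier (Z2_pow n)"
  shows "a \<otimes>\<^bsub>Z2_pow n\<^esub> b \<otimes>\<^bsub>Z2_pow n\<^esub> c = a \<otimes>\<^bsub>Z2_pow n\<^esub> (b \<otimes>\<^bsub>Z2_pow n\<^esub> c)"
  using assms by (meson Z2_group group.is_monoid monoid.m_assoc)

lemma Z2_l_one [simp]: "a \<in> carrier (Z2_pow n) \<Longrightarrow> \<one>\<^bsub>Z2_pow n\<^esub> \<otimes>\<^bsub>Z2_pow n\<^esub> a = a"
  by (meson Z2_group group.is_monoid monoid.l_one)

lemma Z2_r_one [simp]: "a \<in> carrier (Z2_pow n) \<Longrightarrow> a \<otimes>\<^bsub>Z2_pow n\<^esub> \<one>\<^bsub>Z2_pow n\<^esub> = a"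
  by (meson Z2_group group.is_monoid monoid.r_one)

lemma Z2_cancel:
  assumes "a \<in> carrier (Z2_pow n)" "b \<in> carrier (Z2_pow n)"
  shows "a \<otimes>\<^bsub>Z2_pow n\<^esub> (a \<otimes>\<^bsub>Z2_pow n\<^esub> b) = b"
  using assms by (metis Z2_assoc Z2_square Z2_l_one)

lemma Z2_finite [simp]: "finite (carrier (Z2_pow n))"
  by (simp add: Z2_pow_def carrier_integer_mod_group finite_PiE)

lemma Z2_iso_closed: "\<theta> \<in> iso (Z2_pow n) (Z2_pow n) \<Longrightarrow> g \<in> carrier (Z2_pow n) \<Longrightarrow> \<theta> g \<in> carrier (Z2_pow n)"
  by (auto simp: iso_iff)

lemma Z2_iso_mult:
  "\<theta> \<in> iso (Z2_pow n) (Z2_pow n) \<Longrightarrow> g \<in> carrier (Z2_pow n) \<Longrightarrow> h \<in> carrier (Z2_pow n)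
     \<Longrightarrow> \<theta> (g \<otimes>\<^bsub>Z2_pow n\<^esub> h) = \<theta> g \<otimes>\<^bsub>Z2_pow n\<^esub> \<theta> h"
  by (auto simp: iso_iff hom_mult)

lemma Z2_iso_eq_iff:
  "\<theta> \<in> iso (Z2_pow n) (Z2_pow n) \<Longrightarrow> g \<in> carrier (Z2_pow n) \<Longrightarrow> h \<in> carrier (Z2_pow n)
     \<Longrightarrow> \<theta> g = \<theta> h \<longleftrightarrow> g = h"
  by (auto simp: iso_iff inj_on_eq_iff)

lemma Z2_iso_one: "\<theta> \<in> iso (Z2_pow n) (Z2_pow n) \<Longrightarrow> \<theta> \<one>\<^bsub>Z2_pow n\<^esub> = \<one>\<^bsub>Z2_pow n\<^esub>"
  using Z2_group hom_one by (metis iso_iff)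

lemma Z2_iso_surj:
  "\<theta> \<in> iso (Z2_pow n) (Z2_pow n) \<Longrightarrow> h \<in> carrier (Z2_pow n) \<Longrightarrow> \<exists>g \<in> carrier (Z2_pow n). \<theta> g = h"
  by (auto simp: iso_iff image_iff) (metis (no_types, lifting) imageE)

lemma Z2_iso_inverse:
  assumes "\<theta> \<in> iso (Z2_pow n) (Z2_pow n)"
  obtains \<theta>' where "\<theta>' \<in> iso (Z2_pow n) (Z2_pow n)"
    "\<And>g. g \<in> carrier (Z2_pow n) \<Longrightarrow> \<theta>' (\<theta> g) = g" "\<And>g. g \<in> carrier (Z2_pow n) \<Longrightarrow> \<theta> (\<theta>' g) = g"
proof
  show "inv_into (carrier (Z2_pow n)) \<theta> \<in> iso (Z2_pow n) (Z2_pow n)"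
    by (rule group.iso_set_sym[OF Z2_group assms])
  have "inj_on \<theta> (carrier (Z2_pow n))" "\<theta> ` carrier (Z2_pow n) = carrier (Z2_pow n)"
    using assms by (auto simp: iso_iff)
  then show "\<And>g. g \<in> carrier (Z2_pow n) \<Longrightarrow> inv_into (carrier (Z2_pow n)) \<theta> (\<theta> g) = g"
    "\<And>g. g \<in> carrier (Z2_pow n) \<Longrightarrow> \<theta> (inv_into (carrier (Z2_pow n)) \<theta> g) = g"
    by (auto simp: f_inv_into_f)
qed

section \<open>Subset sums and independence over the field with two elements\<close>

definition zsum :: "nat \<Rightarrow> ('x \<Rightarrow> nat \<Rightarrow> int) \<Rightarrow> 'x set \<Rightarrow> nat \<Rightarrow> int" where
  "zsum n f A = (\<lambda>i\<in>{..<n}. (\<Sum>x\<in>A. f x i) mod 2)"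

definition zunit :: "nat \<Rightarrow> nat \<Rightarrow> nat \<Rightarrow> int" where
  "zunit n i = (\<lambda>j\<in>{..<n}. if j = i then 1 else 0)"

text \<open>Coefficients over two elements are 0 or 1, so a linear relation is a subset and
  independence concerns subset sums; this matches \<open>char_of\<close>, where stabilizers are
  images of power sets.\<close>

definition zindep :: "nat \<Rightarrow> ('x \<Rightarrow> nat \<Rightarrow> int) \<Rightarrow> 'x set \<Rightarrow> bool" where
  "zindep n f B \<longleftrightarrow> (\<forall>A\<subseteq>B. zsum n f A = \<one>\<^bsub>Z2_pow n\<^esub> \<longrightarrow> A = {})"

lemma zsum_closed [simp]: "zsum n f A \<in> carrier (Z2_pow n)"
  by (auto simp: zsum_def Z2_carrier)

lemma zunit_closed [simp]: "zunit n i \<in> carrier (Z2_pow n)"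
  by (auto simp: zunit_def Z2_carrier)

lemma zunit_coord: "j < n \<Longrightarrow> zunit n i j = (if j = i then 1 else 0)"
  by (simp add: zunit_def)

lemma zsum_cong: "(\<And>x. x \<in> A \<Longrightarrow> f x = g x) \<Longrightarrow> zsum n f A = zsum n g A"
  by (simp add: zsum_def cong: sum.cong)

lemma zsum_empty [simp]: "zsum n f {} = \<one>\<^bsub>Z2_pow n\<^esub>"
  by (simp add: zsum_def Z2_one)

lemma zsum_insert:
  "finite A \<Longrightarrow> x \<notin> A \<Longrightarrow> zsum n f (insert x A) = f x \<otimes>\<^bsub>Z2_pow n\<^esub> zsum n f A"
  by (auto simp: zsum_def Z2_mult mod_simps)

lemma zsum_singleton: "f x \<in> carrier (Z2_pow n) \<Longrightarrow> zsum n f {x} = f x"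
  using zsum_insert[of "{}" x n f] by simp

lemma zsum_Un_disjoint:
  "finite A \<Longrightarrow> finite B \<Longrightarrow> A \<inter> B = {} \<Longrightarrow> zsum n f (A \<union> B) = zsum n f A \<otimes>\<^bsub>Z2_pow n\<^esub> zsum n f B"
  by (auto simp: zsum_def Z2_mult mod_simps sum.union_disjoint)

text \<open>Every element is its own inverse, so the contribution of \<open>A \<inter> B\<close>
  cancels: addition of coefficient vectors becomes symmetric difference of sets.\<close>

lemma zsum_symdiff:
  assumes "finite A" "finite B"
  shows "zsum n f A \<otimes>\<^bsub>Z2_pow n\<^esub> zsum n f B = zsum n f ((A - B) \<union> (B - A))"
proof -
  let ?m = "\<lambda>a b. a \<otimes>\<^bsub>Z2_pow n\<^esub> b"
  have A: "zsum n f A = ?m (zsum n f (A - B)) (zsum n f (A \<inter> B))"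
    by (subst zsum_Un_disjoint[symmetric]) (use assms in \<open>auto simp: Un_Diff_Int\<close>)
  have B: "zsum n f B = ?m (zsum n f (A \<inter> B)) (zsum n f (B - A))"
    by (subst zsum_Un_disjoint[symmetric]) (use assms in \<open>auto intro: arg_cong[where f="zsum n f"]\<close>)
  have "?m (zsum n f A) (zsum n f B) = ?m (zsum n f (A - B)) (zsum n f (B - A))"
    unfolding A B by (simp add: Z2_assoc Z2_cancel)
  also have "\<dots> = zsum n f ((A - B) \<union> (B - A))"
    by (subst zsum_Un_disjoint[symmetric]) (use assms in auto)
  finally show ?thesis .
qed

lemma zsum_hom:
  assumes "finite A" "\<theta> \<in> hom (Z2_pow n) (Z2_pow k)" "\<And>x. x \<in> A \<Longrightarrow> f x \<in> carrier (Z2_pow n)"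
  shows "\<theta> (zsum n f A) = zsum k (\<lambda>x. \<theta> (f x)) A"
  using assms(1,3)
proof (induction A)
  case empty
  then show ?case using assms(2) by (simp add: hom_one Z2_group)
next
  case (insert x A)
  then show ?case using assms(2) by (simp add: zsum_insert hom_mult)
qed

lemma zsum_reindex: "inj_on h A \<Longrightarrow> zsum n f (h ` A) = zsum n (\<lambda>x. f (h x)) A"
  by (simp add: zsum_def sum.reindex)

lemma zsum_zunit_coord:
  assumes "A \<subseteq> {..<n}" "i < n" shows "zsum n (zunit n) A i = 1 \<longleftrightarrow> i \<in> A"
proof -
  have "finite A" using assms(1) finite_subset by blast
  then have "(\<Sum>x\<in>A. zunit n x i) = (if i \<in> A then 1 else 0)"
    using assms(2) by (simp add: zunit_coord)
  then show ?thesis using assms(2) by (simp add: zsum_def)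
qed

lemma zsum_zunit:
  assumes "g \<in> carrier (Z2_pow n)" shows "zsum n (zunit n) {i. i < n \<and> g i = 1} = g"
  by (rule Z2_eqI[OF zsum_closed assms], subst zsum_zunit_coord) auto

text \<open>Two subsets with equal sums have a symmetric difference with zero sum.\<close>

lemma zindep_inj:
  assumes "zindep n f B" "finite B" "A \<subseteq> B" "A' \<subseteq> B" "zsum n f A = zsum n f A'"
  shows "A = A'"
proof -
  have "finite A" "finite A'" using assms finite_subset by auto
  then have "zsum n f ((A - A') \<union> (A' - A)) = \<one>\<^bsub>Z2_pow n\<^esub>"
    using assms(5) by (simp add: zsum_symdiff[symmetric] Z2_square)
  moreover have "(A - A') \<union> (A' - A) \<subseteq> B" using assms by auto
  ultimately have "(A - A') \<union> (A' - A) = {}"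
    using assms(1) unfolding zindep_def by blast
  then show ?thesis by blast
qed

lemma zindep_iso:
  assumes "\<theta> \<in> iso (Z2_pow n) (Z2_pow n)" "finite B" "\<And>x. x \<in> B \<Longrightarrow> f x \<in> carrier (Z2_pow n)"
    "zindep n (\<lambda>x. \<theta> (f x)) B"
  shows "zindep n f B"
  unfolding zindep_def
proof (intro allI impI)
  fix A assume A: "A \<subseteq> B" "zsum n f A = \<one>\<^bsub>Z2_pow n\<^esub>"
  have "\<theta> (zsum n f A) = zsum n (\<lambda>x. \<theta> (f x)) A"
    by (rule zsum_hom) (use assms A finite_subset in \<open>auto simp: iso_iff\<close>)
  then have "zsum n (\<lambda>x. \<theta> (f x)) A = \<one>\<^bsub>Z2_pow n\<^esub>" using A Z2_iso_one[OF assms(1)] by simp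
  then show "A = {}" using assms(4) A(1) unfolding zindep_def by blast
qed

lemma zindep_units:
  assumes "inj_on \<iota> B" "\<iota> ` B \<subseteq> {..<n}"
  shows "zindep n (\<lambda>x. zunit n (\<iota> x)) B"
  unfolding zindep_def
proof (intro allI impI)
  fix A assume A: "A \<subseteq> B" "zsum n (\<lambda>x. zunit n (\<iota> x)) A = \<one>\<^bsub>Z2_pow n\<^esub>"
  have *: "zsum n (\<lambda>x. zunit n (\<iota> x)) A = zsum n (zunit n) (\<iota> ` A)"
    by (rule zsum_reindex[symmetric]) (use A assms inj_on_subset in blast)
  have sub: "\<iota> ` A \<subseteq> {..<n}" using A assms by blast
  show "A = {}"
  proof (rule ccontr)
    assume "A \<noteq> {}"
    then obtain x where "x \<in> A" by blast
    then have "zsum n (zunit n) (\<iota> ` A) (\<iota> x) = 1" using zsum_zunit_coord[OF sub, of "\<iota> x"] sub by auto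
    then show False using A(2) * sub \<open>x \<in> A\<close> by auto
  qed
qed

text \<open>The coordinate isomorphism of a basis, built as the inverse of \<open>L\<close>, which
  adds up the vectors selected by the ones of a bit vector. Independence makes \<open>L\<close>
  injective, and finiteness of the group makes it onto.\<close>

lemma zindep_basis_iso:
  assumes bij: "bij_betw pos B {..<n}" and ind: "zindep n f B"
    and cl: "\<And>x. x \<in> B \<Longrightarrow> f x \<in> carrier (Z2_pow n)"
  obtains \<theta> where "\<theta> \<in> iso (Z2_pow n) (Z2_pow n)" "\<And>x. x \<in> B \<Longrightarrow> \<theta> (f x) = zunit n (pos x)"
proof -
  have fB: "finite B" using bij bij_betw_finite by blast
  define S where "S g = {x\<in>B. g (pos x) = 1}" for g :: "nat \<Rightarrow> int"
  define L where "L g = zsum n f (S g)" for g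
  have posl: "x \<in> B \<Longrightarrow> pos x < n" for x using bij by (auto simp: bij_betw_def)
  have fS: "finite (S g)" for g using fB by (simp add: S_def)
  have Smult: "S (g \<otimes>\<^bsub>Z2_pow n\<^esub> h) = (S g - S h) \<union> (S h - S g)"
    if "g \<in> carrier (Z2_pow n)" "h \<in> carrier (Z2_pow n)" for g h
    using that posl by (auto simp: S_def Z2_mult_coord)
  have hom: "L \<in> hom (Z2_pow n) (Z2_pow n)"
    by (rule homI) (auto simp: L_def Smult zsum_symdiff fS)
  have inj: "inj_on L (carrier (Z2_pow n))"
  proof
    fix g h assume gh: "g \<in> carrier (Z2_pow n)" "h \<in> carrier (Z2_pow n)" "L g = L h"
    have "S g = S h" by (rule zindep_inj[OF ind fB]) (use gh in \<open>auto simp: L_def S_def\<close>)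
    then have "g (pos x) = 1 \<longleftrightarrow> h (pos x) = 1" if "x \<in> B" for x using that by (auto simp: S_def)
    moreover have "\<exists>x\<in>B. i = pos x" if "i < n" for i using bij that by (auto simp: bij_betw_def image_iff)
    ultimately show "g = h" by (metis Z2_eqI gh(1,2))
  qed
  have "L ` carrier (Z2_pow n) = carrier (Z2_pow n)"
    by (rule endo_inj_surj) (use inj in \<open>auto simp: L_def\<close>)
  then have iso: "L \<in> iso (Z2_pow n) (Z2_pow n)" using hom inj by (simp add: iso_iff)
  obtain \<theta> where \<theta>: "\<theta> \<in> iso (Z2_pow n) (Z2_pow n)" "\<And>g. g \<in> carrier (Z2_pow n) \<Longrightarrow> \<theta> (L g) = g"
    using Z2_iso_inverse[OF iso] by metis
  have "\<theta> (f x) = zunit n (pos x)" if "x \<in> B" for x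
  proof -
    have "S (zunit n (pos x)) = {x}"
      using that bij posl by (auto simp: S_def zunit_coord bij_betw_def inj_on_def split: if_splits)
    then have "L (zunit n (pos x)) = f x" using cl that by (simp add: L_def zsum_singleton)
    then show ?thesis using \<theta>(2)[of "zunit n (pos x)"] by simp
  qed
  then show ?thesis using \<theta>(1) that by blast
qed

section \<open>Products of simplices in coordinates\<close>

text \<open>The ambient open set \<open>W\<close> is what remains when the index set is
  empty.\<close>

lemma openin_Collect_ball_finite:
  assumes "finite A" "openin X W" "\<And>i. i \<in> A \<Longrightarrow> openin X {y\<in>W. S i y}"
  shows "openin X {y\<in>W. \<forall>i\<in>A. S i y}"
  using assms(1,3)
proof (induction A)
  case empty
  then show ?case using assms(2) by simp
next
  case (insert a A)
  have eq: "{y\<in>W. \<forall>i\<in>insert a A. S i y} = {y\<in>W. S a y} \<inter> {y\<in>W. \<forall>i\<in>A. S i y}" by auto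
  show ?case unfolding eq by (intro openin_Int insert.IH insert.prems) auto
qed

lemma continuous_map_Euclidean_coordinate: "continuous_map (Euclidean_space n) euclideanreal (\<lambda>x. x i)"
  unfolding Euclidean_space_def
  by (rule continuous_map_from_subtopology, rule continuous_map_product_coordinates) simp

text \<open>
  A product of \<open>m\<close> simplices, seen through its barycentric coordinates: \<open>u (k, t)\<close> is the \<open>t\<close>-th
  coordinate on the \<open>k\<close>-th factor, of dimension \<open>\<omega> k\<close>, so that the facets are indexed by the pairs \<open>(k, t)\<close>.
\<close>

locale simplex_coords =
  fixes P :: "'p topology" and m :: nat and \<omega> :: "nat \<Rightarrow> nat" and u :: "nat \<times> nat \<Rightarrow> 'p \<Rightarrow> real"
  assumes compact_P: "compact_space P" and Hausdorff_P: "Hausdorff_space P"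
    and \<omega>_pos: "\<And>k. k \<in> {1..m} \<Longrightarrow> 1 \<le> \<omega> k"
    and u_cont: "\<And>F. F \<in> (SIGMA k:{1..m}. {..\<omega> k}) \<Longrightarrow> continuous_map P euclideanreal (u F)"
    and u_inj: "\<And>p q. p \<in> topspace P \<Longrightarrow> q \<in> topspace P \<Longrightarrow>
      (\<And>F. F \<in> (SIGMA k:{1..m}. {..\<omega> k}) \<Longrightarrow> u F p = u F q) \<Longrightarrow> p = q"
    and u_nonneg: "\<And>p F. p \<in> topspace P \<Longrightarrow> F \<in> (SIGMA k:{1..m}. {..\<omega> k}) \<Longrightarrow> 0 \<le> u F p"
    and u_sum: "\<And>p k. p \<in> topspace P \<Longrightarrow> k \<in> {1..m} \<Longrightarrow> (\<Sum>t\<le>\<omega> k. u (k, t) p) = 1"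
    and u_surj: "\<And>v. (\<And>F. F \<in> (SIGMA k:{1..m}. {..\<omega> k}) \<Longrightarrow> 0 \<le> v F) \<Longrightarrow>
      (\<And>k. k \<in> {1..m} \<Longrightarrow> (\<Sum>t\<le>\<omega> k. v (k, t)) = 1) \<Longrightarrow>
      \<exists>p \<in> topspace P. \<forall>F \<in> (SIGMA k:{1..m}. {..\<omega> k}). u F p = v F"
begin

definition I where "I = (SIGMA k:{1..m}. {..\<omega> k})"

definition zeros where "zeros p = {F\<in>I. u F p = 0}"

definition facets where "facets = (\<lambda>F. {p \<in> topspace P. u F p = 0}) ` I"

definition dim where "dim = (\<Sum>k\<in>{1..m}. \<omega> k)"

lemma finite_I [simp]: "finite I" by (simp add: I_def)

lemma finite_zeros [simp]: "finite (zeros p)" by (simp add: zeros_def)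

lemma zeros_subset: "zeros p \<subseteq> I" by (auto simp: zeros_def)

lemma I_iff: "(k, t) \<in> I \<longleftrightarrow> k \<in> {1..m} \<and> t \<le> \<omega> k" by (simp add: I_def)

lemma ex_point:
  assumes "\<And>F. F \<in> I \<Longrightarrow> 0 \<le> v F" "\<And>k. k \<in> {1..m} \<Longrightarrow> (\<Sum>t\<le>\<omega> k. v (k, t)) = 1"
  shows "\<exists>p \<in> topspace P. \<forall>F\<in>I. u F p = v F"
  unfolding I_def by (rule u_surj) (use assms in \<open>simp_all add: I_def\<close>)

lemma point_eqI:
  "p \<in> topspace P \<Longrightarrow> q \<in> topspace P \<Longrightarrow> (\<And>F. F \<in> I \<Longrightarrow> u F p = u F q) \<Longrightarrow> p = q"
  using u_inj[of p q] by (auto simp: I_def)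

lemma coord_cont: "F \<in> I \<Longrightarrow> continuous_map P euclideanreal (u F)"
  using u_cont by (simp add: I_def)

lemma coord_nonneg: "p \<in> topspace P \<Longrightarrow> F \<in> I \<Longrightarrow> 0 \<le> u F p"
  using u_nonneg by (simp add: I_def)

text \<open>\<open>P\<close> is abstract, so its topology has to be recovered from the coordinates:
  \<open>D\<close> is positive away from \<open>p\<close>, hence has a positive minimum on the
  compact set outside \<open>V\<close>.\<close>

lemma coord_basis:
  assumes "openin P V" "p \<in> V"
  shows "\<exists>e>0. \<forall>q\<in>topspace P. (\<forall>F\<in>I. \<bar>u F q - u F p\<bar> < e) \<longrightarrow> q \<in> V"
proof -
  have pP: "p \<in> topspace P" using assms openin_subset by blast
  define D where "D q = (\<Sum>F\<in>I. \<bar>u F q - u F p\<bar>)" for q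
  have contD: "continuous_map P euclideanreal D"
    unfolding D_def by (intro continuous_map_sum continuous_map_real_abs continuous_map_diff coord_cont) auto
  let ?K = "topspace P - V"
  have "compactin P ?K"
    by (meson assms(1) closedin_compact_space closedin_diff closedin_topspace compact_P)
  then have comp: "compact (D ` ?K)"
    using image_compactin[OF _ contD] by simp
  have D0: "D q > 0" if "q \<in> ?K" for q
  proof -
    have "q \<noteq> p" using that assms by auto
    then have "\<not> (\<forall>F\<in>I. u F q = u F p)" using point_eqI[of q p] that pP by auto
    then obtain F where F: "F \<in> I" "u F q \<noteq> u F p" by blast
    have "D q \<ge> \<bar>u F q - u F p\<bar>" unfolding D_def by (rule member_le_sum) (use F in auto)
    then show ?thesis using F by linarith
  qed
  show ?thesis
  proof (cases "?K = {}")
    case True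
    then show ?thesis by (intro exI[of _ 1]) auto
  next
    case False
    then obtain d where d: "d \<in> D ` ?K" "\<forall>x \<in> D ` ?K. d \<le> x"
      using compact_attains_inf[OF comp] by blast
    then have "d > 0" using D0 by auto
    \<comment> \<open>Dividing by \<open>card I + 1\<close> makes the bound
      \<open>card I * e\<close> strictly smaller than \<open>d\<close>, also when \<open>I\<close>
      is empty.\<close>
    define e where "e = d / (card I + 1)"
    have e: "e > 0" using \<open>d > 0\<close> by (simp add: e_def)
    have "q \<in> V" if q: "q \<in> topspace P" "\<forall>F\<in>I. \<bar>u F q - u F p\<bar> < e" for q
    proof (rule ccontr)
      assume "q \<notin> V"
      then have "d \<le> D q" using q d by auto
      also have "D q \<le> card I * e"
        unfolding D_def by (rule sum_bounded_above) (use q(2) in force)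
      also have "\<dots> < d" using \<open>d > 0\<close> by (simp add: e_def field_simps)
      finally show False by simp
    qed
    with e show ?thesis by blast
  qed
qed

lemma continuous_map_coordI:
  assumes "\<And>x. x \<in> topspace T \<Longrightarrow> h x \<in> topspace P"
    and "\<And>F. F \<in> I \<Longrightarrow> continuous_map T euclideanreal (\<lambda>x. u F (h x))"
  shows "continuous_map T P h"
  unfolding continuous_map_def
proof (intro conjI allI impI)
  show "h \<in> topspace T \<rightarrow> topspace P" using assms by auto
  fix V assume V: "openin P V"
  show "openin T {x \<in> topspace T. h x \<in> V}"
  proof (subst openin_subopen, intro ballI)
    fix x assume x: "x \<in> {x \<in> topspace T. h x \<in> V}"
    then obtain e where e: "e > 0" "\<forall>q\<in>topspace P. (\<forall>F\<in>I. \<bar>u F q - u F (h x)\<bar> < e) \<longrightarrow> q \<in> V"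
      using coord_basis[OF V] by blast
    let ?W = "{y \<in> topspace T. \<forall>F\<in>I. \<bar>u F (h y) - u F (h x)\<bar> < e}"
    have "openin T {y \<in> topspace T. \<bar>u F (h y) - u F (h x)\<bar> < e}" if "F \<in> I" for F
    proof -
      have "continuous_map T euclideanreal (\<lambda>y. \<bar>u F (h y) - u F (h x)\<bar>)"
        by (intro continuous_map_real_abs continuous_map_diff assms(2) that) auto
      from openin_continuous_map_preimage[OF this, of "{..<e}"] show ?thesis by simp
    qed
    then have "openin T ?W" by (intro openin_Collect_ball_finite) auto
    moreover have "x \<in> ?W" using x e(1) by auto
    moreover have "?W \<subseteq> {x \<in> topspace T. h x \<in> V}" using e(2) assms(1) by auto
    ultimately show "\<exists>W. openin T W \<and> x \<in> W \<and> W \<subseteq> {x \<in> topspace T. h x \<in> V}" by blast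
  qed
qed

section \<open>Segments, vertices and facets in barycentric coordinates\<close>

lemma segment:
  assumes p: "p \<in> topspace P" and q: "q \<in> topspace P"
  obtains r where "continuous_map (top_of_set {0..1::real}) P r" "r 0 = p" "r 1 = q"
    "\<And>t. t \<in> {0..1} \<Longrightarrow> r t \<in> topspace P"
    "\<And>t F. t \<in> {0..1} \<Longrightarrow> F \<in> I \<Longrightarrow> u F (r t) = (1 - t) * u F p + t * u F q"
proof -
  have "\<exists>x \<in> topspace P. (\<forall>F\<in>I. u F x = (1 - t) * u F p + t * u F q)" if t: "t \<in> {0..1}" for t
  proof -
    have 1: "0 \<le> (1 - t) * u F p + t * u F q" if "F \<in> I" for F
      using t coord_nonneg[OF p that] coord_nonneg[OF q that] by simp
    have 2: "(\<Sum>s\<le>\<omega> k. (1 - t) * u (k, s) p + t * u (k, s) q) = 1" if "k \<in> {1..m}" for k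
      unfolding sum.distrib sum_distrib_left[symmetric] u_sum[OF p that] u_sum[OF q that] by simp
    show ?thesis using ex_point[of "\<lambda>F. (1 - t) * u F p + t * u F q", OF 1 2] by blast
  qed
  then have "\<forall>t\<in>{0..1}. \<exists>x. x \<in> topspace P \<and> (\<forall>F\<in>I. u F x = (1 - t) * u F p + t * u F q)" by blast
  from bchoice[OF this] obtain r
    where R: "\<forall>t\<in>{0..1}. r t \<in> topspace P \<and> (\<forall>F\<in>I. u F (r t) = (1 - t) * u F p + t * u F q)" ..
  have r: "r t \<in> topspace P" "\<And>F. F \<in> I \<Longrightarrow> u F (r t) = (1 - t) * u F p + t * u F q" if "t \<in> {0..1}" for t
    using bspec[OF R that] by blast+
  have c: "continuous_map (top_of_set {0..1::real}) P r"
  proof (intro continuous_map_coordI)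
    fix F assume F: "F \<in> I"
    have "continuous_map (top_of_set {0..1::real}) euclideanreal (\<lambda>t. (1 - t) * u F p + t * u F q)"
      unfolding continuous_map_iff_continuous by (intro continuous_intros)
    then show "continuous_map (top_of_set {0..1::real}) euclideanreal (\<lambda>t. u F (r t))"
      by (rule continuous_map_eq) (simp add: r(2)[OF _ F])
  qed (simp add: r(1))
  have "r 0 = p" by (rule point_eqI[OF r(1) p]) (simp_all add: r(2)[of 0])
  moreover have "r 1 = q" by (rule point_eqI[OF r(1) q]) (simp_all add: r(2)[of 1])
  ultimately show ?thesis using that[of r] c r by presburger
qed

text \<open>A combination of nonnegative coordinates with positive weights vanishes only where both
  coordinates vanish.\<close>

lemma zeros_segment:
  assumes "p \<in> topspace P" "q \<in> topspace P" "0 < t" "t < 1" "r \<in> topspace P"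
    "\<And>F. F \<in> I \<Longrightarrow> u F r = (1 - t) * u F p + t * u F q"
  shows "zeros r = zeros p \<inter> zeros q"
proof -
  have "u F r = 0 \<longleftrightarrow> u F p = 0 \<and> u F q = 0" if "F \<in> I" for F
  proof -
    have "0 \<le> (1 - t) * u F p" "0 \<le> t * u F q"
      using assms(3,4) coord_nonneg[OF assms(1) that] coord_nonneg[OF assms(2) that] by simp_all
    then have "u F r = 0 \<longleftrightarrow> (1 - t) * u F p = 0 \<and> t * u F q = 0"
      unfolding assms(6)[OF that] by (rule add_nonneg_eq_0_iff)
    then show ?thesis using assms(3,4) by simp
  qed
  then show ?thesis by (auto simp: zeros_def)
qed

text \<open>A vertex chooses one corner in each factor; the facet \<open>(k, t)\<close> is opposite
  to corner \<open>t\<close>, so it contains the vertex unless \<open>t\<close> is the chosen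
  corner.\<close>

lemma ex_zeros_vertex:
  assumes "\<And>k. k \<in> {1..m} \<Longrightarrow> c k \<le> \<omega> k"
  obtains p where "p \<in> topspace P" "zeros p = {(k, t). (k, t) \<in> I \<and> t \<noteq> c k}"
proof -
  let ?v = "\<lambda>(k, t). if t = c k then 1 else (0::real)"
  have "\<exists>p \<in> topspace P. \<forall>F\<in>I. u F p = ?v F"
    by (rule ex_point) (use assms in \<open>auto simp: I_iff\<close>)
  then obtain p where p: "p \<in> topspace P" "\<And>F. F \<in> I \<Longrightarrow> u F p = ?v F" by blast
  then have "zeros p = {(k, t). (k, t) \<in> I \<and> t \<noteq> c k}" by (auto simp: zeros_def)
  then show ?thesis using p that by blast
qed

text \<open>The barycentre of the facet does it; \<open>\<omega>_pos\<close> leaves at least one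
  corner of the factor to carry the weight.\<close>

lemma ex_zeros_facet:
  assumes "F \<in> I"
  obtains p where "p \<in> topspace P" "zeros p = {F}"
proof -
  obtain k0 t0 where F: "F = (k0, t0)" "k0 \<in> {1..m}" "t0 \<le> \<omega> k0" using assms by (cases F) (auto simp: I_iff)
  let ?v = "\<lambda>(k, t). if k = k0 then (if t = t0 then 0 else 1 / real (\<omega> k)) else 1 / (real (\<omega> k) + 1)"
  have nz: "real (\<omega> k) \<noteq> 0" if "k \<in> {1..m}" for k using \<omega>_pos[OF that] by auto
  have "(\<Sum>t\<le>\<omega> k. ?v (k, t)) = 1" if k: "k \<in> {1..m}" for k
  proof (cases "k = k0")
    case True
    have "(\<Sum>t\<le>\<omega> k. ?v (k, t)) = ?v (k, t0) + (\<Sum>t\<in>{..\<omega> k} - {t0}. ?v (k, t))"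
      by (rule sum.remove) (use F True in auto)
    also have "\<dots> = (\<Sum>t\<in>{..\<omega> k} - {t0}. 1 / real (\<omega> k))"
      using True by (simp cong: sum.cong_simp)
    also have "\<dots> = 1" using nz[OF k] F True by (simp add: card_Diff_singleton_if)
    finally show ?thesis .
  next
    case False
    then have "(\<Sum>t\<le>\<omega> k. ?v (k, t)) = (real (\<omega> k) + 1) * (1 / (real (\<omega> k) + 1))" by simp
    also have "\<dots> = 1" by simp
    finally show ?thesis .
  qed
  then have "\<exists>p \<in> topspace P. \<forall>F\<in>I. u F p = ?v F"
    by (intro ex_point) auto
  then obtain p where p: "p \<in> topspace P" "\<And>F. F \<in> I \<Longrightarrow> u F p = ?v F" by blast
  have "zeros p = {F}"
  proof (intro equalityI subsetI)
    fix F' assume F': "F' \<in> zeros p"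
    obtain k t where kt: "F' = (k, t)" by fastforce
    have "(k, t) \<in> I" "u (k, t) p = 0" using F' kt by (auto simp: zeros_def)
    then have "(k, t) \<in> I" "?v (k, t) = 0" using p(2)[of "(k, t)"] by simp_all
    have "0 < 1 / (real (\<omega> k) + 1)" by simp
    moreover have "1 / (real (\<omega> k) + 1) = 0" if "k \<noteq> k0" using that \<open>?v (k, t) = 0\<close> unfolding case_prod_conv by argo
    ultimately have kk: "k = k0" by fastforce
    then have "t = t0" using nz[of k] \<open>(k, t) \<in> I\<close> \<open>?v (k, t) = 0\<close> by (cases "t = t0") (auto simp: I_iff)
    then show "F' \<in> {F}" using F kt kk by simp
  next
    fix F' assume "F' \<in> {F}"
    then show "F' \<in> zeros p" using assms p(2)[OF assms] F by (simp add: zeros_def)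
  qed
  then show ?thesis using p that by blast
qed

lemma inj_facets: "inj_on (\<lambda>F. {p \<in> topspace P. u F p = 0}) I"
proof
  fix F F' assume F: "F \<in> I" "F' \<in> I" "{p \<in> topspace P. u F p = 0} = {p \<in> topspace P. u F' p = 0}"
  obtain p where p: "p \<in> topspace P" "zeros p = {F}" using ex_zeros_facet[OF F(1)] by blast
  then have "u F p = 0" by (auto simp: zeros_def)
  then have "u F' p = 0" using F p by blast
  then have "F' \<in> zeros p" using F by (simp add: zeros_def)
  then show "F = F'" using p by simp
qed

lemma card_facets_at:
  assumes "p \<in> topspace P" shows "card {F\<in>facets. p \<in> F} = card (zeros p)"
proof -
  have "{F\<in>facets. p \<in> F} = (\<lambda>F. {p \<in> topspace P. u F p = 0}) ` zeros p"
    using assms by (auto simp: facets_def zeros_def)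
  moreover have "inj_on (\<lambda>F. {p \<in> topspace P. u F p = 0}) (zeros p)"
    using inj_facets zeros_subset inj_on_subset by blast
  ultimately show ?thesis by (simp add: card_image)
qed

end

section \<open>Stabilizers in a small cover\<close>

lemma eventually_continuous_map_in:
  fixes r :: "real \<Rightarrow> 'b"
  assumes "continuous_map (top_of_set S) Y r" "openin Y V" "t \<in> S" "r t \<in> V"
  shows "eventually (\<lambda>s. s \<in> S \<and> r s \<in> V) (at t within S)"
proof -
  have "openin (top_of_set S) {s \<in> topspace (top_of_set S). r s \<in> V}"
    by (rule openin_continuous_map_preimage[OF assms(1,2)])
  then obtain T where T: "open T" "{s \<in> S. r s \<in> V} = S \<inter> T" unfolding openin_open by auto
  have "t \<in> T" using T assms(3,4) by blast
  moreover have "\<forall>s\<in>T. s \<noteq> t \<longrightarrow> s \<in> S \<longrightarrow> s \<in> S \<and> r s \<in> V" using T(2) by blast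
  ultimately show ?thesis unfolding eventually_at_topological using T(1) by blast
qed

locale small_cover_over = simplex_coords P m \<omega> u
  for P :: "'p topology" and m \<omega> u +
  fixes M :: "('a, 'p) small_cover"
  assumes M: "M \<in> small_covers dim P facets"
begin

abbreviation "X \<equiv> sc_top M"
abbreviation "act \<equiv> sc_act M"
abbreviation "\<pi> \<equiv> sc_proj M"
abbreviation "G \<equiv> Z2_pow dim"

section \<open>The action and the orbit projection\<close>

lemma Hausdorff_X: "Hausdorff_space X" and compact_X: "compact_space X"
  and action: "group_action G (topspace X) act"
  and quot: "quotient_map X P \<pi>"
  using M by (auto simp: small_covers_def closed_smooth_manifold_def orbit_space_is_def)

lemma act_cont: "g \<in> carrier G \<Longrightarrow> continuous_map X X (act g)"
  using M by (auto simp: small_covers_def smooth_self_map_def)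

lemma act_closed: "g \<in> carrier G \<Longrightarrow> x \<in> topspace X \<Longrightarrow> act g x \<in> topspace X"
  using group_action.element_image[OF action] by blast

lemma act_mult: "g \<in> carrier G \<Longrightarrow> h \<in> carrier G \<Longrightarrow> x \<in> topspace X \<Longrightarrow> act (g \<otimes>\<^bsub>G\<^esub> h) x = act g (act h x)"
  using group_action.composition_rule[OF action] by blast

lemma act_one: "x \<in> topspace X \<Longrightarrow> act \<one>\<^bsub>G\<^esub> x = x"
  using group_action.id_eq_one[OF action] by (metis restrict_apply')

lemma act_act: "g \<in> carrier G \<Longrightarrow> x \<in> topspace X \<Longrightarrow> act g (act g x) = x"
  using act_mult[of g g x] act_one Z2_square by simp

lemma proj_in: "x \<in> topspace X \<Longrightarrow> \<pi> x \<in> topspace P"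
  using continuous_map_image_subset_topspace[OF quotient_imp_continuous_map[OF quot]] by blast

lemma proj_surj: "p \<in> topspace P \<Longrightarrow> \<exists>x \<in> topspace X. \<pi> x = p"
  unfolding quotient_imp_surjective_map[OF quot, symmetric] by blast

lemma proj_eq_iff:
  assumes "x \<in> topspace X" "y \<in> topspace X"
  shows "\<pi> y = \<pi> x \<longleftrightarrow> (\<exists>g\<in>carrier G. y = act g x)"
proof -
  have "{y \<in> topspace X. \<pi> y = \<pi> x} = orbit G act x"
    using M assms(1) by (auto simp: small_covers_def orbit_space_is_def)
  then have "y \<in> {y \<in> topspace X. \<pi> y = \<pi> x} \<longleftrightarrow> y \<in> orbit G act x" by simp
  then show ?thesis using assms by (auto simp: orbit_def)
qed

lemma proj_act: "g \<in> carrier G \<Longrightarrow> x \<in> topspace X \<Longrightarrow> \<pi> (act g x) = \<pi> x"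
  using proj_eq_iff[of x "act g x"] act_closed by blast

text \<open>The saturation of \<open>U\<close> is the union of its translates, which are open
  because the group acts continuously.\<close>

lemma proj_open:
  assumes "openin X U" shows "openin P (\<pi> ` U)"
proof -
  have U: "U \<subseteq> topspace X" by (rule openin_subset[OF assms])
  have eq: "{x \<in> topspace X. \<pi> x \<in> \<pi> ` U} = (\<Union>g\<in>carrier G. {x \<in> topspace X. act g x \<in> U})"
  proof (intro equalityI subsetI)
    fix x assume "x \<in> {x \<in> topspace X. \<pi> x \<in> \<pi> ` U}"
    then obtain y where y: "x \<in> topspace X" "y \<in> U" "\<pi> y = \<pi> x" by force
    then obtain g where "g \<in> carrier G" "y = act g x" using proj_eq_iff[of x y] U by blast
    then show "x \<in> (\<Union>g\<in>carrier G. {x \<in> topspace X. act g x \<in> U})" using y by blast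
  next
    fix x assume "x \<in> (\<Union>g\<in>carrier G. {x \<in> topspace X. act g x \<in> U})"
    then obtain g where g: "g \<in> carrier G" "x \<in> topspace X" "act g x \<in> U" by blast
    have "\<pi> x = \<pi> (act g x)" using proj_act g by simp
    then show "x \<in> {x \<in> topspace X. \<pi> x \<in> \<pi> ` U}" using g by blast
  qed
  have "openin X {x \<in> topspace X. \<pi> x \<in> \<pi> ` U}"
    unfolding eq by (intro openin_Union) (auto intro: openin_continuous_map_preimage[OF act_cont assms])
  moreover have "\<pi> ` U \<subseteq> topspace P" using U proj_in by blast
  ultimately show ?thesis using quot unfolding quotient_map_def by blast
qed

text \<open>The topological content of a standard chart, with its automorphism named and the facets
  counted through \<open>zeros\<close>. Equivalences are homeomorphisms, so the classification works
  with this much.\<close>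

definition std where
  "std W f \<theta> \<longleftrightarrow> openin X W \<and> openin (Euclidean_space dim) (f ` W) \<and>
     homeomorphic_map (subtopology X W) (subtopology (Euclidean_space dim) (f ` W)) f \<and>
     \<theta> \<in> iso G G \<and>
     (\<forall>g\<in>carrier G. \<forall>x\<in>W. act g x \<in> W \<and> f (act g x) = sign_change dim (\<theta> g) (f x)) \<and>
     (\<forall>x\<in>W. card {i. i < dim \<and> f x i = 0} = card (zeros (\<pi> x)))"

lemma ex_std:
  assumes "x \<in> topspace X" shows "\<exists>W f \<theta>. std W f \<theta> \<and> x \<in> W"
proof -
  have "locally_standard dim M" using M by (simp add: small_covers_def)
  then obtain c where c: "standard_chart dim M c" "x \<in> fst c"
    using assms unfolding locally_standard_def by blast
  obtain W f where Wf: "c = (W, f)" by fastforce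
  have ch: "is_chart dim X (W, f)" using c Wf by (simp add: standard_chart_def smooth_chart_def)
  then have W: "openin X W" by (simp add: is_chart_def)
  have "standard_chart dim M (W, f)" using c Wf by simp
  then obtain \<theta> where \<theta>: "\<theta> \<in> iso G G"
    "\<forall>g\<in>carrier G. \<forall>x\<in>W. act g x \<in> W \<and> f (act g x) = sign_change dim (\<theta> g) (f x)"
    unfolding standard_chart_def by auto
  have "orbit_space_is dim P facets M" using M by (simp add: small_covers_def)
  then have "\<forall>x\<in>W. card {i. i < dim \<and> f x i = 0} = card {F \<in> facets. \<pi> x \<in> F}"
    using \<open>standard_chart dim M (W, f)\<close> unfolding orbit_space_is_def by blast
  then have "\<forall>x\<in>W. card {i. i < dim \<and> f x i = 0} = card (zeros (\<pi> x))"
    using card_facets_at proj_in openin_subset[OF W] by auto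
  then have "std W f \<theta>" using ch \<theta> unfolding std_def is_chart_def by simp
  then show ?thesis using c Wf by auto
qed

lemma std_inj: "std W f \<theta> \<Longrightarrow> inj_on f W"
  using homeomorphic_imp_injective_map[of "subtopology X W" "subtopology (Euclidean_space dim) (f ` W)" f]
    openin_subset[of X W]
  by (simp add: std_def Int_absorb1)

lemma std_sub: "std W f \<theta> \<Longrightarrow> W \<subseteq> topspace X"
  unfolding std_def using openin_subset by blast

lemma std_vanish: "std W f \<theta> \<Longrightarrow> y \<in> W \<Longrightarrow> dim \<le> i \<Longrightarrow> f y i = 0"
  unfolding std_def using openin_subset[of "Euclidean_space dim" "f ` W"] by (auto simp: topspace_Euclidean_space)

lemma std_cont: "std W f \<theta> \<Longrightarrow> continuous_map (subtopology X W) (subtopology (Euclidean_space dim) (f ` W)) f"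
  unfolding std_def using homeomorphic_imp_continuous_map by blast

lemma std_open:
  assumes "std W f \<theta>" "open S" shows "openin X {y\<in>W. f y i \<in> S}"
proof -
  have "continuous_map (subtopology X W) (Euclidean_space dim) f"
    using std_cont[OF assms(1)] by (simp add: continuous_map_in_subtopology)
  then have "continuous_map (subtopology X W) euclideanreal (\<lambda>y. f y i)"
    using continuous_map_compose[OF _ continuous_map_Euclidean_coordinate[of dim i]] by (simp add: o_def)
  from openin_continuous_map_preimage[OF this, of S]
  have "openin (subtopology X W) {y \<in> topspace (subtopology X W). f y i \<in> S}" using assms(2) by simp
  moreover have "{y \<in> topspace (subtopology X W). f y i \<in> S} = {y\<in>W. f y i \<in> S}"
    using std_sub[OF assms(1)] by auto
  moreover have "openin X W" using assms(1) by (simp add: std_def)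
  ultimately show ?thesis using openin_trans_full by metis
qed

lemma std_act:
  assumes "std W f \<theta>" "g \<in> carrier G" "y \<in> W"
  shows "act g y \<in> W" "f (act g y) i = (if i < dim \<and> \<theta> g i = 1 then - f y i else f y i)"
  using assms by (auto simp: std_def sign_change_def)

lemma std_zeros: "std W f \<theta> \<Longrightarrow> y \<in> W \<Longrightarrow> card {i. i < dim \<and> f y i = 0} = card (zeros (\<pi> y))"
  by (simp add: std_def)

lemma std_eqI:
  assumes s: "std W f \<theta>" and y: "y \<in> W" "y' \<in> W" and "\<And>i. i < dim \<Longrightarrow> f y i = f y' i"
  shows "y = y'"
proof -
  have "f y = f y'"
  proof
    fix i show "f y i = f y' i" using assms(4) std_vanish[OF s y(1)] std_vanish[OF s y(2)] by (cases "i < dim") auto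
  qed
  then show ?thesis using std_inj[OF s] y by (auto dest: inj_onD)
qed

definition stab where "stab x = {g \<in> carrier G. act g x = x}"

text \<open>A sign change fixes a vector exactly when it flips only vanishing coordinates, and the
  chart is injective.\<close>

lemma std_stab:
  assumes s: "std W f \<theta>" and y: "y \<in> W"
  shows "stab y = {g \<in> carrier G. \<forall>i<dim. \<theta> g i = 1 \<longrightarrow> f y i = 0}"
proof (intro equalityI subsetI)
  fix g assume "g \<in> stab y"
  then have g: "g \<in> carrier G" "act g y = y" by (auto simp: stab_def)
  have "f y i = 0" if "i < dim" "\<theta> g i = 1" for i using std_act(2)[OF s g(1) y, of i] g(2) that by simp
  then show "g \<in> {g \<in> carrier G. \<forall>i<dim. \<theta> g i = 1 \<longrightarrow> f y i = 0}" using g by blast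
next
  fix g assume g: "g \<in> {g \<in> carrier G. \<forall>i<dim. \<theta> g i = 1 \<longrightarrow> f y i = 0}"
  have "act g y = y"
    by (rule std_eqI[OF s]) (use std_act[OF s _ y, of g] g y in auto)
  then show "g \<in> stab y" using g by (simp add: stab_def)
qed

lemma std_abs:
  assumes s: "std W f \<theta>" and y: "y \<in> W" "y' \<in> W" "\<pi> y = \<pi> y'"
  shows "\<bar>f y i\<bar> = \<bar>f y' i\<bar>"
proof -
  obtain g where "g \<in> carrier G" "y = act g y'" using proj_eq_iff[of y' y] y std_sub[OF s] by blast
  then show ?thesis using std_act(2)[OF s _ y(2), of g i] by simp
qed

text \<open>Near \<open>x\<close> the nonzero chart coordinates keep their signs. A nearby point on
  equally many facets has equally many vanishing coordinates, hence the same ones, and so the same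
  stabilizer. It is also determined by its orbit: the orbit gives the absolute values and the
  neighbourhood gives the signs.\<close>

lemma local_rigidity:
  assumes x: "x \<in> topspace X"
  obtains N where "openin X N" "x \<in> N"
    "\<And>y. y \<in> N \<Longrightarrow> card (zeros (\<pi> y)) = card (zeros (\<pi> x)) \<Longrightarrow> stab y = stab x"
    "\<And>y y'. y \<in> N \<Longrightarrow> y' \<in> N \<Longrightarrow> \<pi> y = \<pi> y' \<Longrightarrow> card (zeros (\<pi> y)) = card (zeros (\<pi> x)) \<Longrightarrow> y = y'"
proof -
  obtain W f \<theta> where s: "std W f \<theta>" and xW: "x \<in> W" using ex_std[OF x] by blast
  define N where "N = {y\<in>W. \<forall>i\<in>{i. i < dim \<and> f x i \<noteq> 0}. f y i \<in> {z. 0 < z * f x i}}"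
  have oN: "openin X N"
    unfolding N_def
  proof (rule openin_Collect_ball_finite)
    show "openin X W" using s by (simp add: std_def)
    show "openin X {y\<in>W. f y i \<in> {z. 0 < z * f x i}}" for i
      by (rule std_open[OF s]) (intro open_Collect_less continuous_intros)
  qed simp
  have xN: "x \<in> N"
    using xW by (auto simp: N_def) (metis not_real_square_gt_zero)
  have Z: "{i. i < dim \<and> f y i = 0} = {i. i < dim \<and> f x i = 0}"
    if y: "y \<in> N" "card (zeros (\<pi> y)) = card (zeros (\<pi> x))" for y
  proof (rule card_subset_eq)
    show "{i. i < dim \<and> f y i = 0} \<subseteq> {i. i < dim \<and> f x i = 0}" using y by (force simp: N_def)
    show "card {i. i < dim \<and> f y i = 0} = card {i. i < dim \<and> f x i = 0}"
      using std_zeros[OF s, of y] std_zeros[OF s xW] y by (auto simp: N_def)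
  qed simp
  have Z': "f y i = 0 \<longleftrightarrow> f x i = 0"
    if y: "y \<in> N" "card (zeros (\<pi> y)) = card (zeros (\<pi> x))" "i < dim" for y i
    using Z[OF y(1,2)] y(3) by blast
  show ?thesis
  proof (rule that[OF oN xN])
    fix y assume y: "y \<in> N" "card (zeros (\<pi> y)) = card (zeros (\<pi> x))"
    then have "y \<in> W" by (simp add: N_def)
    then show "stab y = stab x" using Z'[OF y] by (auto simp: std_stab[OF s] xW)
  next
    fix y y' assume y: "y \<in> N" "y' \<in> N" "\<pi> y = \<pi> y'" "card (zeros (\<pi> y)) = card (zeros (\<pi> x))"
    then have W: "y \<in> W" "y' \<in> W" by (auto simp: N_def)
    show "y = y'"
    proof (rule std_eqI[OF s W])
      fix i assume i: "i < dim"
      have a: "\<bar>f y i\<bar> = \<bar>f y' i\<bar>" by (rule std_abs[OF s W y(3)])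
      show "f y i = f y' i"
      proof (cases "f x i = 0")
        case True
        then show ?thesis using Z'[OF y(1,4) i] a by simp
      next
        case False
        then have "0 < f y i * f x i" "0 < f y' i * f x i" using y(1,2) i by (auto simp: N_def)
        then have "(0 < f y i \<and> 0 < f y' i) \<or> (f y i < 0 \<and> f y' i < 0)"
          by (auto simp: zero_less_mult_iff)
        then show ?thesis using a by auto
      qed
    qed
  qed
qed

text \<open>The choice in the fibre does not matter because the group is abelian, see
  \<open>stabP_proj\<close>.\<close>

definition stabP where "stabP p = stab (SOME x. x \<in> topspace X \<and> \<pi> x = p)"

lemma stab_act: 
  assumes "g \<in> carrier G" "x \<in> topspace X" shows "stab (act g x) = stab x"
proof -
  have *: "act h (act g x) = act g (act h x)" if "h \<in> carrier G" for h
    using act_mult[of g h x] act_mult[of h g x] assms that Z2_comm by metis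
  have "act g (act h x) = act g x \<longleftrightarrow> act h x = x" if "h \<in> carrier G" for h
    using act_act[OF assms(1)] assms act_closed[OF that assms(2)] by metis
  then show ?thesis unfolding stab_def using * by auto
qed

lemma stabP_proj:
  assumes "x \<in> topspace X" shows "stabP (\<pi> x) = stab x"
proof -
  let ?y = "SOME y. y \<in> topspace X \<and> \<pi> y = \<pi> x"
  have y: "?y \<in> topspace X \<and> \<pi> ?y = \<pi> x" by (rule someI[of _ x]) (use assms in auto)
  then obtain g where "g \<in> carrier G" "?y = act g x" using proj_eq_iff[OF assms] by blast
  then show ?thesis unfolding stabP_def using stab_act[OF _ assms] by simp
qed

text \<open>The end point is excluded because \<open>q\<close> may lie on more facets than
  \<open>p\<close>.\<close>

lemma segment_zeros_const:
  assumes "p \<in> topspace P" "q \<in> topspace P" "zeros p \<subseteq> zeros q" "r 0 = p"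
    "\<And>t. t \<in> {0..1} \<Longrightarrow> r t \<in> topspace P"
    "\<And>t F. t \<in> {0..1} \<Longrightarrow> F \<in> I \<Longrightarrow> u F (r t) = (1 - t) * u F p + t * u F q"
    "t \<in> {0..<1::real}"
  shows "zeros (r t) = zeros p"
proof (cases "t = 0")
  case False
  have "zeros (r t) = zeros p \<inter> zeros q"
    by (rule zeros_segment[of _ _ t]) (use assms False in auto)
  then show ?thesis using assms(3) by blast
qed (use assms in simp)

lemma stabP_const:
  assumes p: "p \<in> topspace P" and q: "q \<in> topspace P" and Z: "zeros p = zeros q"
  shows "stabP p = stabP q"
proof -
  obtain r where r: "continuous_map (top_of_set {0..1::real}) P r" "r 0 = p" "r 1 = q"
    "\<And>t. t \<in> {0..1} \<Longrightarrow> r t \<in> topspace P"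
    "\<And>t F. t \<in> {0..1} \<Longrightarrow> F \<in> I \<Longrightarrow> u F (r t) = (1 - t) * u F p + t * u F q"
    using segment[OF p q] by metis
  have zr: "zeros (r t) = zeros p" if t: "t \<in> {0..1}" for t
  proof (cases "t = 1")
    case False
    then show ?thesis using segment_zeros_const[OF p q _ r(2,4,5), of t] Z t by auto
  qed (use r Z in simp)
  have "stabP (r 0) = stabP (r 1)"
  proof (rule connected_local_const[of "{0..1::real}" 0 1 "\<lambda>t. stabP (r t)"])
    show "\<forall>t\<in>{0..1}. eventually (\<lambda>s. stabP (r t) = stabP (r s)) (at t within {0..1})"
    proof
      fix t :: real assume t: "t \<in> {0..1}"
      obtain x where x: "x \<in> topspace X" "\<pi> x = r t" using proj_surj[OF r(4)[OF t]] by blast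
      obtain N where N: "openin X N" "x \<in> N"
        "\<And>y. y \<in> N \<Longrightarrow> card (zeros (\<pi> y)) = card (zeros (\<pi> x)) \<Longrightarrow> stab y = stab x"
        using local_rigidity[OF x(1)] by metis
      \<comment> \<open>Openness of \<open>\<pi>\<close> keeps the path inside the image of
        \<open>N\<close> for parameters near \<open>t\<close>, where rigidity compares
        stabilizers.\<close>
      have "eventually (\<lambda>s. s \<in> {0..1} \<and> r s \<in> \<pi> ` N) (at t within {0..1})"
        by (rule eventually_continuous_map_in[OF r(1) proj_open[OF N(1)] t]) (use x N(2) in \<open>metis imageI\<close>)
      then show "eventually (\<lambda>s. stabP (r t) = stabP (r s)) (at t within {0..1})"
      proof (rule eventually_mono)
        fix s assume s: "s \<in> {0..1} \<and> r s \<in> \<pi> ` N"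
        then obtain y where y: "y \<in> N" "r s = \<pi> y" by blast
        have "zeros (\<pi> y) = zeros (\<pi> x)" using zr[of s] zr[OF t] s x y by simp
        then have "stab y = stab x" using N(3)[OF y(1)] by simp
        moreover have "y \<in> topspace X" using y N(1) openin_subset by blast
        ultimately show "stabP (r t) = stabP (r s)" using stabP_proj x y by metis
      qed
    qed
  qed auto
  then show ?thesis using r by simp
qed

end

section \<open>Global sections\<close>

context small_cover_over
begin

text \<open>In a standard chart each orbit has exactly one point with nonnegative coordinates. The
  folding \<open>R\<close> onto these points is continuous and constant on orbits, so it descends
  along the open map \<open>\<pi>\<close>.\<close>

lemma ex_local_section:
  assumes p: "p \<in> topspace P"
  shows "\<exists>V s. openin P V \<and> p \<in> V \<and> continuous_map (subtopology P V) X s \<and> (\<forall>q\<in>V. \<pi> (s q) = q)"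
proof -
  obtain x where x: "x \<in> topspace X" "\<pi> x = p" using proj_surj[OF p] by blast
  obtain W f \<theta> where s: "std W f \<theta>" and xW: "x \<in> W" using ex_std[OF x(1)] by blast
  have oW: "openin X W" and \<theta>: "\<theta> \<in> iso G G"
    and hom: "homeomorphic_map (subtopology X W) (subtopology (Euclidean_space dim) (f ` W)) f"
    using s by (auto simp: std_def)
  note WX = std_sub[OF s]
  define A where "A y = (\<lambda>i. \<bar>y i\<bar>)" for y :: "nat \<Rightarrow> real"
  define R where "R y = inv_into W f (A (f y))" for y
  have AW: "A (f y) \<in> f ` W" if y: "y \<in> W" for y
  proof -
    \<comment> \<open>The automorphism of the chart reaches every sign pattern, in particular the
      one that makes all coordinates of \<open>y\<close> nonnegative.\<close>
    define h where "h = (\<lambda>i\<in>{..<dim}. if f y i < 0 then 1 else 0 :: int)"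
    have "h \<in> carrier G" by (auto simp: h_def Z2_carrier)
    then obtain g where g: "g \<in> carrier G" "\<theta> g = h" using Z2_iso_surj[OF \<theta>] by blast
    have "f (act g y) = A (f y)"
    proof
      fix i show "f (act g y) i = A (f y) i"
        using std_act(2)[OF s g(1) y, of i] g(2) std_vanish[OF s y, of i]
        by (cases "i < dim") (auto simp: h_def A_def)
    qed
    then show ?thesis using std_act(1)[OF s g(1) y] by (metis imageI)
  qed
  have RW: "R y \<in> W" "f (R y) = A (f y)" if "y \<in> W" for y
    unfolding R_def using AW[OF that] by (auto simp: inv_into_into f_inv_into_f)
  have Rpi: "\<pi> (R y) = \<pi> y" if y: "y \<in> W" for y
  proof -
    define h where "h = (\<lambda>i\<in>{..<dim}. if f y i < 0 then 1 else 0 :: int)"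
    have "h \<in> carrier G" by (auto simp: h_def Z2_carrier)
    then obtain g where g: "g \<in> carrier G" "\<theta> g = h" using Z2_iso_surj[OF \<theta>] by blast
    have "act g y = R y"
    proof (rule std_eqI[OF s std_act(1)[OF s g(1) y] RW(1)[OF y]])
      fix i assume "i < dim"
      then show "f (act g y) i = f (R y) i"
        using std_act(2)[OF s g(1) y, of i] g(2) RW(2)[OF y] by (simp add: h_def A_def)
    qed
    then show ?thesis using proj_act[OF g(1), of y] y WX by auto
  qed
  have Req: "R y = R y'" if "y \<in> W" "y' \<in> W" "\<pi> y = \<pi> y'" for y y'
  proof -
    have "A (f y) = A (f y')" unfolding A_def using std_abs[OF s that] by blast
    then show ?thesis by (simp add: R_def)
  qed
  have Rcont: "continuous_map (subtopology X W) X R"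
  proof -
    let ?E = "subtopology (Euclidean_space dim) (f ` W)"
    have tE: "topspace ?E = f ` W"
      using s openin_subset[of "Euclidean_space dim" "f ` W"] by (auto simp: std_def)
    have "continuous_map ?E (Euclidean_space dim) (\<lambda>y i. if i < dim then \<bar>y i\<bar> else 0)"
      unfolding continuous_map_componentwise_Euclidean_space
      by (intro allI impI continuous_map_real_abs continuous_map_from_subtopology continuous_map_Euclidean_coordinate)
    then have "continuous_map ?E (Euclidean_space dim) A"
    proof (rule continuous_map_eq)
      fix y assume "y \<in> topspace ?E"
      then have "y \<in> f ` W" using tE by simp
      then have "y i = 0" if "dim \<le> i" for i using std_vanish[OF s _ that] by blast
      then show "(\<lambda>i. if i < dim then \<bar>y i\<bar> else 0) = A y" by (auto simp: A_def)
    qed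
    then have cA: "continuous_map ?E ?E A"
      unfolding continuous_map_in_subtopology using AW tE by auto
    obtain g where g: "homeomorphic_maps (subtopology X W) ?E f g"
      using hom homeomorphic_map_maps by metis
    have cg: "continuous_map ?E (subtopology X W) g" using g by (simp add: homeomorphic_maps_def)
    have geq: "inv_into W f y = g y" if y: "y \<in> f ` W" for y
    proof -
      obtain w where w: "w \<in> W" "y = f w" using y by blast
      have "g (f w) = w" using g w WX by (auto simp: homeomorphic_maps_def)
      then show ?thesis using w std_inj[OF s] by simp
    qed
    have "continuous_map (subtopology X W) (subtopology X W) (g \<circ> (A \<circ> f))"
      using continuous_map_compose[OF continuous_map_compose[OF std_cont[OF s] cA] cg] by simp
    then have "continuous_map (subtopology X W) X (g \<circ> (A \<circ> f))" by (simp add: continuous_map_in_subtopology)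
    then show ?thesis
    proof (rule continuous_map_eq)
      fix y assume "y \<in> topspace (subtopology X W)"
      then have "y \<in> W" by simp
      then show "(g \<circ> (A \<circ> f)) y = R y" using geq AW by (simp add: R_def)
    qed
  qed
  define V where "V = \<pi> ` W"
  \<comment> \<open>The lift \<open>t\<close> is arbitrary and need not be continuous; composing
    with \<open>R\<close> removes the dependence on the choice.\<close>
  define t where "t q = (SOME y. y \<in> W \<and> \<pi> y = q)" for q
  have t: "t q \<in> W" "\<pi> (t q) = q" if q: "q \<in> V" for q
  proof -
    obtain y where "y \<in> W \<and> \<pi> y = q" using q unfolding V_def by blast
    then have "t q \<in> W \<and> \<pi> (t q) = q" unfolding t_def by (rule someI)
    then show "t q \<in> W" "\<pi> (t q) = q" by auto
  qed
  have VP: "openin P V" unfolding V_def by (rule proj_open[OF oW])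
  have Vt: "topspace (subtopology P V) = V" using openin_subset[OF VP] by auto
  have "continuous_map (subtopology P V) X (\<lambda>q. R (t q))"
    unfolding continuous_map_def
  proof (intro conjI allI impI)
    show "(\<lambda>q. R (t q)) \<in> topspace (subtopology P V) \<rightarrow> topspace X"
      unfolding Vt using RW(1) t(1) WX by blast
    fix U assume U: "openin X U"
    have "openin (subtopology X W) {y \<in> topspace (subtopology X W). R y \<in> U}"
      by (rule openin_continuous_map_preimage[OF Rcont U])
    then have "openin X {y \<in> topspace (subtopology X W). R y \<in> U}"
      using oW openin_trans_full by blast
    moreover have "{y \<in> topspace (subtopology X W). R y \<in> U} = {y\<in>W. R y \<in> U}" using WX by auto
    ultimately have "openin P (\<pi> ` {y\<in>W. R y \<in> U})" using proj_open by simp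
    moreover have "{q \<in> topspace (subtopology P V). R (t q) \<in> U} = \<pi> ` {y\<in>W. R y \<in> U}"
      unfolding Vt
    proof (intro equalityI subsetI)
      fix q assume q: "q \<in> {q \<in> V. R (t q) \<in> U}"
      then have "t q \<in> {y\<in>W. R y \<in> U}" "\<pi> (t q) = q" using t by auto
      then show "q \<in> \<pi> ` {y\<in>W. R y \<in> U}" by (metis imageI)
    next
      fix q assume "q \<in> \<pi> ` {y\<in>W. R y \<in> U}"
      then obtain y where y: "y \<in> W" "R y \<in> U" "q = \<pi> y" by blast
      then have qV: "q \<in> V" unfolding V_def by blast
      have "R (t q) = R y" by (rule Req) (use t[OF qV] y in auto)
      then show "q \<in> {q \<in> V. R (t q) \<in> U}" using y qV by simp
    qed
    ultimately have "openin P {q \<in> topspace (subtopology P V). R (t q) \<in> U}" by simp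
    then show "openin (subtopology P V) {q \<in> topspace (subtopology P V). R (t q) \<in> U}"
      by (rule subset_openin_subtopology) auto
  qed
  moreover have "\<forall>q\<in>V. \<pi> (R (t q)) = q" using Rpi t by auto
  moreover have "p \<in> V" using x xW unfolding V_def by blast
  ultimately show ?thesis using VP by (intro exI[of _ V] exI[of _ "\<lambda>q. R (t q)"]) auto
qed

section \<open>Gluing sections over convex sets\<close>

definition has_section where
  "has_section D \<longleftrightarrow> (\<exists>s. continuous_map (subtopology P D) X s \<and> (\<forall>q\<in>D. \<pi> (s q) = q))"

text \<open>Convexity has to be expressed in barycentric coordinates, since the type of points of
  \<open>P\<close> carries no linear structure.\<close>

definition seg_convex where
  "seg_convex D \<longleftrightarrow> D \<subseteq> topspace P \<and> (\<forall>p\<in>D. \<forall>q\<in>D. \<forall>r\<in>topspace P. \<forall>t\<in>{0..1}.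
     (\<forall>F\<in>I. u F r = (1 - t) * u F p + t * u F q) \<longrightarrow> r \<in> D)"

lemma has_section_mono:
  assumes "has_section D" "D' \<subseteq> D" shows "has_section D'"
proof -
  obtain s where s: "continuous_map (subtopology P D) X s" "\<forall>q\<in>D. \<pi> (s q) = q"
    using assms(1) unfolding has_section_def by blast
  have "continuous_map (subtopology P D') X s" by (rule continuous_map_from_subtopology_mono[OF s(1) assms(2)])
  then show ?thesis unfolding has_section_def using s(2) assms(2) by blast
qed

text \<open>Two sections that agree at \<open>p\<close> agree along every segment from \<open>p\<close> on which the set of facets stays
  constant, hence also at its end point.\<close>

lemma sections_agree:
  assumes D: "seg_convex D" and pq: "p \<in> D" "q \<in> D" and Z: "zeros p \<subseteq> zeros q"
    and s: "continuous_map (subtopology P D) X s" "\<And>y. y \<in> D \<Longrightarrow> \<pi> (s y) = y"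
    and s': "continuous_map (subtopology P D) X s'" "\<And>y. y \<in> D \<Longrightarrow> \<pi> (s' y) = y"
    and eq: "s p = s' p"
  shows "s q = s' q"
proof -
  have DP: "D \<subseteq> topspace P" using D by (simp add: seg_convex_def)
  have p: "p \<in> topspace P" and q: "q \<in> topspace P" using pq DP by auto
  obtain r where r: "continuous_map (top_of_set {0..1::real}) P r" "r 0 = p" "r 1 = q"
    "\<And>t. t \<in> {0..1} \<Longrightarrow> r t \<in> topspace P"
    "\<And>t F. t \<in> {0..1} \<Longrightarrow> F \<in> I \<Longrightarrow> u F (r t) = (1 - t) * u F p + t * u F q"
    using segment[OF p q] by metis
  have rD: "r t \<in> D" if "t \<in> {0..1}" for t
  proof -
    have "\<forall>F\<in>I. u F (r t) = (1 - t) * u F p + t * u F q" using r(5)[OF that] by blast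
    then show ?thesis using D pq r(4)[OF that] that unfolding seg_convex_def by blast
  qed
  have "continuous_map (top_of_set {0..1}) (subtopology P D) r"
    using r(1) rD by (simp add: continuous_map_in_subtopology Pi_iff)
  then have c: "continuous_map (top_of_set {0..1}) X (s \<circ> r)" "continuous_map (top_of_set {0..1}) X (s' \<circ> r)"
    using s(1) s'(1) continuous_map_compose by blast+
  have sX: "(s \<circ> r) t \<in> topspace X" "(s' \<circ> r) t \<in> topspace X" if "t \<in> {0..1}" for t
    using continuous_map_image_subset_topspace[OF c(1)] continuous_map_image_subset_topspace[OF c(2)] that by auto
  have zr: "zeros (r t) = zeros p" if t: "t \<in> {0..<1}" for t
    using segment_zeros_const[OF p q Z r(2,4,5) t] .
  have ne: "eventually (\<lambda>z. (s \<circ> r) z \<noteq> (s' \<circ> r) z) (at t within {0..1})"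
    if t: "t \<in> {0..1}" "(s \<circ> r) t \<noteq> (s' \<circ> r) t" for t
  proof -
    obtain U V where UV: "openin X U" "openin X V" "(s \<circ> r) t \<in> U" "(s' \<circ> r) t \<in> V" "disjnt U V"
      using Hausdorff_X sX[OF t(1)] t(2) unfolding Hausdorff_space_def by metis
    show ?thesis
      using eventually_continuous_map_in[OF c(1) UV(1) t(1) UV(3)] eventually_continuous_map_in[OF c(2) UV(2) t(1) UV(4)]
    proof eventually_elim
      case (elim z)
      then show ?case using UV(5) by (metis disjnt_iff)
    qed
  qed
  \<comment> \<open>On the half-open interval agreement is locally constant: it persists by local
    rigidity, the facets being those of \<open>p\<close>, and disagreement persists because
    \<open>X\<close> is Hausdorff.\<close>
  have loc: "((s \<circ> r) 0 = (s' \<circ> r) 0) = ((s \<circ> r) t = (s' \<circ> r) t)" if t: "t \<in> {0..<1}" for t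
  proof (rule connected_local_const[of "{0..<1::real}" 0 t "\<lambda>t. (s \<circ> r) t = (s' \<circ> r) t"])
    show "\<forall>t\<in>{0..<1}. eventually (\<lambda>z. ((s \<circ> r) t = (s' \<circ> r) t) = ((s \<circ> r) z = (s' \<circ> r) z)) (at t within {0..<1})"
    proof
      fix t :: real assume t: "t \<in> {0..<1}"
      then have t': "t \<in> {0..1}" by auto
      have sub: "eventually Q (at t within {0..<1})" if "eventually Q (at t within {0..1})" for Q
        by (rule filter_leD[OF at_le that]) auto
      have ev: "eventually (\<lambda>z. z \<in> {0..<1}) (at t within {0..<1})"
        by (simp add: eventually_at_filter)
      show "eventually (\<lambda>z. ((s \<circ> r) t = (s' \<circ> r) t) = ((s \<circ> r) z = (s' \<circ> r) z)) (at t within {0..<1})"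
      proof (cases "(s \<circ> r) t = (s' \<circ> r) t")
        case False
        show ?thesis using sub[OF ne[OF t' False]] by (rule eventually_mono) (use False in simp)
      next
        case True
        obtain N where N: "openin X N" "(s \<circ> r) t \<in> N"
          "\<And>y y'. y \<in> N \<Longrightarrow> y' \<in> N \<Longrightarrow> \<pi> y = \<pi> y' \<Longrightarrow> card (zeros (\<pi> y)) = card (zeros (\<pi> ((s \<circ> r) t))) \<Longrightarrow> y = y'"
          using local_rigidity[OF sX(1)[OF t']] by metis
        have N': "(s' \<circ> r) t \<in> N" using N(2) True by simp
        show ?thesis
          using ev sub[OF eventually_continuous_map_in[OF c(1) N(1) t' N(2)]]
            sub[OF eventually_continuous_map_in[OF c(2) N(1) t' N']]
        proof eventually_elim
          case (elim z)
          have z: "z \<in> {0..1}" using elim by auto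
          have pz: "\<pi> ((s \<circ> r) z) = r z" "\<pi> ((s' \<circ> r) z) = r z" "\<pi> ((s \<circ> r) t) = r t"
            using s(2)[OF rD[OF z]] s'(2)[OF rD[OF z]] s(2)[OF rD[OF t']] by auto
          have "(s \<circ> r) z = (s' \<circ> r) z"
            by (rule N(3)) (use elim pz zr[OF t] zr[of z] in auto)
          then show ?case using True by simp
        qed
      qed
    qed
  qed (use t in auto)
  \<comment> \<open>At the end point new facets may appear and rigidity is lost; the limit is
    reached by Hausdorffness alone.\<close>
  have "(s \<circ> r) 1 = (s' \<circ> r) 1"
  proof (rule ccontr)
    assume "(s \<circ> r) 1 \<noteq> (s' \<circ> r) 1"
    then have "eventually (\<lambda>z. (s \<circ> r) z \<noteq> (s' \<circ> r) z) (at 1 within {0..1})" by (intro ne) auto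
    moreover have "eventually (\<lambda>z. z \<in> {0..<1}) (at 1 within {0..1::real})"
      by (auto simp: eventually_at_filter)
    ultimately have "eventually (\<lambda>z. False) (at 1 within {0..1::real})"
    proof eventually_elim
      case (elim z)
      then show ?case using loc[of z] eq r(2) by simp
    qed
    moreover have "at 1 within {0..1::real} \<noteq> bot" by (simp add: at_within_Icc_at_left)
    ultimately show False by (simp add: eventually_False)
  qed
  then show ?thesis using r(3) by simp
qed

text \<open>The second section is translated by a group element chosen at one point of the overlap;
  by \<open>sections_agree\<close> the two then agree on all of it and can be pasted along closed
  sets.\<close>

lemma glue_sections:
  assumes sec: "has_section D1" "has_section D2" and cl: "closedin P D1" "closedin P D2"
    and conv: "seg_convex (D1 \<inter> D2)"
  shows "has_section (D1 \<union> D2)"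
proof -
  have sub: "D1 \<subseteq> topspace P" "D2 \<subseteq> topspace P" using cl closedin_subset by auto
  obtain s1 where s1: "continuous_map (subtopology P D1) X s1" "\<And>q. q \<in> D1 \<Longrightarrow> \<pi> (s1 q) = q"
    using sec(1) unfolding has_section_def by blast
  obtain s2 where s2: "continuous_map (subtopology P D2) X s2" "\<And>q. q \<in> D2 \<Longrightarrow> \<pi> (s2 q) = q"
    using sec(2) unfolding has_section_def by blast
  have s2X: "s2 q \<in> topspace X" if "q \<in> D2" for q
    using continuous_map_image_subset_topspace[OF s2(1)] that sub by auto
  have s1X: "s1 q \<in> topspace X" if "q \<in> D1" for q
    using continuous_map_image_subset_topspace[OF s1(1)] that sub by auto
  have "\<exists>g\<in>carrier G. \<forall>q\<in>D1 \<inter> D2. s1 q = act g (s2 q)"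
  proof (cases "D1 \<inter> D2 = {}")
    case True
    then show ?thesis using Z2_one_closed by blast
  next
    case False
    \<comment> \<open>A minimizer lies on no facet that another point avoids: otherwise the midpoint
      of the two, which is again in the overlap, would lie on fewer facets.\<close>
    obtain c where c: "c \<in> D1 \<inter> D2" "\<And>q. q \<in> D1 \<inter> D2 \<Longrightarrow> card (zeros c) \<le> card (zeros q)"
      using ex_has_least_nat[of "\<lambda>q. q \<in> D1 \<inter> D2" _ "\<lambda>q. card (zeros q)"] False by blast
    have cz: "zeros c \<subseteq> zeros q" if q: "q \<in> D1 \<inter> D2" for q
    proof -
      have cP: "c \<in> topspace P" "q \<in> topspace P" using c q sub by auto
      obtain r where r: "\<And>t. t \<in> {0..1} \<Longrightarrow> r t \<in> topspace P"
        "\<And>t F. t \<in> {0..1} \<Longrightarrow> F \<in> I \<Longrightarrow> u F (r t) = (1 - t) * u F c + t * u F q"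
        using segment[OF cP] by metis
      have h: "(1/2::real) \<in> {0..1}" by simp
      have e: "\<forall>F\<in>I. u F (r (1/2)) = (1 - 1/2) * u F c + 1/2 * u F q" using r(2)[OF h] by blast
      have "r (1/2) \<in> D1 \<inter> D2"
        using conv c(1) q r(1)[OF h] h e unfolding seg_convex_def by blast
      then have le: "card (zeros c) \<le> card (zeros (r (1/2)))" by (rule c(2))
      have "zeros (r (1/2)) = zeros c \<inter> zeros q"
        by (rule zeros_segment[OF cP _ _ r(1)[OF h], of "1/2"]) (use e in auto)
      then have "zeros c \<inter> zeros q = zeros c" using le by (intro card_seteq) auto
      then show ?thesis by blast
    qed
    have "\<pi> (s1 c) = \<pi> (s2 c)" using s1 s2 c(1) by simp
    then obtain g where g: "g \<in> carrier G" "s1 c = act g (s2 c)"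
      using proj_eq_iff[of "s2 c" "s1 c"] s1X s2X c(1) by blast
    have "s1 q = act g (s2 q)" if q: "q \<in> D1 \<inter> D2" for q
    proof -
      have "s1 q = (act g \<circ> s2) q"
      proof (rule sections_agree[OF conv c(1) q cz[OF q]])
        show "continuous_map (subtopology P (D1 \<inter> D2)) X s1"
          by (rule continuous_map_from_subtopology_mono[OF s1(1)]) auto
        show "continuous_map (subtopology P (D1 \<inter> D2)) X (act g \<circ> s2)"
          by (rule continuous_map_compose[OF continuous_map_from_subtopology_mono[OF s2(1)] act_cont[OF g(1)]]) auto
        show "\<pi> (s1 y) = y" if "y \<in> D1 \<inter> D2" for y using s1 that by blast
        show "\<pi> ((act g \<circ> s2) y) = y" if "y \<in> D1 \<inter> D2" for y using s2 that proj_act[OF g(1) s2X] by auto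
        show "s1 c = (act g \<circ> s2) c" using g by simp
      qed
      then show ?thesis by simp
    qed
    then show ?thesis using g(1) by blast
  qed
  then obtain g where g: "g \<in> carrier G" "\<And>q. q \<in> D1 \<inter> D2 \<Longrightarrow> s1 q = act g (s2 q)" by blast
  define s where "s q = (if q \<in> D1 then s1 q else act g (s2 q))" for q
  have "continuous_map (subtopology P (D1 \<union> D2)) X s"
  proof (rule pasting_lemma_closed[where I="{True,False}" and T="\<lambda>b. if b then D1 else D2"
        and f="\<lambda>b. if b then s1 else act g \<circ> s2"])
    show "closedin (subtopology P (D1 \<union> D2)) (if b then D1 else D2)" for b
      by (rule closedin_subset_topspace) (use cl in auto)
    have e: "(D1 \<union> D2) \<inter> D1 = D1" "(D1 \<union> D2) \<inter> D2 = D2" by auto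
    show "continuous_map (subtopology (subtopology P (D1 \<union> D2)) (if b then D1 else D2)) X
         (if b then s1 else act g \<circ> s2)" for b
      using s1(1) continuous_map_compose[OF s2(1) act_cont[OF g(1)]] by (simp add: subtopology_subtopology e)
  qed (auto simp: s_def g(2))
  moreover have "\<pi> (s q) = q" if "q \<in> D1 \<union> D2" for q
    using that s1(2) s2(2) proj_act[OF g(1) s2X] by (auto simp: s_def)
  ultimately show ?thesis unfolding has_section_def by blast
qed

section \<open>Subdivision of \<open>P\<close> into boxes\<close>

definition box where "box a b = {p \<in> topspace P. \<forall>F\<in>I. a F \<le> u F p \<and> u F p \<le> b F}"

lemma box_closed: "closedin P (box a b)"
proof -
  have "box a b = topspace P \<inter> (\<Inter>F\<in>I. {p \<in> topspace P. u F p \<in> {a F..b F}})" by (auto simp: box_def)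
  moreover have "closedin P {p \<in> topspace P. u F p \<in> {a F..b F}}" if "F \<in> I" for F
    by (rule closedin_continuous_map_preimage[OF coord_cont[OF that]]) simp
  moreover have "topspace P \<inter> (\<Inter>F\<in>I. {p \<in> topspace P. u F p \<in> {a F..b F}}) =
      (\<Inter>F\<in>I. {p \<in> topspace P. u F p \<in> {a F..b F}})" if "I \<noteq> {}" using that by blast
  ultimately show ?thesis by (cases "I = {}") (auto intro!: closedin_Inter)
qed

lemma box_convex: "seg_convex (box a b)"
  unfolding seg_convex_def
proof (intro conjI ballI impI)
  fix p q r and t :: real
  assume p: "p \<in> box a b" and q: "q \<in> box a b" and r: "r \<in> topspace P" and t: "t \<in> {0..1}"
    and e: "\<forall>F\<in>I. u F r = (1 - t) * u F p + t * u F q"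
  have "a F \<le> u F r \<and> u F r \<le> b F" if F: "F \<in> I" for F
  proof -
    have pF: "a F \<le> u F p" "u F p \<le> b F" and qF: "a F \<le> u F q" "u F q \<le> b F" using p q F by (auto simp: box_def)
    have "(1 - t) * a F + t * a F \<le> u F r" "u F r \<le> (1 - t) * b F + t * b F"
      unfolding bspec[OF e F] using t pF qF by (intro add_mono mult_left_mono; simp)+
    then show ?thesis by (simp add: algebra_simps)
  qed
  then show "r \<in> box a b" using r by (simp add: box_def)
qed (auto simp: box_def)

text \<open>A Lebesgue number for the maximum of the coordinate differences. Sections exist on balls
  of radius \<open>2 * e p\<close> while the cover uses radius \<open>e p\<close>, so a box of width
  at most \<open>e p\<close> that meets the small ball stays in the large one.\<close>

lemma small_boxes_have_section: "\<exists>\<delta>>0. \<forall>a b. (\<forall>F\<in>I. b F - a F \<le> \<delta>) \<longrightarrow> has_section (box a b)"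
proof -
  define B where "B p e = {q \<in> topspace P. \<forall>F\<in>I. \<bar>u F q - u F p\<bar> < e}" for p e
  have oB: "openin P (B p e)" for p e
    unfolding B_def
  proof (rule openin_Collect_ball_finite)
    fix F assume F: "F \<in> I"
    have "continuous_map P euclideanreal (\<lambda>q. \<bar>u F q - u F p\<bar>)"
      by (intro continuous_map_real_abs continuous_map_diff coord_cont F) auto
    from openin_continuous_map_preimage[OF this, of "{..<e}"]
    show "openin P {q \<in> topspace P. \<bar>u F q - u F p\<bar> < e}" by simp
  qed auto
  have ex: "\<exists>e>0. has_section (B p (2 * e))" if p: "p \<in> topspace P" for p
  proof -
    obtain V s where V: "openin P V" "p \<in> V" "continuous_map (subtopology P V) X s" "\<forall>q\<in>V. \<pi> (s q) = q"
      using ex_local_section[OF p] by blast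
    obtain e where e: "e > 0" "\<forall>q\<in>topspace P. (\<forall>F\<in>I. \<bar>u F q - u F p\<bar> < e) \<longrightarrow> q \<in> V"
      using coord_basis[OF V(1,2)] by blast
    have "has_section V" unfolding has_section_def using V by blast
    moreover have "B p (2 * (e / 2)) \<subseteq> V" using e(2) by (auto simp: B_def)
    ultimately have "has_section (B p (2 * (e / 2)))" by (rule has_section_mono)
    then show ?thesis using e(1) by (intro exI[of _ "e/2"]) auto
  qed
  then have "\<forall>p\<in>topspace P. \<exists>e>0. has_section (B p (2 * e))" by blast
  from bchoice[OF this] obtain e where e: "\<forall>p\<in>topspace P. 0 < e p \<and> has_section (B p (2 * e p))" by blast
  let ?\<U> = "(\<lambda>p. B p (e p)) ` topspace P"
  have "p \<in> B p (e p)" if "p \<in> topspace P" for p using that e by (auto simp: B_def)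
  then have "topspace P \<subseteq> \<Union>?\<U>" by blast
  moreover have "\<And>U. U \<in> ?\<U> \<Longrightarrow> openin P U" using oB by blast
  ultimately obtain \<F> where \<F>: "finite \<F>" "\<F> \<subseteq> ?\<U>" "topspace P \<subseteq> \<Union>\<F>"
    using compact_P unfolding compact_space_alt by metis
  obtain T where T: "finite T" "T \<subseteq> topspace P" "\<F> = (\<lambda>p. B p (e p)) ` T"
    using finite_subset_image[OF \<F>(1,2)] by blast
  \<comment> \<open>The element 1 keeps the minimum defined when \<open>T\<close> is empty.\<close>
  define \<delta> where "\<delta> = Min (insert 1 (e ` T))"
  have d0: "\<delta> > 0" unfolding \<delta>_def using T e by (subst Min_gr_iff) auto
  have dle: "\<delta> \<le> e p" if "p \<in> T" for p unfolding \<delta>_def using T(1) that by (intro Min_le) auto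
  have "has_section (box a b)" if ab: "\<forall>F\<in>I. b F - a F \<le> \<delta>" for a b
  proof (cases "box a b = {}")
    case True
    then show ?thesis by (simp add: has_section_def)
  next
    case False
    then obtain q where q: "q \<in> box a b" by blast
    then have "q \<in> topspace P" by (simp add: box_def)
    then obtain p where p: "p \<in> T" "q \<in> B p (e p)" using \<F>(3) T(3) by blast
    have "box a b \<subseteq> B p (2 * e p)"
    proof
      fix x assume x: "x \<in> box a b"
      have "\<bar>u F x - u F p\<bar> < 2 * e p" if F: "F \<in> I" for F
      proof -
        have "\<bar>u F q - u F p\<bar> < e p" using p(2) F by (simp add: B_def)
        moreover have "a F \<le> u F x" "u F x \<le> b F" "a F \<le> u F q" "u F q \<le> b F"
          using x q F by (auto simp: box_def)
        moreover have "b F - a F \<le> e p" using ab F dle[OF p(1)] by force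
        ultimately show ?thesis by linarith
      qed
      then show "x \<in> B p (2 * e p)" using x by (simp add: B_def box_def)
    qed
    moreover have "has_section (B p (2 * e p))" using e T(2) p(1) by blast
    ultimately show ?thesis using has_section_mono by blast
  qed
  then show ?thesis using d0 by blast
qed

lemma box_split:
  assumes F0: "F0 \<in> I" and c: "a F0 \<le> c" "c \<le> b F0"
  shows "box a b = box a (b(F0 := c)) \<union> box (a(F0 := c)) b"
proof -
  have "p \<in> box a (b(F0 := c)) \<longleftrightarrow> p \<in> box a b \<and> u F0 p \<le> c" for p
  proof -
    have "(\<forall>F\<in>I. a F \<le> u F p \<and> u F p \<le> (b(F0 := c)) F) \<longleftrightarrow>
        (\<forall>F\<in>I. (a F \<le> u F p \<and> u F p \<le> b F) \<and> (F = F0 \<longrightarrow> u F0 p \<le> c))"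
      using c by (intro ball_cong refl) auto
    then show ?thesis using F0 by (auto simp: box_def)
  qed
  moreover have "p \<in> box (a(F0 := c)) b \<longleftrightarrow> p \<in> box a b \<and> c \<le> u F0 p" for p
  proof -
    have "(\<forall>F\<in>I. (a(F0 := c)) F \<le> u F p \<and> u F p \<le> b F) \<longleftrightarrow>
        (\<forall>F\<in>I. (a F \<le> u F p \<and> u F p \<le> b F) \<and> (F = F0 \<longrightarrow> c \<le> u F0 p))"
      using c by (intro ball_cong refl) auto
    then show ?thesis using F0 by (auto simp: box_def)
  qed
  ultimately show ?thesis using linear by blast
qed

lemma seg_convexD:
  "seg_convex D \<Longrightarrow> p \<in> D \<Longrightarrow> q \<in> D \<Longrightarrow> r \<in> topspace P \<Longrightarrow> t \<in> {0..1}
    \<Longrightarrow> \<forall>F\<in>I. u F r = (1 - t) * u F p + t * u F q \<Longrightarrow> r \<in> D"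
  unfolding seg_convex_def by blast

lemma seg_convex_Int:
  assumes "seg_convex D" "seg_convex D'" shows "seg_convex (D \<inter> D')"
  unfolding seg_convex_def
proof (intro conjI ballI impI)
  show "D \<inter> D' \<subseteq> topspace P" using assms by (auto simp: seg_convex_def)
  fix p q r t assume pq: "p \<in> D \<inter> D'" "q \<in> D \<inter> D'" and r: "r \<in> topspace P" "t \<in> {0..1}"
    "\<forall>F\<in>I. u F r = (1 - t) * u F p + t * u F q"
  show "r \<in> D \<inter> D'"
    using seg_convexD[OF assms(1) _ _ r] seg_convexD[OF assms(2) _ _ r] pq by simp
qed

text \<open>Two nested inductions: on the set \<open>A\<close> of coordinates in which the box may
  still be wide, and for one of them on the number \<open>k\<close> of slices of width
  \<open>\<delta>\<close> that cover it.\<close>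

lemma boxes_have_section: "has_section (box a b)"
proof -
  obtain \<delta> where \<delta>: "\<delta> > 0" "\<And>a b. \<forall>F\<in>I. b F - a F \<le> \<delta> \<Longrightarrow> has_section (box a b)"
    using small_boxes_have_section by blast
  have "finite A \<Longrightarrow> A \<subseteq> I \<Longrightarrow> \<forall>F\<in>I - A. b F - a F \<le> \<delta> \<Longrightarrow> has_section (box a b)" for A a b
  proof (induction A arbitrary: a b rule: finite_induct)
    case empty
    then show ?case using \<delta>(2) by simp
  next
    case (insert F0 A)
    have F0: "F0 \<in> I" using insert.prems by simp
    have "\<forall>F\<in>I - insert F0 A. b F - a F \<le> \<delta> \<Longrightarrow> b F0 - a F0 \<le> real k * \<delta> \<Longrightarrow> has_section (box a b)" for k a b
    proof (induction k arbitrary: a b)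
      case 0
      then have "\<forall>F\<in>I - A. b F - a F \<le> \<delta>" using \<delta>(1) by fastforce
      then show ?case using insert.IH insert.prems by blast
    next
      case (Suc k)
      show ?case
      proof (cases "b F0 - a F0 \<le> \<delta>")
        case True
        then have "\<forall>F\<in>I - A. b F - a F \<le> \<delta>" using Suc.prems by blast
        then show ?thesis using insert.IH insert.prems by blast
      next
        case False
        define c where "c = a F0 + \<delta>"
        have c: "a F0 \<le> c" "c \<le> b F0" using False \<delta>(1) by (auto simp: c_def)
        have "has_section (box a (b(F0 := c)))"
        proof -
          have "\<forall>F\<in>I - A. (b(F0 := c)) F - a F \<le> \<delta>" using Suc.prems(1) by (auto simp: c_def)
          then show ?thesis using insert.IH insert.prems by blast
        qed
        moreover have "has_section (box (a(F0 := c)) b)"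
        proof (rule Suc.IH)
          show "\<forall>F\<in>I - insert F0 A. b F - (a(F0 := c)) F \<le> \<delta>" using Suc.prems(1) by auto
          show "b F0 - (a(F0 := c)) F0 \<le> real k * \<delta>" using Suc.prems(2) by (simp add: c_def algebra_simps)
        qed
        ultimately show ?thesis
          unfolding box_split[where a=a and b=b, OF F0 c] by (rule glue_sections) (auto simp: box_closed intro: seg_convex_Int box_convex)
      qed
    qed
    moreover have "\<exists>k. b F0 - a F0 \<le> real k * \<delta>" using \<delta>(1) by (meson ex_less_of_nat_mult less_imp_le)
    ultimately show ?case using insert.prems(2) by blast
  qed
  from this[of I b a] show ?thesis by simp
qed

text \<open>\<open>P\<close> is itself a box, since nonnegative coordinates with sum 1 are at most
  1.\<close>

lemma ex_section:
  obtains s where "continuous_map P X s" "\<And>p. p \<in> topspace P \<Longrightarrow> \<pi> (s p) = p"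
proof -
  have "box (\<lambda>_. 0) (\<lambda>_. 1) = topspace P"
  proof -
    have "u F p \<le> 1" if p: "p \<in> topspace P" and F: "F \<in> I" for F p
    proof -
      obtain k t where kt: "F = (k, t)" "k \<in> {1..m}" "t \<le> \<omega> k" using F by (cases F) (auto simp: I_iff)
      have "u (k, t) p \<le> (\<Sum>t\<le>\<omega> k. u (k, t) p)"
        by (rule member_le_sum) (use kt p coord_nonneg in \<open>auto simp: I_iff\<close>)
      then show ?thesis using u_sum[OF p kt(2)] kt(1) by simp
    qed
    then show ?thesis by (auto simp: box_def coord_nonneg)
  qed
  then have "has_section (topspace P)" using boxes_have_section by metis
  then show ?thesis unfolding has_section_def using that by auto
qed

end

section \<open>Classification by characteristic functions\<close>

text \<open>The subgroup generated by the characteristic vectors of the facets through a point is written as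
  the set of their subset sums.\<close>

definition (in simplex_coords) char_of :: "('a, 'p) small_cover \<Rightarrow> (nat \<times> nat \<Rightarrow> nat \<Rightarrow> int) \<Rightarrow> bool" where
  "char_of M lam \<longleftrightarrow> (\<forall>F\<in>I. lam F \<in> carrier (Z2_pow dim)) \<and>
     (\<forall>p\<in>topspace P. zindep dim lam (zeros p)) \<and>
     (\<forall>x\<in>topspace (sc_top M). \<forall>g\<in>carrier (Z2_pow dim).
        sc_act M g x = x \<longleftrightarrow> g \<in> zsum dim lam ` Pow (zeros (sc_proj M x)))"

context small_cover_over
begin

text \<open>Every vanishing coordinate except the \<open>i\<close>-th is moved to a small positive
  value. The result stays in the chart and off the facets that miss \<open>\<pi> x\<close>; a single
  vanishing coordinate means a single facet, which therefore passes through
  \<open>\<pi> x\<close>.\<close>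

lemma std_nearby_facet:
  assumes s: "std W f \<theta>" and x: "x \<in> W" and i: "i < dim" "f x i = 0"
  shows "\<exists>y F. y \<in> W \<and> F \<in> zeros (\<pi> x) \<and> zeros (\<pi> y) = {F} \<and> {j. j < dim \<and> f y j = 0} = {i}"
proof -
  let ?E = "Euclidean_space dim"
  have WX: "W \<subseteq> topspace X" by (rule std_sub[OF s])
  have oW: "openin X W" and ofW: "openin ?E (f ` W)"
    and hom: "homeomorphic_map (subtopology X W) (subtopology ?E (f ` W)) f"
    using s by (auto simp: std_def)
  \<comment> \<open>Facets that miss \<open>\<pi> x\<close> are kept away by an open condition on
    their coordinates.\<close>
  define N where "N = {q \<in> topspace P. \<forall>F\<in>I - zeros (\<pi> x). u F q \<in> {0<..}}"
  have oN: "openin P N"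
    unfolding N_def
  proof (rule openin_Collect_ball_finite)
    fix F assume "F \<in> I - zeros (\<pi> x)"
    then have "F \<in> I" by blast
    from openin_continuous_map_preimage[OF coord_cont[OF this], of "{0<..}"]
    show "openin P {q \<in> topspace P. u F q \<in> {0<..}}" by simp
  qed auto
  have xX: "x \<in> topspace X" using x WX by blast
  have xN: "\<pi> x \<in> N"
  proof -
    have "0 < u F (\<pi> x)" if "F \<in> I - zeros (\<pi> x)" for F
      using that coord_nonneg[OF proj_in[OF xX], of F] by (auto simp: zeros_def)
    then show ?thesis using proj_in[OF xX] by (simp add: N_def)
  qed
  define O' where "O' = {y \<in> topspace X. \<pi> y \<in> N} \<inter> W"
  have oO: "openin X O'"
    unfolding O'_def
    by (intro openin_Int oW openin_continuous_map_preimage[OF quotient_imp_continuous_map[OF quot] oN])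
  have "openin (subtopology X W) O'" by (rule subset_openin_subtopology[OF oO]) (auto simp: O'_def)
  then have "openin (subtopology ?E (f ` W)) (f ` O')"
    using homeomorphic_imp_open_map[OF hom] unfolding open_map_def by blast
  then have ofO: "openin ?E (f ` O')" using ofW openin_trans_full by blast
  define z where "z e = (\<lambda>j. if j < dim then (if j \<noteq> i \<and> f x j = 0 then e else f x j) else 0)" for e :: real
  have "continuous_map euclideanreal ?E z"
    unfolding z_def continuous_map_componentwise_Euclidean_space
    by (auto simp del: continuous_map_iff_continuous2)
  then have "openin euclideanreal {e \<in> topspace euclideanreal. z e \<in> f ` O'}"
    by (rule openin_continuous_map_preimage[OF _ ofO])
  then have op: "open {e. z e \<in> f ` O'}" by simp
  have "z 0 = f x" using std_vanish[OF s x] by (auto simp: z_def)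
  then have "0 \<in> {e. z e \<in> f ` O'}" using x xN xX by (auto simp: O'_def)
  then obtain d where d: "d > 0" "ball 0 d \<subseteq> {e. z e \<in> f ` O'}" using op open_contains_ball by blast
  have "d / 2 \<in> ball 0 d" using d(1) by simp
  then obtain y where y: "y \<in> O'" "f y = z (d / 2)" using d(2) by (metis imageE mem_Collect_eq subsetD)
  have yW: "y \<in> W" using y by (simp add: O'_def)
  have Zy: "{j. j < dim \<and> f y j = 0} = {i}" using y(2) d(1) i by (auto simp: z_def)
  then have "card (zeros (\<pi> y)) = 1" using std_zeros[OF s yW] by simp
  then obtain F where F: "zeros (\<pi> y) = {F}" using card_1_singletonE by blast
  have "F \<in> zeros (\<pi> x)"
  proof (rule ccontr)
    assume "F \<notin> zeros (\<pi> x)"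
    moreover have "F \<in> I" "u F (\<pi> y) = 0" using F by (auto simp: zeros_def)
    moreover have "\<forall>F\<in>I - zeros (\<pi> x). u F (\<pi> y) \<in> {0<..}" using y(1) by (simp add: O'_def N_def)
    ultimately have "u F (\<pi> y) \<in> {0<..}" by blast
    then show False using \<open>u F (\<pi> y) = 0\<close> by simp
  qed
  then show ?thesis using yW F Zy by blast
qed

text \<open>\<open>\<iota>\<close> matches the facets at \<open>p\<close> with the vanishing
  coordinates of a chart. It is inverse to the map \<open>\<phi>\<close> that reads off the facet
  reached near coordinate \<open>i\<close>. If \<open>\<phi>\<close> identified two coordinates, the
  stabilizer over one facet would be generated by two different sign changes; counting then makes
  \<open>\<phi>\<close> a bijection.\<close>

lemma facet_stabilizer:
  assumes p: "p \<in> topspace P"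
  shows "\<exists>\<theta> \<iota>. \<theta> \<in> iso G G \<and> inj_on \<iota> (zeros p) \<and> \<iota> ` zeros p \<subseteq> {..<dim} \<and>
    stabP p = {g\<in>carrier G. \<forall>i<dim. \<theta> g i = 1 \<longrightarrow> i \<in> \<iota> ` zeros p} \<and>
    (\<forall>F\<in>zeros p. \<forall>q\<in>topspace P. zeros q = {F} \<longrightarrow>
       stabP q = {g\<in>carrier G. \<forall>i<dim. \<theta> g i = 1 \<longrightarrow> i = \<iota> F})"
proof -
  obtain x where x: "x \<in> topspace X" "\<pi> x = p" using proj_surj[OF p] by blast
  obtain W f \<theta> where s: "std W f \<theta>" and xW: "x \<in> W" using ex_std[OF x(1)] by blast
  have \<theta>: "\<theta> \<in> iso G G" using s by (simp add: std_def)
  define J where "J = {i. i < dim \<and> f x i = 0}"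
  have "\<forall>i\<in>J. \<exists>yF. fst yF \<in> W \<and> snd yF \<in> zeros p \<and> zeros (\<pi> (fst yF)) = {snd yF} \<and> {j. j < dim \<and> f (fst yF) j = 0} = {i}"
    using std_nearby_facet[OF s xW] x(2) by (fastforce simp: J_def)
  from bchoice[OF this] obtain yF where yF: "\<And>i. i \<in> J \<Longrightarrow> fst (yF i) \<in> W \<and> snd (yF i) \<in> zeros p \<and>
      zeros (\<pi> (fst (yF i))) = {snd (yF i)} \<and> {j. j < dim \<and> f (fst (yF i)) j = 0} = {i}" by blast
  define y where "y i = fst (yF i)" for i
  define \<phi> where "\<phi> i = snd (yF i)" for i
  have y: "y i \<in> W" "\<phi> i \<in> zeros p" "zeros (\<pi> (y i)) = {\<phi> i}" "{j. j < dim \<and> f (y i) j = 0} = {i}" if "i \<in> J" for i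
    using yF[OF that] by (auto simp: y_def \<phi>_def)
  have yX: "y i \<in> topspace X" if "i \<in> J" for i using y(1)[OF that] std_sub[OF s] by blast
  have st: "stabP (\<pi> (y i)) = {g\<in>carrier G. \<forall>j<dim. \<theta> g j = 1 \<longrightarrow> j = i}" if i: "i \<in> J" for i
  proof -
    have "f (y i) j = 0 \<longleftrightarrow> j = i" if "j < dim" for j using y(4)[OF i] that by blast
    then show ?thesis unfolding stabP_proj[OF yX[OF i]] std_stab[OF s y(1)[OF i]] by auto
  qed
  have inj: "inj_on \<phi> J"
  proof
    fix i i' assume i: "i \<in> J" "i' \<in> J" "\<phi> i = \<phi> i'"
    have "stabP (\<pi> (y i)) = stabP (\<pi> (y i'))"
      by (rule stabP_const) (use i y(3) proj_in[OF yX] in auto)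
    \<comment> \<open>The \<open>i\<close>-th sign change fixes \<open>y i\<close>; once it also
      lies in the stabilizer belonging to \<open>i'\<close>, its only one must sit at
      \<open>i'\<close>.\<close>
    moreover obtain g where g: "g \<in> carrier G" "\<theta> g = zunit dim i" using Z2_iso_surj[OF \<theta> zunit_closed] by blast
    have "g \<in> stabP (\<pi> (y i))" unfolding st[OF i(1)] using g by (auto simp: zunit_coord split: if_splits)
    ultimately have "g \<in> stabP (\<pi> (y i'))" by simp
    moreover have "i < dim" using i by (simp add: J_def)
    ultimately show "i = i'" unfolding st[OF i(2)] using g(2) by (auto simp: zunit_coord)
  qed
  have "card J = card (zeros p)" using std_zeros[OF s xW] x(2) by (simp add: J_def)
  then have im: "\<phi> ` J = zeros p"
    using inj y(2) by (intro card_subset_eq) (auto simp: card_image)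
  define \<iota> where "\<iota> = inv_into J \<phi>"
  have \<iota>: "\<iota> F \<in> J" "\<phi> (\<iota> F) = F" if "F \<in> zeros p" for F
    unfolding \<iota>_def using that im by (auto simp: inv_into_into f_inv_into_f)
  have im2: "\<iota> ` zeros p = J"
    unfolding im[symmetric] \<iota>_def using inj by (simp add: image_image)
  show ?thesis
  proof (intro exI conjI ballI impI)
    show "\<theta> \<in> iso G G" by (rule \<theta>)
    show "inj_on \<iota> (zeros p)" by (rule inj_on_inverseI[of _ \<phi>]) (use \<iota> in auto)
    show "\<iota> ` zeros p \<subseteq> {..<dim}" unfolding im2 by (auto simp: J_def)
    show "stabP p = {g\<in>carrier G. \<forall>i<dim. \<theta> g i = 1 \<longrightarrow> i \<in> \<iota> ` zeros p}"
      using stabP_proj[OF x(1)] unfolding im2 x(2) std_stab[OF s xW] by (auto simp: J_def)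
    fix F q assume F: "F \<in> zeros p" "q \<in> topspace P" "zeros q = {F}"
    have "stabP q = stabP (\<pi> (y (\<iota> F)))"
      by (rule stabP_const) (use F y(3)[OF \<iota>(1)[OF F(1)]] \<iota>(2)[OF F(1)] proj_in[OF yX[OF \<iota>(1)[OF F(1)]]] in auto)
    then show "stabP q = {g\<in>carrier G. \<forall>i<dim. \<theta> g i = 1 \<longrightarrow> i = \<iota> F}" using st[OF \<iota>(1)[OF F(1)]] by simp
  qed
qed

text \<open>The vector of a facet is a nontrivial element of the stabilizer over a relative interior
  point. The automorphism of a chart at any point of the facet turns it into a unit vector, which
  gives independence and generation there.\<close>

lemma ex_char: "\<exists>lam. char_of M lam"
proof -
  have "\<forall>F\<in>I. \<exists>q. q \<in> topspace P \<and> zeros q = {F}" using ex_zeros_facet by metis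
  from bchoice[OF this] obtain q where q: "\<And>F. F \<in> I \<Longrightarrow> q F \<in> topspace P \<and> zeros (q F) = {F}" by blast
  have "\<forall>F\<in>I. \<exists>g. g \<in> stabP (q F) \<and> g \<noteq> \<one>\<^bsub>G\<^esub>"
  proof
    fix F assume F: "F \<in> I"
    have Fz: "F \<in> zeros (q F)" using q[OF F] by simp
    have qF: "q F \<in> topspace P" using q[OF F] by blast
    obtain \<theta> \<iota> where t: "\<theta> \<in> iso G G" "inj_on \<iota> (zeros (q F))" "\<iota> ` zeros (q F) \<subseteq> {..<dim}"
      "stabP (q F) = {g\<in>carrier G. \<forall>i<dim. \<theta> g i = 1 \<longrightarrow> i \<in> \<iota> ` zeros (q F)}"
      "\<forall>F'\<in>zeros (q F). \<forall>q'\<in>topspace P. zeros q' = {F'} \<longrightarrow>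
       stabP q' = {g\<in>carrier G. \<forall>i<dim. \<theta> g i = 1 \<longrightarrow> i = \<iota> F'}"
      using facet_stabilizer[OF qF] by (elim exE conjE) (rule that)
    obtain g where g: "g \<in> carrier G" "\<theta> g = zunit dim (\<iota> F)" using Z2_iso_surj[OF t(1) zunit_closed] by blast
    have "stabP (q F) = {g\<in>carrier G. \<forall>i<dim. \<theta> g i = 1 \<longrightarrow> i = \<iota> F}" using t(5) Fz q[OF F] by blast
    then have "g \<in> stabP (q F)" using g by (auto simp: zunit_coord split: if_splits)
    moreover have "g \<noteq> \<one>\<^bsub>G\<^esub>"
    proof
      assume "g = \<one>\<^bsub>G\<^esub>"
      then have "zunit dim (\<iota> F) = \<one>\<^bsub>G\<^esub>" using g(2) Z2_iso_one[OF t(1)] by simp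
      moreover have "\<iota> F < dim" using t(3) Fz by blast
      ultimately have "zunit dim (\<iota> F) (\<iota> F) = 0" by simp
      then show False using \<open>\<iota> F < dim\<close> by (simp add: zunit_coord)
    qed
    ultimately show "\<exists>g. g \<in> stabP (q F) \<and> g \<noteq> \<one>\<^bsub>G\<^esub>" by blast
  qed
  from bchoice[OF this] obtain lam where lam: "\<And>F. F \<in> I \<Longrightarrow> lam F \<in> stabP (q F) \<and> lam F \<noteq> \<one>\<^bsub>G\<^esub>" by blast
  have lamG: "lam F \<in> carrier G" if "F \<in> I" for F using lam[OF that] by (simp add: stabP_def stab_def)
  have main: "zindep dim lam (zeros p) \<and> stabP p = zsum dim lam ` Pow (zeros p)" if p: "p \<in> topspace P" for p
  proof -
    obtain \<theta> \<iota> where t: "\<theta> \<in> iso G G" "inj_on \<iota> (zeros p)" "\<iota> ` zeros p \<subseteq> {..<dim}"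
      "stabP p = {g\<in>carrier G. \<forall>i<dim. \<theta> g i = 1 \<longrightarrow> i \<in> \<iota> ` zeros p}"
      "\<forall>F\<in>zeros p. \<forall>q\<in>topspace P. zeros q = {F} \<longrightarrow>
       stabP q = {g\<in>carrier G. \<forall>i<dim. \<theta> g i = 1 \<longrightarrow> i = \<iota> F}"
      using facet_stabilizer[OF p] by (elim exE conjE) (rule that)
    have th: "\<theta> (lam F) = zunit dim (\<iota> F)" if F: "F \<in> zeros p" for F
    proof -
      have FI: "F \<in> I" using F zeros_subset by blast
      have "stabP (q F) = {g\<in>carrier G. \<forall>i<dim. \<theta> g i = 1 \<longrightarrow> i = \<iota> F}" using t(5) F q[OF FI] by blast
      then have a: "\<forall>i<dim. \<theta> (lam F) i = 1 \<longrightarrow> i = \<iota> F" using lam[OF FI] by blast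
      have b: "\<theta> (lam F) \<in> carrier G" by (rule Z2_iso_closed[OF t(1) lamG[OF FI]])
      have "\<theta> (lam F) \<noteq> \<one>\<^bsub>G\<^esub>"
        using Z2_iso_eq_iff[OF t(1) lamG[OF FI] Z2_one_closed] Z2_iso_one[OF t(1)] lam[OF FI] by simp
      then have "\<exists>i<dim. \<theta> (lam F) i = 1" using Z2_eqI[OF b Z2_one_closed] by fastforce
      then obtain i where i: "i < dim" "\<theta> (lam F) i = 1" by blast
      then have "i = \<iota> F" using a by simp
      with i(2) have one: "\<theta> (lam F) (\<iota> F) = 1" by simp
      show ?thesis
      proof (rule Z2_eqI[OF b zunit_closed])
        fix j assume j: "j < dim"
        show "\<theta> (lam F) j = 1 \<longleftrightarrow> zunit dim (\<iota> F) j = 1"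
        proof (cases "j = \<iota> F")
          case True
          then show ?thesis using one j by (simp add: zunit_coord)
        next
          case False
          have "\<theta> (lam F) j \<noteq> 1" using a j False by blast
          then show ?thesis using False j by (simp add: zunit_coord)
        qed
      qed
    qed
    have lz: "lam F \<in> carrier G" if "F \<in> zeros p" for F using that zeros_subset lamG by blast
    have "zindep dim (\<lambda>F. \<theta> (lam F)) (zeros p)"
      unfolding zindep_def
    proof (intro allI impI)
      fix A assume A: "A \<subseteq> zeros p" "zsum dim (\<lambda>F. \<theta> (lam F)) A = \<one>\<^bsub>G\<^esub>"
      have "zsum dim (\<lambda>F. \<theta> (lam F)) A = zsum dim (\<lambda>F. zunit dim (\<iota> F)) A"
        by (rule zsum_cong) (use A(1) th in blast)
      then show "A = {}" using zindep_units[OF t(2,3)] A unfolding zindep_def by simp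
    qed
    then have ind: "zindep dim lam (zeros p)" by (intro zindep_iso[OF t(1) _ lz]) auto
    have thsum: "\<theta> (zsum dim lam A) = zsum dim (zunit dim) (\<iota> ` A)" if A: "A \<subseteq> zeros p" for A
    proof -
      have "\<theta> (zsum dim lam A) = zsum dim (\<lambda>F. \<theta> (lam F)) A"
        by (rule zsum_hom) (use A finite_subset[OF A] t(1) lz in \<open>auto simp: iso_iff\<close>)
      also have "\<dots> = zsum dim (\<lambda>F. zunit dim (\<iota> F)) A" by (rule zsum_cong) (use th A in blast)
      also have "\<dots> = zsum dim (zunit dim) (\<iota> ` A)" by (rule zsum_reindex[symmetric]) (rule inj_on_subset[OF t(2) A])
      finally show ?thesis .
    qed
    have "stabP p = zsum dim lam ` Pow (zeros p)"
    proof (intro equalityI subsetI)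
      fix g assume g: "g \<in> stabP p"
      then have gG: "g \<in> carrier G" by (simp add: t(4))
      define A where "A = {F\<in>zeros p. \<theta> g (\<iota> F) = 1}"
      have "\<iota> ` A = {i. i < dim \<and> \<theta> g i = 1}" using g t(3,4) by (auto simp: A_def)
      then have "\<theta> (zsum dim lam A) = \<theta> g"
        using thsum[of A] zsum_zunit[OF Z2_iso_closed[OF t(1) gG]] by (simp add: A_def)
      then have "zsum dim lam A = g" using Z2_iso_eq_iff[OF t(1) zsum_closed gG] by blast
      moreover have "A \<in> Pow (zeros p)" by (auto simp: A_def)
      ultimately show "g \<in> zsum dim lam ` Pow (zeros p)" by (metis imageI)
    next
      fix g assume "g \<in> zsum dim lam ` Pow (zeros p)"
      then obtain A where A: "A \<subseteq> zeros p" "g = zsum dim lam A" by blast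
      have "\<iota> ` A \<subseteq> {..<dim}" using A(1) t(3) by blast
      from zsum_zunit_coord[OF this] have "i \<in> \<iota> ` A" if "i < dim" "\<theta> g i = 1" for i
        using thsum[OF A(1)] A(2) that by simp
      then show "g \<in> stabP p" using A by (auto simp: t(4))
    qed
    with ind show ?thesis by blast
  qed
  have "char_of M lam"
    unfolding char_of_def
  proof (intro conjI ballI)
    fix x g assume x: "x \<in> topspace X" and g: "g \<in> carrier G"
    have "act g x = x \<longleftrightarrow> g \<in> stabP (\<pi> x)" using stabP_proj[OF x] g by (simp add: stab_def)
    then show "act g x = x \<longleftrightarrow> g \<in> zsum dim lam ` Pow (zeros (\<pi> x))" using main[OF proj_in[OF x]] by simp
  qed (use lamG main in auto)
  then show ?thesis by blast
qed

text \<open>The translates of the section fill \<open>X\<close>, and \<open>f\<close> is prescribed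
  on each of them. The assumption on stabilizers makes the prescriptions compatible; the translates
  are compact, hence closed, and finitely many, so the pieces can be pasted.\<close>

lemma equivariant_extension:
  assumes B: "small_cover_over P m \<omega> u M'" and \<alpha>: "\<alpha> \<in> iso G G"
    and stab: "\<And>x x' g. x \<in> topspace X \<Longrightarrow> x' \<in> topspace (sc_top M') \<Longrightarrow> sc_proj M' x' = \<pi> x \<Longrightarrow>
      g \<in> carrier G \<Longrightarrow> act g x = x \<Longrightarrow> sc_act M' (\<alpha> g) x' = x'"
    and s: "continuous_map P X s" "\<And>p. p \<in> topspace P \<Longrightarrow> \<pi> (s p) = p"
    and s': "continuous_map P (sc_top M') s'" "\<And>p. p \<in> topspace P \<Longrightarrow> sc_proj M' (s' p) = p"
  shows "\<exists>f. continuous_map X (sc_top M') f \<and> (\<forall>g\<in>carrier G. \<forall>p\<in>topspace P. f (act g (s p)) = sc_act M' (\<alpha> g) (s' p))"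
proof -
  interpret B: small_cover_over P m \<omega> u M' by (rule B)
  have sX: "s p \<in> topspace X" if "p \<in> topspace P" for p
    using continuous_map_image_subset_topspace[OF s(1)] that by blast
  have sX': "s' p \<in> topspace B.X" if "p \<in> topspace P" for p
    using continuous_map_image_subset_topspace[OF s'(1)] that by blast
  define gr where "gr x = (SOME g. g \<in> carrier G \<and> x = act g (s (\<pi> x)))" for x
  have gr: "gr x \<in> carrier G" "x = act (gr x) (s (\<pi> x))" if x: "x \<in> topspace X" for x
  proof -
    have "\<pi> x = \<pi> (s (\<pi> x))" using s(2) proj_in[OF x] by simp
    then obtain g where "g \<in> carrier G \<and> x = act g (s (\<pi> x))" using proj_eq_iff[OF sX[OF proj_in[OF x]] x] by blast
    from someI[of "\<lambda>g. g \<in> carrier G \<and> x = act g (s (\<pi> x))", OF this]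
    have "gr x \<in> carrier G \<and> x = act (gr x) (s (\<pi> x))" unfolding gr_def .
    then show "gr x \<in> carrier G" "x = act (gr x) (s (\<pi> x))" by auto
  qed
  define f where "f x = B.act (\<alpha> (gr x)) (s' (\<pi> x))" for x
  \<comment> \<open>Elements are their own inverses, so equal translates by \<open>g\<close> and
    \<open>h\<close> put their product into the stabilizer, where the assumption applies.\<close>
  have wd: "B.act (\<alpha> g) (s' p) = B.act (\<alpha> h) (s' p)"
    if g: "g \<in> carrier G" "h \<in> carrier G" and p: "p \<in> topspace P" and e: "act g (s p) = act h (s p)" for g h p
  proof -
    have gh: "g \<otimes>\<^bsub>G\<^esub> h \<in> carrier G" using g by simp
    have "act (g \<otimes>\<^bsub>G\<^esub> h) (s p) = act g (act g (s p))" using act_mult[OF g sX[OF p]] e by simp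
    then have "act (g \<otimes>\<^bsub>G\<^esub> h) (s p) = s p" using act_act[OF g(1) sX[OF p]] by simp
    then have "B.act (\<alpha> (g \<otimes>\<^bsub>G\<^esub> h)) (s' p) = s' p"
      using stab[OF sX[OF p] sX'[OF p] _ gh] s(2)[OF p] s'(2)[OF p] by simp
    then have "B.act (\<alpha> g) (B.act (\<alpha> h) (s' p)) = s' p"
      using B.act_mult[OF Z2_iso_closed[OF \<alpha> g(1)] Z2_iso_closed[OF \<alpha> g(2)] sX'[OF p]] Z2_iso_mult[OF \<alpha> g] by simp
    then show ?thesis
      using B.act_act[OF Z2_iso_closed[OF \<alpha> g(1)] B.act_closed[OF Z2_iso_closed[OF \<alpha> g(2)] sX'[OF p]]] by simp
  qed
  have f: "f (act g (s p)) = B.act (\<alpha> g) (s' p)" if g: "g \<in> carrier G" and p: "p \<in> topspace P" for g p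
  proof -
    have x: "act g (s p) \<in> topspace X" by (rule act_closed[OF g sX[OF p]])
    have px: "\<pi> (act g (s p)) = p" using proj_act[OF g sX[OF p]] s(2)[OF p] by simp
    have "act (gr (act g (s p))) (s p) = act g (s p)" using gr(2)[OF x] unfolding px by simp
    then show ?thesis unfolding f_def px using wd[OF gr(1)[OF x] g p] by simp
  qed
  have "continuous_map X B.X f"
  proof (rule pasting_lemma_closed[where I="carrier G" and T="\<lambda>g. (act g \<circ> s) ` topspace P" and f="\<lambda>g. B.act (\<alpha> g) \<circ> (s' \<circ> \<pi>)"])
    fix g assume g: "g \<in> carrier G"
    have "compactin P (topspace P)" using compact_P by (simp add: compact_space_def)
    then have "compactin X ((act g \<circ> s) ` topspace P)"
      by (rule image_compactin[OF _ continuous_map_compose[OF s(1) act_cont[OF g]]])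
    then show "closedin X ((act g \<circ> s) ` topspace P)" by (rule compactin_imp_closedin[OF Hausdorff_X])
    have "continuous_map X B.X (B.act (\<alpha> g) \<circ> (s' \<circ> \<pi>))"
      by (intro continuous_map_compose[OF continuous_map_compose[OF quotient_imp_continuous_map[OF quot] s'(1)]]
          B.act_cont Z2_iso_closed[OF \<alpha> g])
    then show "continuous_map (subtopology X ((act g \<circ> s) ` topspace P)) B.X (B.act (\<alpha> g) \<circ> (s' \<circ> \<pi>))"
      by (rule continuous_map_from_subtopology)
  next
    fix g h x assume g: "g \<in> carrier G" "h \<in> carrier G"
      and x: "x \<in> topspace X \<inter> (act g \<circ> s) ` topspace P \<inter> (act h \<circ> s) ` topspace P"
    obtain p where p: "p \<in> topspace P" "x = act g (s p)" using x by auto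
    obtain p' where p': "p' \<in> topspace P" "x = act h (s p')" using x by auto
    have px: "\<pi> x = p" using proj_act[OF g(1) sX[OF p(1)]] s(2)[OF p(1)] p(2) by simp
    have "\<pi> x = p'" using proj_act[OF g(2) sX[OF p'(1)]] s(2)[OF p'(1)] p'(2) by simp
    then have "act g (s p) = act h (s p)" using px p p' by simp
    from wd[OF g p(1) this] show "(B.act (\<alpha> g) \<circ> (s' \<circ> \<pi>)) x = (B.act (\<alpha> h) \<circ> (s' \<circ> \<pi>)) x" using px by simp
  next
    fix x assume x: "x \<in> topspace X"
    show "\<exists>g. g \<in> carrier G \<and> x \<in> (act g \<circ> s) ` topspace P \<and> f x = (B.act (\<alpha> g) \<circ> (s' \<circ> \<pi>)) x"
      using gr[OF x] proj_in[OF x] by (intro exI[of _ "gr x"]) (auto simp: f_def)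
  qed simp
  then show ?thesis using f by blast
qed

end

section \<open>Equivalences of small covers and automorphisms of the group\<close>

context simplex_coords
begin

lemma small_cover_overI: "M \<in> small_covers dim P facets \<Longrightarrow> small_cover_over P m \<omega> u M"
  by (simp add: small_cover_over_def small_cover_over_axioms_def simplex_coords_axioms)

lemma char_of_iso_stab:
  assumes "\<alpha> \<in> iso (Z2_pow dim) (Z2_pow dim)" "\<And>F. F \<in> I \<Longrightarrow> \<alpha> (lam F) = lam' F" "\<And>F. F \<in> I \<Longrightarrow> lam F \<in> carrier (Z2_pow dim)"
    and g: "g \<in> zsum dim lam ` Pow (zeros p)"
  shows "\<alpha> g \<in> zsum dim lam' ` Pow (zeros p)"
proof -
  obtain A where A: "A \<subseteq> zeros p" "g = zsum dim lam A" using g by blast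
  have AI: "A \<subseteq> I" using A zeros_subset by blast
  have "\<alpha> g = zsum dim (\<lambda>F. \<alpha> (lam F)) A" unfolding A(2)
    by (rule zsum_hom) (use assms AI finite_subset[OF AI] in \<open>auto simp: iso_iff\<close>)
  also have "\<dots> = zsum dim lam' A" by (rule zsum_cong) (use assms(2) AI in blast)
  finally show ?thesis using A by blast
qed

text \<open>Over the relative interior of a facet the stabilizer has exactly one nontrivial element.
  An equivalence covers the identity of \<open>P\<close> and carries stabilizers to stabilizers
  through \<open>\<alpha>\<close>, so it matches these elements.\<close>

lemma DJ_equivalent_imp_iso:
  assumes M: "M \<in> small_covers dim P facets" and M': "M' \<in> small_covers dim P facets"
    and c: "char_of M lam" and c': "char_of M' lam'" and eq: "DJ_equivalent dim M M'"
  shows "\<exists>\<alpha>\<in>iso (Z2_pow dim) (Z2_pow dim). \<forall>F\<in>I. \<alpha> (lam F) = lam' F"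
proof -
  interpret A: small_cover_over P m \<omega> u M by (rule small_cover_overI[OF M])
  interpret B: small_cover_over P m \<omega> u M' by (rule small_cover_overI[OF M'])
  let ?G = "Z2_pow dim"
  obtain f \<alpha> where f: "homeomorphic_map A.X B.X f" and \<alpha>: "\<alpha> \<in> iso ?G ?G"
    and eqv: "\<forall>g\<in>carrier ?G. \<forall>x\<in>topspace A.X. f (A.act g x) = B.act (\<alpha> g) (f x)"
    and pr: "\<forall>x\<in>topspace A.X. B.\<pi> (f x) = A.\<pi> x"
    using eq unfolding DJ_equivalent_def by blast
  have "\<alpha> (lam F) = lam' F" if F: "F \<in> I" for F
  proof -
    obtain q where q: "q \<in> topspace P" "zeros q = {F}" using ex_zeros_facet[OF F] by blast
    obtain x where x: "x \<in> topspace A.X" "A.\<pi> x = q" using A.proj_surj[OF q(1)] by blast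
    have fx: "f x \<in> topspace B.X" using f x homeomorphic_imp_surjective_map by blast
    have lG: "lam F \<in> carrier ?G" "lam' F \<in> carrier ?G" using c c' F by (auto simp: char_of_def)
    have P1: "zsum dim k ` Pow {F} = {\<one>\<^bsub>?G\<^esub>, k F}" if "k F \<in> carrier ?G" for k
      using zsum_singleton[of k F dim, OF that] by (auto simp: Pow_insert)
    have "A.act (lam F) x = x"
      using c x q lG(1) P1[of lam, OF lG(1)] unfolding char_of_def by fastforce
    then have "B.act (\<alpha> (lam F)) (f x) = f x" using eqv lG x by metis
    moreover have aG: "\<alpha> (lam F) \<in> carrier ?G" by (rule Z2_iso_closed[OF \<alpha> lG(1)])
    moreover have "B.\<pi> (f x) = q" using pr x by simp
    ultimately have "\<alpha> (lam F) \<in> zsum dim lam' ` Pow {F}"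
      using c' fx q(2) unfolding char_of_def by fastforce
    moreover have "lam F \<noteq> \<one>\<^bsub>?G\<^esub>"
    proof
      assume "lam F = \<one>\<^bsub>?G\<^esub>"
      then have "zsum dim lam {F} = \<one>\<^bsub>?G\<^esub>" using zsum_singleton[of lam F dim, OF lG(1)] by simp
      moreover have "zindep dim lam {F}" using c q by (auto simp: char_of_def)
      ultimately show False unfolding zindep_def by blast
    qed
    then have "\<alpha> (lam F) \<noteq> \<one>\<^bsub>?G\<^esub>"
      using Z2_iso_eq_iff[OF \<alpha> lG(1) Z2_one_closed] Z2_iso_one[OF \<alpha>] by simp
    ultimately show ?thesis unfolding P1[of lam', OF lG(2)] by blast
  qed
  then show ?thesis using \<alpha> by blast
qed

text \<open>The maps extending \<open>\<alpha>\<close> and its inverse are built from the same pair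
  of sections. They are mutually inverse on the translates of the sections, and these fill the
  spaces.\<close>

lemma iso_imp_DJ_equivalent:
  assumes M: "M \<in> small_covers dim P facets" and M': "M' \<in> small_covers dim P facets"
    and c: "char_of M lam" and c': "char_of M' lam'"
    and \<alpha>: "\<alpha> \<in> iso (Z2_pow dim) (Z2_pow dim)" and eq: "\<forall>F\<in>I. \<alpha> (lam F) = lam' F"
  shows "DJ_equivalent dim M M'"
proof -
  interpret A: small_cover_over P m \<omega> u M by (rule small_cover_overI[OF M])
  interpret B: small_cover_over P m \<omega> u M' by (rule small_cover_overI[OF M'])
  let ?G = "Z2_pow dim"
  obtain \<beta> where \<beta>: "\<beta> \<in> iso ?G ?G" "\<And>g. g \<in> carrier ?G \<Longrightarrow> \<beta> (\<alpha> g) = g" "\<And>g. g \<in> carrier ?G \<Longrightarrow> \<alpha> (\<beta> g) = g"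
    using Z2_iso_inverse[OF \<alpha>] by metis
  have lG: "lam F \<in> carrier ?G" "lam' F \<in> carrier ?G" if "F \<in> I" for F using c c' that by (auto simp: char_of_def)
  obtain s where s: "continuous_map P A.X s" "\<And>p. p \<in> topspace P \<Longrightarrow> A.\<pi> (s p) = p" using A.ex_section by metis
  obtain s' where s': "continuous_map P B.X s'" "\<And>p. p \<in> topspace P \<Longrightarrow> B.\<pi> (s' p) = p" using B.ex_section by metis
  have 1: "B.act (\<alpha> g) x' = x'"
    if "x \<in> topspace A.X" "x' \<in> topspace B.X" "B.\<pi> x' = A.\<pi> x" "g \<in> carrier ?G" "A.act g x = x" for x x' g
  proof -
    have gz: "g \<in> zsum dim lam ` Pow (zeros (A.\<pi> x))" using c that unfolding char_of_def by blast
    have "\<alpha> g \<in> zsum dim lam' ` Pow (zeros (A.\<pi> x))"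
      by (rule char_of_iso_stab[OF \<alpha> _ _ gz]) (use eq lG in simp_all)
    then show ?thesis using c' that Z2_iso_closed[OF \<alpha> that(4)] unfolding char_of_def by metis
  qed
  have 2: "A.act (\<beta> g) x = x"
    if "x' \<in> topspace B.X" "x \<in> topspace A.X" "A.\<pi> x = B.\<pi> x'" "g \<in> carrier ?G" "B.act g x' = x'" for x x' g
  proof -
    have gz: "g \<in> zsum dim lam' ` Pow (zeros (B.\<pi> x'))" using c' that unfolding char_of_def by blast
    have "\<beta> (lam' F) = lam F" if "F \<in> I" for F using eq \<beta>(2)[OF lG(1)[OF that]] that by simp
    then have "\<beta> g \<in> zsum dim lam ` Pow (zeros (B.\<pi> x'))"
      by (rule char_of_iso_stab[OF \<beta>(1) _ _ gz]) (use lG in simp_all)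
    then show ?thesis using c that Z2_iso_closed[OF \<beta>(1) that(4)] unfolding char_of_def by metis
  qed
  have "\<exists>f. continuous_map A.X B.X f \<and> (\<forall>g\<in>carrier ?G. \<forall>p\<in>topspace P. f (A.act g (s p)) = B.act (\<alpha> g) (s' p))"
    by (rule A.equivariant_extension[OF B.small_cover_over_axioms \<alpha>]) (fact 1 s s')+
  then obtain f where f0: "continuous_map A.X B.X f" "\<forall>g\<in>carrier ?G. \<forall>p\<in>topspace P. f (A.act g (s p)) = B.act (\<alpha> g) (s' p)"
    by (elim exE conjE) (rule that)
  have f: "continuous_map A.X B.X f" "f (A.act g (s p)) = B.act (\<alpha> g) (s' p)" if "g \<in> carrier ?G" "p \<in> topspace P" for g p
    using f0(1) bspec[OF bspec[OF f0(2) that(1)] that(2)] by simp_all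
  have "\<exists>f. continuous_map B.X A.X f \<and> (\<forall>g\<in>carrier ?G. \<forall>p\<in>topspace P. f (B.act g (s' p)) = A.act (\<beta> g) (s p))"
    by (rule B.equivariant_extension[OF A.small_cover_over_axioms \<beta>(1)]) (fact 2 s s')+
  then obtain f' where f0': "continuous_map B.X A.X f'" "\<forall>g\<in>carrier ?G. \<forall>p\<in>topspace P. f' (B.act g (s' p)) = A.act (\<beta> g) (s p)"
    by (elim exE conjE) (rule that)
  have f': "continuous_map B.X A.X f'" "f' (B.act g (s' p)) = A.act (\<beta> g) (s p)" if "g \<in> carrier ?G" "p \<in> topspace P" for g p
    using f0'(1) bspec[OF bspec[OF f0'(2) that(1)] that(2)] by simp_all
  have sX: "s p \<in> topspace A.X" if "p \<in> topspace P" for p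
    using continuous_map_image_subset_topspace[OF s(1)] that by blast
  have sX': "s' p \<in> topspace B.X" if "p \<in> topspace P" for p
    using continuous_map_image_subset_topspace[OF s'(1)] that by blast
  have exA: "\<exists>g\<in>carrier ?G. x = A.act g (s (A.\<pi> x))" if x: "x \<in> topspace A.X" for x
    using A.proj_eq_iff[OF sX[OF A.proj_in[OF x]] x] s(2)[OF A.proj_in[OF x]] by simp
  have exB: "\<exists>g\<in>carrier ?G. x = B.act g (s' (B.\<pi> x))" if x: "x \<in> topspace B.X" for x
    using B.proj_eq_iff[OF sX'[OF B.proj_in[OF x]] x] s'(2)[OF B.proj_in[OF x]] by simp
  have "homeomorphic_maps A.X B.X f f'"
    unfolding homeomorphic_maps_def
  proof (intro conjI ballI)
    fix x assume x: "x \<in> topspace A.X"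
    obtain g where g: "g \<in> carrier ?G" "x = A.act g (s (A.\<pi> x))" using exA[OF x] by blast
    have "f x = B.act (\<alpha> g) (s' (A.\<pi> x))" by (subst g(2)) (rule f(2)[OF g(1) A.proj_in[OF x]])
    then have "f' (f x) = A.act (\<beta> (\<alpha> g)) (s (A.\<pi> x))" using f'(2)[OF Z2_iso_closed[OF \<alpha> g(1)] A.proj_in[OF x]] by simp
    then show "f' (f x) = x" using \<beta>(2)[OF g(1)] g(2) by simp
  next
    fix x assume x: "x \<in> topspace B.X"
    obtain g where g: "g \<in> carrier ?G" "x = B.act g (s' (B.\<pi> x))" using exB[OF x] by blast
    have "f' x = A.act (\<beta> g) (s (B.\<pi> x))" by (subst g(2)) (rule f'(2)[OF g(1) B.proj_in[OF x]])
    then have "f (f' x) = B.act (\<alpha> (\<beta> g)) (s' (B.\<pi> x))" using f(2)[OF Z2_iso_closed[OF \<beta>(1) g(1)] B.proj_in[OF x]] by simp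
    then show "f (f' x) = x" using \<beta>(3)[OF g(1)] g(2) by simp
  qed (fact f0(1) f0'(1))+
  then have hom: "homeomorphic_map A.X B.X f" using homeomorphic_maps_map by blast
  have eqv: "f (A.act h x) = B.act (\<alpha> h) (f x)" if h: "h \<in> carrier ?G" and x: "x \<in> topspace A.X" for h x
  proof -
    obtain g where g: "g \<in> carrier ?G" "x = A.act g (s (A.\<pi> x))" using exA[OF x] by blast
    note p = A.proj_in[OF x]
    have fx: "f x = B.act (\<alpha> g) (s' (A.\<pi> x))" by (subst g(2)) (rule f(2)[OF g(1) p])
    have "A.act h x = A.act (h \<otimes>\<^bsub>?G\<^esub> g) (s (A.\<pi> x))" by (subst g(2)) (rule A.act_mult[OF h g(1) sX[OF p], symmetric])
    then have "f (A.act h x) = B.act (\<alpha> (h \<otimes>\<^bsub>?G\<^esub> g)) (s' (A.\<pi> x))" using f(2)[OF Z2_closed[OF h g(1)] p] by simp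
    also have "\<dots> = B.act (\<alpha> h) (B.act (\<alpha> g) (s' (A.\<pi> x)))"
      using B.act_mult[OF Z2_iso_closed[OF \<alpha> h] Z2_iso_closed[OF \<alpha> g(1)] sX'[OF p]] Z2_iso_mult[OF \<alpha> h g(1)] by simp
    finally show ?thesis using fx by simp
  qed
  have "B.\<pi> (f x) = A.\<pi> x" if x: "x \<in> topspace A.X" for x
  proof -
    obtain g where g: "g \<in> carrier ?G" "x = A.act g (s (A.\<pi> x))" using exA[OF x] by blast
    note p = A.proj_in[OF x]
    have fx: "f x = B.act (\<alpha> g) (s' (A.\<pi> x))" by (subst g(2)) (rule f(2)[OF g(1) p])
    show ?thesis using B.proj_act[OF Z2_iso_closed[OF \<alpha> g(1)] sX'[OF p]] s'(2)[OF p] fx by simp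
  qed
  then show ?thesis unfolding DJ_equivalent_def using hom \<alpha> eqv by blast
qed

end

section \<open>Characteristic functions and acyclic digraphs\<close>

text \<open>Take a smallest nonempty set in which every vertex has a successor. The image of any
  successor function on it is again such a set, so the function is onto and hence injective, and
  this leaves no second successor.\<close>

lemma not_acyclic_minimal_set:
  assumes "finite V" "E \<subseteq> V \<times> V" "\<not> acyclic E"
  shows "\<exists>S f. S \<noteq> {} \<and> S \<subseteq> V \<and> (\<forall>k\<in>S. f k \<in> S) \<and> (\<forall>k\<in>S. \<forall>k'\<in>S. (k, k') \<in> E \<longleftrightarrow> k' = f k)"
proof -
  define Q where "Q S \<longleftrightarrow> S \<noteq> {} \<and> S \<subseteq> V \<and> (\<forall>k\<in>S. \<exists>k'\<in>S. (k, k') \<in> E)" for S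
  have "Q {x. (x, x) \<in> E\<^sup>+}"
    unfolding Q_def
  proof (intro conjI ballI)
    show "{x. (x, x) \<in> E\<^sup>+} \<noteq> {}" using assms(3) by (auto simp: acyclic_def)
    show "{x. (x, x) \<in> E\<^sup>+} \<subseteq> V" using trancl_subset_Sigma[OF assms(2)] by blast
    fix k assume "k \<in> {x. (x, x) \<in> E\<^sup>+}"
    then have "(k, k) \<in> E\<^sup>+" by simp
    then obtain y where y: "(k, y) \<in> E" "(y, k) \<in> E\<^sup>*" by (meson tranclD)
    have "(y, y) \<in> E\<^sup>+" by (rule rtrancl_into_trancl1[OF y(2,1)])
    then show "\<exists>k'\<in>{x. (x, x) \<in> E\<^sup>+}. (k, k') \<in> E" using y(1) by blast
  qed
  then obtain S where S: "Q S" "\<And>T. Q T \<Longrightarrow> card S \<le> card T"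
    using ex_has_least_nat[of Q _ card] by blast
  have fS: "finite S" using S(1) assms(1) finite_subset unfolding Q_def by blast
  have "\<forall>k\<in>S. \<exists>k'. k' \<in> S \<and> (k, k') \<in> E" using S(1) unfolding Q_def by blast
  from bchoice[OF this] obtain f where f: "\<forall>k\<in>S. f k \<in> S \<and> (k, f k) \<in> E" ..
  have img: "h ` S = S" if h: "\<forall>k\<in>S. h k \<in> S \<and> (k, h k) \<in> E" for h
  proof -
    have "Q (h ` S)" using h S(1) unfolding Q_def by blast
    then have "card S \<le> card (h ` S)" by (rule S(2))
    moreover have "h ` S \<subseteq> S" using h by blast
    ultimately show ?thesis using fS by (intro card_seteq)
  qed
  have inj: "inj_on f S" by (rule eq_card_imp_inj_on[OF fS]) (simp add: img[OF f])
  have "k' = f k" if k: "k \<in> S" "k' \<in> S" "(k, k') \<in> E" for k k'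
  proof (rule ccontr)
    assume ne: "k' \<noteq> f k"
    \<comment> \<open>Redirecting \<open>k\<close> to \<open>k'\<close> gives another successor
      function, again onto; then \<open>f k\<close> is also the value of \<open>f\<close> at some
      \<open>i\<close> other than \<open>k\<close>, against injectivity.\<close>
    have "\<forall>i\<in>S. (f(k := k')) i \<in> S \<and> (i, (f(k := k')) i) \<in> E" using f k by simp
    from img[OF this] have "f k \<in> f(k := k') ` S" using f k(1) by blast
    then obtain i where i: "i \<in> S" "f k = (f(k := k')) i" by blast
    then have "i \<noteq> k" using ne by auto
    then have "f i = f k" using i by simp
    then show False using inj i(1) k(1) \<open>i \<noteq> k\<close> by (auto dest: inj_onD)
  qed
  then have "\<forall>k\<in>S. \<forall>k'\<in>S. (k, k') \<in> E \<longleftrightarrow> k' = f k" using f by blast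
  moreover have "S \<noteq> {}" "S \<subseteq> V" using S(1) unfolding Q_def by auto
  moreover have "\<forall>k\<in>S. f k \<in> S" using f by blast
  ultimately show ?thesis by (intro exI conjI)
qed

section \<open>Normalization at the base vertex and the resulting matrices\<close>

context simplex_coords
begin

text \<open>The facets through the base vertex, the one with corner 0 chosen in every factor; there
  are \<open>dim\<close> of them, and their vectors become the standard basis.\<close>

definition J where "J = {F\<in>I. snd F \<noteq> 0}"

definition pos where "pos = (SOME h. bij_betw h J {..<dim})"

lemma finite_J [simp]: "finite J" by (simp add: J_def)

lemma J_subset: "J \<subseteq> I" by (auto simp: J_def)

lemma pos_bij: "bij_betw pos J {..<dim}"
proof -
  have "J = (SIGMA k:{1..m}. {1..\<omega> k})" by (auto simp: J_def I_def)
  then have "card J = dim" by (simp add: dim_def)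
  then have "\<exists>h. bij_betw h J {..<dim}" by (intro finite_same_card_bij) auto
  then show ?thesis unfolding pos_def by (rule someI_ex)
qed

lemma pos_less: "F \<in> J \<Longrightarrow> pos F < dim"
  using pos_bij by (auto simp: bij_betw_def)

lemma pos_eq_iff: "F \<in> J \<Longrightarrow> F' \<in> J \<Longrightarrow> pos F = pos F' \<longleftrightarrow> F = F'"
  using pos_bij by (auto simp: bij_betw_def inj_on_eq_iff)

lemma pos_surj: "i < dim \<Longrightarrow> \<exists>F\<in>J. i = pos F"
  using pos_bij by (auto simp: bij_betw_def image_iff set_eq_iff)

lemma zsum_pos_units:
  assumes "v \<in> carrier (Z2_pow dim)" shows "zsum dim (\<lambda>F. zunit dim (pos F)) {F\<in>J. v (pos F) = 1} = v"
proof -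
  have inj: "inj_on pos J" using pos_bij by (auto simp: bij_betw_def)
  have "zsum dim (\<lambda>F. zunit dim (pos F)) {F\<in>J. v (pos F) = 1} = zsum dim (zunit dim) (pos ` {F\<in>J. v (pos F) = 1})"
    by (rule zsum_reindex[symmetric]) (rule inj_on_subset[OF inj], auto)
  also have "pos ` {F\<in>J. v (pos F) = 1} = {i. i < dim \<and> v i = 1}"
  proof (intro equalityI subsetI)
    fix i assume i: "i \<in> {i. i < dim \<and> v i = 1}"
    then obtain F where "F \<in> J" "i = pos F" using pos_surj by blast
    then show "i \<in> pos ` {F\<in>J. v (pos F) = 1}" using i by blast
  next
    fix i assume "i \<in> pos ` {F\<in>J. v (pos F) = 1}"
    then obtain F where "F \<in> J" "i = pos F" "v (pos F) = 1" by blast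
    then show "i \<in> {i. i < dim \<and> v i = 1}" using pos_less by simp
  qed
  finally show ?thesis using zsum_zunit[OF assms] by simp
qed

text \<open>The block \<open>k'\<close> of the vector of the facet \<open>(k, 0)\<close> is the all-ones vector for \<open>k' = k\<close>, the weight of
  the edge from \<open>k'\<close> to \<open>k\<close> if there is one, and zero otherwise.  Weights are indexed from 0, the
  facets with standard basis vectors from 1.\<close>

definition digraph_char :: "(nat \<times> nat) set \<times> (nat \<times> nat \<Rightarrow> nat \<Rightarrow> int) \<Rightarrow> nat \<times> nat \<Rightarrow> nat \<Rightarrow> int" where
  "digraph_char D F = (if snd F \<noteq> 0 then zunit dim (pos F) else
     (\<lambda>i\<in>{..<dim}. let (k', t') = inv_into J pos i in
        if k' = fst F then 1 else if (k', fst F) \<in> fst D then snd D (k', fst F) (t' - 1) else 0))"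

lemma digraph_char_unit: "F \<in> J \<Longrightarrow> digraph_char D F = zunit dim (pos F)"
  by (simp add: digraph_char_def J_def)

lemma digraph_char_coord:
  assumes "(k', t') \<in> J"
  shows "digraph_char D (k, 0) (pos (k', t')) =
    (if k' = k then 1 else if (k', k) \<in> fst D then snd D (k', k) (t' - 1) else 0)"
proof -
  have "inv_into J pos (pos (k', t')) = (k', t')"
    using pos_bij assms by (auto simp: bij_betw_def)
  then show ?thesis using pos_less[OF assms] by (simp add: digraph_char_def)
qed

lemma digraph_weight_closed:
  assumes "D \<in> acyclic_weighted_digraphs m \<omega>" "(k', k) \<in> fst D"
  shows "snd D (k', k) \<in> carrier (Z2_pow (\<omega> k'))" "snd D (k', k) \<noteq> \<one>\<^bsub>Z2_pow (\<omega> k')\<^esub>" "k' \<in> {1..m}" "k \<in> {1..m}" "k' \<noteq> k"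
proof -
  obtain E w where D: "D = (E, w)" by fastforce
  have E: "E \<subseteq> {1..m} \<times> {1..m}" "acyclic E"
    and w: "w \<in> (\<Pi>\<^sub>E (i, j)\<in>E. carrier (Z2_pow (\<omega> i)) - {\<one>\<^bsub>Z2_pow (\<omega> i)\<^esub>})"
    using assms(1) by (auto simp: acyclic_weighted_digraphs_def D)
  have e: "(k', k) \<in> E" using assms(2) D by simp
  have "w (k', k) \<in> (case (k', k) of (i, j) \<Rightarrow> carrier (Z2_pow (\<omega> i)) - {\<one>\<^bsub>Z2_pow (\<omega> i)\<^esub>})"
    by (rule PiE_mem[OF w e])
  then show "snd D (k', k) \<in> carrier (Z2_pow (\<omega> k'))" "snd D (k', k) \<noteq> \<one>\<^bsub>Z2_pow (\<omega> k')\<^esub>" by (simp_all add: D)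
  show "k' \<in> {1..m}" "k \<in> {1..m}" using E(1) e by auto
  show "k' \<noteq> k"
  proof
    assume "k' = k"
    then have "(k, k) \<in> E\<^sup>+" using e by blast
    then show False using E(2) by (simp add: acyclic_def)
  qed
qed

lemma J_iff: "(k, t) \<in> J \<longleftrightarrow> k \<in> {1..m} \<and> 1 \<le> t \<and> t \<le> \<omega> k"
  by (auto simp: J_def I_iff)

lemma digraph_char_closed:
  assumes D: "D \<in> acyclic_weighted_digraphs m \<omega>" and F: "F \<in> I"
  shows "digraph_char D F \<in> carrier (Z2_pow dim)"
proof (cases "snd F = 0")
  case True
  then obtain k where k: "F = (k, 0)" by (metis prod.collapse)
  have ext: "digraph_char D F \<in> extensional {..<dim}" using True by (simp add: digraph_char_def)
  have "digraph_char D F i = 0 \<or> digraph_char D F i = 1" if i: "i < dim" for i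
  proof -
    obtain k' t' where kt: "(k', t') \<in> J" "i = pos (k', t')" using pos_surj[OF i] by fastforce
    have "t' - 1 < \<omega> k'" using kt(1) by (auto simp: J_iff)
    then have "snd D (k', k) (t' - 1) = 0 \<or> snd D (k', k) (t' - 1) = 1" if "(k', k) \<in> fst D"
      using Z2_coord[OF digraph_weight_closed(1)[OF D that]] by blast
    then show ?thesis unfolding k kt(2) digraph_char_coord[OF kt(1)] by simp
  qed
  with ext show ?thesis by (simp add: Z2_carrier)
qed (simp add: digraph_char_def)

lemma ex_nonzero_coord:
  assumes p: "p \<in> topspace P"
  shows "\<exists>c. \<forall>k\<in>{1..m}. c k \<le> \<omega> k \<and> (k, c k) \<notin> zeros p"
proof -
  have "\<forall>k\<in>{1..m}. \<exists>t. t \<le> \<omega> k \<and> (k, t) \<notin> zeros p"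
  proof (rule ballI, rule ccontr)
    fix k assume k: "k \<in> {1..m}" "\<not> (\<exists>t. t \<le> \<omega> k \<and> (k, t) \<notin> zeros p)"
    then have "(\<Sum>t\<le>\<omega> k. u (k, t) p) = 0" by (intro sum.neutral) (auto simp: zeros_def)
    then show False using u_sum[OF p k(1)] by simp
  qed
  from bchoice[OF this] show ?thesis .
qed

text \<open>Among the \<open>k\<close> whose facet \<open>(k, 0)\<close> occurs in a relation,
  acyclicity gives one with no edge into the others. In the row \<open>(k, c k)\<close>, where
  \<open>c k\<close> is a corner with nonzero coordinate at \<open>p\<close>, its vector is the only
  one with entry 1. So no such \<open>k\<close> exists and the relation is one between unit
  vectors.\<close>

lemma digraph_char_indep:
  assumes D: "D \<in> acyclic_weighted_digraphs m \<omega>" and p: "p \<in> topspace P"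
  shows "zindep dim (digraph_char D) (zeros p)"
  unfolding zindep_def
proof (intro allI impI)
  fix A assume A: "A \<subseteq> zeros p" and A1: "zsum dim (digraph_char D) A = \<one>\<^bsub>Z2_pow dim\<^esub>"
  obtain c where c': "\<forall>k\<in>{1..m}. c k \<le> \<omega> k \<and> (k, c k) \<notin> zeros p" using ex_nonzero_coord[OF p] ..
  have c: "c k \<le> \<omega> k \<and> (k, c k) \<notin> zeros p" if "k \<in> {1..m}" for k using bspec[OF c' that] .
  have AI: "A \<subseteq> I" using A zeros_subset by blast
  have fA: "finite A" by (rule finite_subset[OF AI finite_I])
  define S where "S = {k. (k, 0) \<in> A}"
  have "S = {}"
  proof (rule ccontr)
    assume ne: "S \<noteq> {}"
    have E: "acyclic (fst D)" "fst D \<subseteq> {1..m} \<times> {1..m}" using D by (auto simp: acyclic_weighted_digraphs_def)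
    have "finite (fst D)" by (rule finite_subset[OF E(2)]) simp
    then have "wf ((fst D)\<inverse>)" using E(1) by (rule finite_acyclic_wf_converse)
    moreover obtain k0 where "k0 \<in> S" using ne by blast
    ultimately obtain k where k: "k \<in> S" "\<forall>y. (y, k) \<in> (fst D)\<inverse> \<longrightarrow> y \<notin> S"
      unfolding wf_eq_minimal by blast
    have kA: "(k, 0) \<in> A" using k(1) by (simp add: S_def)
    have km: "k \<in> {1..m}" using kA AI by (auto simp: I_iff)
    have "(k, 0) \<in> zeros p" using kA A by blast
    then have "c k \<noteq> 0" using c[OF km] by metis
    then have kJ: "(k, c k) \<in> J" using c[OF km] km by (auto simp: J_iff)
    have val: "digraph_char D F (pos (k, c k)) = (if F = (k, 0) then 1 else 0)" if F: "F \<in> A" for F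
    proof (cases "snd F = 0")
      case True
      then obtain k2 where k2: "F = (k2, 0)" by (metis prod.collapse)
      then have "k2 \<in> S" using F by (simp add: S_def)
      then have "(k, k2) \<notin> fst D" using k(2) by auto
      then show ?thesis unfolding k2 digraph_char_coord[OF kJ] by simp
    next
      case False
      then have FJ: "F \<in> J" using F AI by (auto simp: J_def)
      have "F \<noteq> (k, c k)" using F A c[OF km] by blast
      then have "pos (k, c k) \<noteq> pos F" using pos_eq_iff[OF kJ FJ] by blast
      then show ?thesis using False digraph_char_unit[OF FJ] pos_less[OF kJ] by (auto simp: zunit_coord)
    qed
    have "(\<Sum>F\<in>A. digraph_char D F (pos (k, c k))) = (\<Sum>F\<in>A. if F = (k, 0) then 1 else 0)"
      by (rule sum.cong) (use val in auto)
    also have "\<dots> = 1" using fA kA by simp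
    finally have "zsum dim (digraph_char D) A (pos (k, c k)) = 1" using pos_less[OF kJ] by (simp add: zsum_def)
    then show False using A1 pos_less[OF kJ] by simp
  qed
  then have "snd F \<noteq> 0" if "F \<in> A" for F using that unfolding S_def by (metis Collect_empty_eq prod.collapse)
  then have AJ: "A \<subseteq> J" using AI unfolding J_def by blast
  have "zsum dim (\<lambda>F. zunit dim (pos F)) A = zsum dim (digraph_char D) A"
    by (rule zsum_cong) (metis AJ digraph_char_unit subsetD)
  moreover have "zindep dim (\<lambda>F. zunit dim (pos F)) J"
    by (rule zindep_units) (use pos_bij in \<open>auto simp: bij_betw_def\<close>)
  ultimately show "A = {}" using A1 AJ unfolding zindep_def by simp
qed

text \<open>If the conclusion failed, the principal minor with blocks \<open>S\<close> and coordinates \<open>c\<close> would vanish,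
  giving a relation among the characteristic vectors at the corresponding vertex.\<close>

lemma vertex_minor:
  assumes lamG: "\<And>F. F \<in> I \<Longrightarrow> lam F \<in> carrier (Z2_pow dim)"
    and ind: "\<And>p. p \<in> topspace P \<Longrightarrow> zindep dim lam (zeros p)"
    and unit: "\<And>F. F \<in> J \<Longrightarrow> lam F = zunit dim (pos F)"
    and S: "S \<subseteq> {1..m}" "S \<noteq> {}" and c: "\<And>k. k \<in> S \<Longrightarrow> 1 \<le> c k \<and> c k \<le> \<omega> k"
  shows "\<exists>k\<in>S. (\<Sum>k2\<in>S. lam (k2, 0) (pos (k, c k))) mod 2 = 1"
proof (rule ccontr)
  assume neg: "\<not> (\<exists>k\<in>S. (\<Sum>k2\<in>S. lam (k2, 0) (pos (k, c k))) mod 2 = 1)"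
  define v where "v = zsum dim lam ((\<lambda>k. (k, 0)) ` S)"
  \<comment> \<open>Outside \<open>S\<close> the base corner is kept, so at the vertex
    \<open>p\<close> the vectors of \<open>(k, 0)\<close> for \<open>k \<in> S\<close> replace the
    unit vectors of \<open>(k, c k)\<close>.\<close>
  define c' where "c' k = (if k \<in> S then c k else 0)" for k
  obtain p where p: "p \<in> topspace P" "zeros p = {(k, t). (k, t) \<in> I \<and> t \<noteq> c' k}"
    by (rule ex_zeros_vertex[of c']) (use c in \<open>auto simp: c'_def\<close>)
  have vG: "v \<in> carrier (Z2_pow dim)" by (simp add: v_def)
  have vk: "v (pos (k, c k)) \<noteq> 1" if k: "k \<in> S" for k
  proof -
    have "(k, c k) \<in> J" using c[OF k] S(1) k by (auto simp: J_iff)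
    then have "v (pos (k, c k)) = (\<Sum>F\<in>(\<lambda>k. (k, 0)) ` S. lam F (pos (k, c k))) mod 2"
      using pos_less by (simp add: v_def zsum_def)
    also have "\<dots> = (\<Sum>k2\<in>S. lam (k2, 0) (pos (k, c k))) mod 2"
      by (subst sum.reindex) (auto simp: inj_on_def)
    finally show ?thesis using neg k by simp
  qed
  \<comment> \<open>The ones of \<open>v\<close> are cancelled by unit vectors. By assumption
    \<open>v\<close> has no one at the positions of the missing facets \<open>(k, c k)\<close>, so
    all facets of the relation pass through \<open>p\<close>.\<close>
  define B where "B = {F\<in>J. v (pos F) = 1}"
  have fS: "finite S" by (rule finite_subset[OF S(1)]) simp
  have "zsum dim lam ((\<lambda>k. (k, 0)) ` S \<union> B) = v \<otimes>\<^bsub>Z2_pow dim\<^esub> zsum dim lam B"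
    unfolding v_def by (rule zsum_Un_disjoint) (use fS in \<open>auto simp: B_def J_def\<close>)
  also have "zsum dim lam B = zsum dim (\<lambda>F. zunit dim (pos F)) B"
    by (rule zsum_cong) (use unit in \<open>auto simp: B_def\<close>)
  also have "\<dots> = v" unfolding B_def by (rule zsum_pos_units[OF vG])
  also have "v \<otimes>\<^bsub>Z2_pow dim\<^esub> v = \<one>\<^bsub>Z2_pow dim\<^esub>" by (rule Z2_square[OF vG])
  finally have "zsum dim lam ((\<lambda>k. (k, 0)) ` S \<union> B) = \<one>\<^bsub>Z2_pow dim\<^esub>" .
  moreover have "(\<lambda>k. (k, 0)) ` S \<union> B \<subseteq> zeros p"
  proof
    fix F assume "F \<in> (\<lambda>k. (k, 0)) ` S \<union> B"
    then consider k where "k \<in> S" "F = (k, 0)" | "F \<in> B" by blast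
    then show "F \<in> zeros p"
    proof cases
      case 1
      then show ?thesis unfolding p(2) using S(1) c[OF 1(1)] by (auto simp: I_iff c'_def)
    next
      case 2
      obtain k t where kt: "F = (k, t)" by fastforce
      have F: "(k, t) \<in> J" "v (pos (k, t)) = 1" using 2 kt by (auto simp: B_def)
      have "t \<noteq> c' k" using F vk[of k] by (auto simp: c'_def J_iff)
      then show ?thesis unfolding p(2) kt using F J_subset by auto
    qed
  qed
  ultimately have "(\<lambda>k. (k, 0)) ` S \<union> B = {}" using ind[OF p(1)] unfolding zindep_def by blast
  then show False using S(2) by simp
qed

text \<open>Minors with a single block force the ones in the diagonal blocks, and nonzero
  off-diagonal blocks are declared to be edges. A minimal set of vertices with successors would give
  a submatrix whose rows all have exactly two ones, against \<open>vertex_minor\<close>.\<close>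

lemma ex_digraph_char_normal:
  assumes lamG: "\<And>F. F \<in> I \<Longrightarrow> lam F \<in> carrier (Z2_pow dim)"
    and ind: "\<And>p. p \<in> topspace P \<Longrightarrow> zindep dim lam (zeros p)"
    and unit: "\<And>F. F \<in> J \<Longrightarrow> lam F = zunit dim (pos F)"
  shows "\<exists>D \<in> acyclic_weighted_digraphs m \<omega>. \<forall>F\<in>I. lam F = digraph_char D F"
proof -
  have minor: "\<exists>k\<in>S. (\<Sum>k2\<in>S. lam (k2, 0) (pos (k, c k))) mod 2 = 1"
    if "S \<subseteq> {1..m}" "S \<noteq> {}" "\<And>k. k \<in> S \<Longrightarrow> 1 \<le> c k \<and> c k \<le> \<omega> k" for S c
    by (rule vertex_minor) (fact lamG ind unit that)+
  have k0: "(k, 0) \<in> I" if "k \<in> {1..m}" for k using that by (simp add: I_iff)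
  have l01: "lam (k, 0) (pos F) = 0 \<or> lam (k, 0) (pos F) = 1" if "k \<in> {1..m}" "F \<in> J" for k F
    using Z2_coord[OF lamG[OF k0[OF that(1)]] pos_less[OF that(2)]] .
  have diag: "lam (k, 0) (pos (k, t)) = 1" if kt: "(k, t) \<in> J" for k t
  proof -
    have k: "k \<in> {1..m}" "1 \<le> t" "t \<le> \<omega> k" using kt by (auto simp: J_iff)
    have "\<exists>k'\<in>{k}. (\<Sum>k2\<in>{k}. lam (k2, 0) (pos (k', t))) mod 2 = 1"
      by (rule minor[of "{k}" "\<lambda>_. t"]) (use k in auto)
    then show ?thesis using l01[OF k(1) kt] by auto
  qed
  define E where "E = {(k', k). k' \<in> {1..m} \<and> k \<in> {1..m} \<and> k' \<noteq> k \<and> (\<exists>t'. (k', t') \<in> J \<and> lam (k, 0) (pos (k', t')) = 1)}"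
  \<comment> \<open>The shift \<open>s + 1\<close> skips the label 0, which belongs to the facet of
    the factor that misses the base vertex.\<close>
  define w where "w = (\<lambda>e\<in>E. \<lambda>s\<in>{..<\<omega> (fst e)}. lam (snd e, 0) (pos (fst e, s + 1)))"
  have Em: "E \<subseteq> {1..m} \<times> {1..m}" by (auto simp: E_def)
  have ac: "acyclic E"
  proof (rule ccontr)
    assume "\<not> acyclic E"
    from not_acyclic_minimal_set[OF finite_atLeastAtMost Em this]
    obtain S f where S: "S \<noteq> {}" "S \<subseteq> {1..m}" and f: "\<forall>k\<in>S. f k \<in> S"
      and fu: "\<forall>k\<in>S. \<forall>k'\<in>S. (k, k') \<in> E \<longleftrightarrow> k' = f k"
      by (elim exE conjE) (rule that)
    have S': "f k \<in> S" "(k, k') \<in> E \<longleftrightarrow> k' = f k" if "k \<in> S" "k' \<in> S" for k k'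
      using f fu that by auto
    have fS: "finite S" by (rule finite_subset[OF S(2)]) simp
    have fE: "(k, f k) \<in> E" if "k \<in> S" for k using S'(2)[OF that] f that by simp
    have "\<forall>k\<in>S. \<exists>t. (k, t) \<in> J \<and> lam (f k, 0) (pos (k, t)) = 1" using fE by (auto simp: E_def)
    from bchoice[OF this] obtain c where c: "\<forall>k\<in>S. (k, c k) \<in> J \<and> lam (f k, 0) (pos (k, c k)) = 1" ..
    have "\<exists>k\<in>S. (\<Sum>k2\<in>S. lam (k2, 0) (pos (k, c k))) mod 2 = 1"
      by (rule minor[OF S(2,1)]) (use c in \<open>auto simp: J_iff\<close>)
    then obtain k where k: "k \<in> S" "(\<Sum>k2\<in>S. lam (k2, 0) (pos (k, c k))) mod 2 = 1" by blast
    have kJ: "(k, c k) \<in> J" "lam (f k, 0) (pos (k, c k)) = 1" using c k(1) by auto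
    have fk: "f k \<noteq> k" using fE[OF k(1)] by (auto simp: E_def)
    have z: "lam (k2, 0) (pos (k, c k)) = 0" if k2: "k2 \<in> S - {k} - {f k}" for k2
    proof -
      have "(k, k2) \<notin> E" using S'(2)[of k k2] k(1) k2 by blast
      moreover have km: "k \<in> {1..m}" "k2 \<in> {1..m}" "k \<noteq> k2" using k2 k(1) S(2) by auto
      ultimately have "lam (k2, 0) (pos (k, c k)) \<noteq> 1" using kJ(1) unfolding E_def by blast
      then show ?thesis using l01[OF km(2) kJ(1)] by blast
    qed
    \<comment> \<open>Modulo 2 the diagonal entry and the entry at the successor cancel.\<close>
    have "(\<Sum>k2\<in>S. lam (k2, 0) (pos (k, c k))) = lam (k, 0) (pos (k, c k)) + (lam (f k, 0) (pos (k, c k)) + (\<Sum>k2\<in>S - {k} - {f k}. lam (k2, 0) (pos (k, c k))))"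
      using sum.remove[OF fS k(1), of "\<lambda>k2. lam (k2, 0) (pos (k, c k))"]
        sum.remove[of "S - {k}" "f k" "\<lambda>k2. lam (k2, 0) (pos (k, c k))"] fS S'(1)[OF k(1) k(1)] fk by simp
    also have "\<dots> = 2" using diag[OF kJ(1)] kJ(2) z by simp
    finally show False using k(2) by simp
  qed
  have wc: "w (k', k) \<in> carrier (Z2_pow (\<omega> k')) - {\<one>\<^bsub>Z2_pow (\<omega> k')\<^esub>}" if e: "(k', k) \<in> E" for k' k
  proof -
    obtain t' where t': "k' \<in> {1..m}" "k \<in> {1..m}" "(k', t') \<in> J" "lam (k, 0) (pos (k', t')) = 1"
      using e by (auto simp: E_def)
    have we: "w (k', k) = (\<lambda>s\<in>{..<\<omega> k'}. lam (k, 0) (pos (k', s + 1)))" using e by (simp add: w_def)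
    have "lam (k, 0) (pos (k', s + 1)) = 0 \<or> lam (k, 0) (pos (k', s + 1)) = 1" if "s < \<omega> k'" for s
      by (rule l01[OF t'(2)]) (use that t'(1) in \<open>simp add: J_iff\<close>)
    then have "w (k', k) \<in> carrier (Z2_pow (\<omega> k'))" by (auto simp: Z2_carrier we)
    moreover have "w (k', k) (t' - 1) = 1" using t'(3,4) by (auto simp: we J_iff)
    moreover have "t' - 1 < \<omega> k'" using t'(3) by (auto simp: J_iff)
    ultimately show ?thesis by auto
  qed
  have "w \<in> (\<Pi>\<^sub>E (i, j)\<in>E. carrier (Z2_pow (\<omega> i)) - {\<one>\<^bsub>Z2_pow (\<omega> i)\<^esub>})"
  proof (rule PiE_I)
    fix e assume "e \<in> E"
    then show "w e \<in> (case e of (i, j) \<Rightarrow> carrier (Z2_pow (\<omega> i)) - {\<one>\<^bsub>Z2_pow (\<omega> i)\<^esub>})"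
      using wc by (cases e) simp
  qed (simp add: w_def)
  then have D: "(E, w) \<in> acyclic_weighted_digraphs m \<omega>" using Em ac by (simp add: acyclic_weighted_digraphs_def)
  have "lam F = digraph_char (E, w) F" if F: "F \<in> I" for F
  proof (cases "snd F = 0")
    case False
    then have "F \<in> J" using F by (simp add: J_def)
    then show ?thesis using unit digraph_char_unit by simp
  next
    case True
    then obtain k where Fk: "F = (k, 0)" by (metis prod.collapse)
    have k: "k \<in> {1..m}" using F Fk by (simp add: I_iff)
    have co: "lam F (pos (k', t')) = digraph_char (E, w) F (pos (k', t'))" if kt: "(k', t') \<in> J" for k' t'
    proof -
      have k': "k' \<in> {1..m}" "1 \<le> t'" "t' \<le> \<omega> k'" using kt by (auto simp: J_iff)
      show ?thesis
      proof (cases "k' = k")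
        case True
        then show ?thesis using diag kt unfolding Fk digraph_char_coord[OF kt] by simp
      next
        case ne: False
        show ?thesis
        proof (cases "(k', k) \<in> E")
          case True
          have "t' - 1 < \<omega> k'" "Suc (t' - 1) = t'" using k' by auto
          then have "w (k', k) (t' - 1) = lam (k, 0) (pos (k', t'))"
            using True by (simp add: w_def)
          then show ?thesis using True ne unfolding Fk digraph_char_coord[OF kt] by simp
        next
          case False
          then have "lam (k, 0) (pos (k', t')) \<noteq> 1" using ne k k'(1) kt unfolding E_def by blast
          then show ?thesis using False ne l01[OF k kt] unfolding Fk digraph_char_coord[OF kt] by simp
        qed
      qed
    qed
    show ?thesis
    proof (rule Z2_eqI[OF lamG[OF F] digraph_char_closed[OF D F]])
      fix i assume "i < dim"
      then obtain k' t' where "(k', t') \<in> J" "i = pos (k', t')" using pos_surj by (metis surj_pair)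
      then show "(lam F i = 1) = (digraph_char (E, w) F i = 1)" using co by simp
    qed
  qed
  then show ?thesis using D by blast
qed

text \<open>The vectors at the base vertex form a basis by independence there, and straightening
  them reduces to the normalized case; independence at the other points is preserved by an
  automorphism.\<close>

lemma ex_digraph_char:
  assumes lamG: "\<And>F. F \<in> I \<Longrightarrow> lam F \<in> carrier (Z2_pow dim)"
    and ind: "\<And>p. p \<in> topspace P \<Longrightarrow> zindep dim lam (zeros p)"
  shows "\<exists>D \<in> acyclic_weighted_digraphs m \<omega>. \<exists>\<alpha>\<in>iso (Z2_pow dim) (Z2_pow dim). \<forall>F\<in>I. \<alpha> (lam F) = digraph_char D F"
proof -
  obtain p where p: "p \<in> topspace P" "zeros p = {(k, t). (k, t) \<in> I \<and> t \<noteq> 0}"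
    by (rule ex_zeros_vertex[of "\<lambda>_. 0"]) auto
  have zJ: "zeros p = J" unfolding p(2) J_def by auto
  obtain \<alpha> where \<alpha>: "\<alpha> \<in> iso (Z2_pow dim) (Z2_pow dim)" "\<And>F. F \<in> J \<Longrightarrow> \<alpha> (lam F) = zunit dim (pos F)"
    by (rule zindep_basis_iso[OF pos_bij, of lam]) (use ind[OF p(1)] lamG J_subset zJ in auto)
  obtain \<beta> where \<beta>: "\<beta> \<in> iso (Z2_pow dim) (Z2_pow dim)" "\<And>g. g \<in> carrier (Z2_pow dim) \<Longrightarrow> \<beta> (\<alpha> g) = g"
    using Z2_iso_inverse[OF \<alpha>(1)] by metis
  have aG: "\<alpha> (lam F) \<in> carrier (Z2_pow dim)" if "F \<in> I" for F by (rule Z2_iso_closed[OF \<alpha>(1) lamG[OF that]])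
  have "zindep dim (\<lambda>F. \<alpha> (lam F)) (zeros p)" if p: "p \<in> topspace P" for p
  proof (rule zindep_iso[OF \<beta>(1)])
    have z: "F \<in> I" if "F \<in> zeros p" for F using that zeros_subset by blast
    show "\<alpha> (lam F) \<in> carrier (Z2_pow dim)" if "F \<in> zeros p" for F using aG z[OF that] by blast
    show "zindep dim (\<lambda>F. \<beta> (\<alpha> (lam F))) (zeros p)"
      unfolding zindep_def
    proof (intro allI impI)
      fix A assume A: "A \<subseteq> zeros p" "zsum dim (\<lambda>F. \<beta> (\<alpha> (lam F))) A = \<one>\<^bsub>Z2_pow dim\<^esub>"
      have "zsum dim (\<lambda>F. \<beta> (\<alpha> (lam F))) A = zsum dim lam A"
        by (rule zsum_cong) (use A(1) z \<beta>(2)[OF lamG] in auto)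
      then show "A = {}" using ind[OF p] A unfolding zindep_def by simp
    qed
  qed simp
  then have "\<exists>D \<in> acyclic_weighted_digraphs m \<omega>. \<forall>F\<in>I. \<alpha> (lam F) = digraph_char D F"
    by (intro ex_digraph_char_normal[of "\<lambda>F. \<alpha> (lam F)"] aG \<alpha>(2)) auto
  then show ?thesis using \<alpha>(1) by blast
qed

text \<open>An automorphism that fixes all unit vectors is the identity, so the matrices coincide,
  and the digraph is read off from their off-diagonal blocks.\<close>

lemma digraph_char_inj:
  assumes D: "D \<in> acyclic_weighted_digraphs m \<omega>" and D': "D' \<in> acyclic_weighted_digraphs m \<omega>"
    and \<alpha>: "\<alpha> \<in> iso (Z2_pow dim) (Z2_pow dim)" and eq: "\<forall>F\<in>I. \<alpha> (digraph_char D F) = digraph_char D' F"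
  shows "D = D'"
proof -
  have id: "\<alpha> v = v" if v: "v \<in> carrier (Z2_pow dim)" for v
  proof -
    let ?B = "{F\<in>J. v (pos F) = 1}"
    have "\<alpha> v = \<alpha> (zsum dim (\<lambda>F. zunit dim (pos F)) ?B)" using zsum_pos_units[OF v] by simp
    also have "\<dots> = zsum dim (\<lambda>F. \<alpha> (zunit dim (pos F))) ?B"
      by (rule zsum_hom) (use \<alpha> in \<open>auto simp: iso_iff\<close>)
    also have "\<dots> = zsum dim (\<lambda>F. zunit dim (pos F)) ?B"
    proof (rule zsum_cong)
      fix F assume "F \<in> ?B"
      then have F: "F \<in> J" by simp
      then have "F \<in> I" using J_subset by blast
      then show "\<alpha> (zunit dim (pos F)) = zunit dim (pos F)" using eq digraph_char_unit[OF F] by metis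
    qed
    finally show ?thesis using zsum_pos_units[OF v] by simp
  qed
  have same: "digraph_char D F = digraph_char D' F" if "F \<in> I" for F
    using eq id[OF digraph_char_closed[OF D that]] that by simp
  \<comment> \<open>A weight is never zero, so an edge leaves a nonzero block in the matrix and
    cannot be missing on the other side.\<close>
  have half: "(k', k) \<in> fst D2" "snd D1 (k', k) s = snd D2 (k', k) s"
    if D1: "D1 \<in> acyclic_weighted_digraphs m \<omega>" and s: "\<And>F. F \<in> I \<Longrightarrow> digraph_char D1 F = digraph_char D2 F"
      and D2: "D2 \<in> acyclic_weighted_digraphs m \<omega>" and e: "(k', k) \<in> fst D1" for D1 D2 k' k s
  proof -
    note w = digraph_weight_closed[OF D1 e]
    have kI: "(k, 0) \<in> I" using w(4) by (simp add: I_iff)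
    have co: "snd D1 (k', k) s = (if (k', k) \<in> fst D2 then snd D2 (k', k) s else 0)" if sl: "s < \<omega> k'" for s
    proof -
      have kt: "(k', s + 1) \<in> J" using sl w(3) by (simp add: J_iff)
      have "digraph_char D1 (k, 0) (pos (k', s + 1)) = digraph_char D2 (k, 0) (pos (k', s + 1))"
        using s[OF kI] by simp
      then show ?thesis unfolding digraph_char_coord[OF kt] using w(5) e by simp
    qed
    show e2: "(k', k) \<in> fst D2"
    proof (rule ccontr)
      assume "(k', k) \<notin> fst D2"
      then have "snd D1 (k', k) = \<one>\<^bsub>Z2_pow (\<omega> k')\<^esub>"
        by (intro Z2_eqI[OF w(1) Z2_one_closed]) (simp add: co)
      then show False using w(2) by simp
    qed
    show "snd D1 (k', k) s = snd D2 (k', k) s"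
    proof (cases "s < \<omega> k'")
      case True
      then show ?thesis using co e2 by simp
    next
      case False
      then show ?thesis using w(1) digraph_weight_closed(1)[OF D2 e2] by (simp add: Z2_carrier extensional_def)
    qed
  qed
  have "e \<in> fst D'" if "e \<in> fst D" for e
    using half(1)[of D D' "fst e" "snd e"] D D' same that by simp
  moreover have "e \<in> fst D" if "e \<in> fst D'" for e
    using half(1)[of D' D "fst e" "snd e"] D D' same that by simp
  ultimately have EE: "fst D = fst D'" by blast
  have ext: "snd D0 \<in> extensional (fst D0)" if "D0 \<in> acyclic_weighted_digraphs m \<omega>" for D0
    using that by (auto simp: acyclic_weighted_digraphs_def PiE_def)
  have "snd D = snd D'"
  proof (rule extensionalityI[OF ext[OF D]])
    show "snd D' \<in> extensional (fst D)" using ext[OF D'] EE by simp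
    fix e assume e: "e \<in> fst D"
    show "snd D e = snd D' e"
    proof
      fix s show "snd D e s = snd D' e s"
        using half(2)[of D D' "fst e" "snd e" s] D D' same e by simp
    qed
  qed
  then show ?thesis using EE by (simp add: prod_eq_iff)
qed

end

section \<open>Iterated partial derivatives\<close>

lemma continuous_map_line:
  assumes "x \<in> topspace (Euclidean_space n)" "i < n"
  shows "continuous_map euclideanreal (Euclidean_space n) (\<lambda>t. x(i := t))"
proof -
  have "continuous_map euclideanreal (Euclidean_space n) (\<lambda>t j. if j < n then (if j = i then t else x j) else 0)"
    unfolding continuous_map_componentwise_Euclidean_space
    by (auto simp del: continuous_map_iff_continuous2)
  then show ?thesis
    by (rule continuous_map_eq) (use assms in \<open>auto simp: topspace_Euclidean_space fun_eq_iff\<close>)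
qed

lemma eventually_line_in:
  assumes "openin (Euclidean_space n) U" "x \<in> U" "i < n"
  shows "eventually (\<lambda>t. x(i := t) \<in> U) (nhds (x i))"
proof -
  have "x \<in> topspace (Euclidean_space n)" using assms openin_subset by blast
  from openin_continuous_map_preimage[OF continuous_map_line[OF this assms(3)] assms(1)]
  have "open {t. x(i := t) \<in> U}" by simp
  moreover have "x i \<in> {t. x(i := t) \<in> U}" using assms(2) by simp
  ultimately show ?thesis unfolding eventually_nhds by (intro exI[of _ "{t. x(i := t) \<in> U}"]) auto
qed

lemma has_real_derivative_line_cong:
  assumes "openin (Euclidean_space n) U" "x \<in> U" "i < n" "\<And>y. y \<in> U \<Longrightarrow> f y = g y"
    and "((\<lambda>t. f (x(i := t))) has_real_derivative d) (at (x i))"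
  shows "((\<lambda>t. g (x(i := t))) has_real_derivative d) (at (x i))"
proof -
  have "eventually (\<lambda>t. f (x(i := t)) = g (x(i := t))) (nhds (x i))"
    using eventually_line_in[OF assms(1-3)] by (rule eventually_mono) (use assms(4) in blast)
  then show ?thesis using assms(5) DERIV_cong_ev by metis
qed

lemma Ck_on_continuous: "Ck_on n k U f \<Longrightarrow> continuous_map (subtopology (Euclidean_space n) U) euclideanreal f"
  by (cases k) auto

text \<open>A partial derivative at \<open>x\<close> sees \<open>f\<close> along a line that may
  leave \<open>U\<close>. Openness keeps the line in \<open>U\<close> near \<open>x\<close>, so
  values off \<open>U\<close> have no influence.\<close>

lemma Ck_on_cong:
  assumes U: "openin (Euclidean_space n) U" and eq: "\<And>x. x \<in> U \<Longrightarrow> f x = g x" and f: "Ck_on n k U f"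
  shows "Ck_on n k U g"
proof -
  have c: "continuous_map (subtopology (Euclidean_space n) U) euclideanreal g"
    by (rule continuous_map_eq[OF Ck_on_continuous[OF f]]) (use eq in auto)
  show ?thesis
  proof (cases k)
    case (Suc k')
    have "\<exists>f'. (\<forall>x\<in>U. ((\<lambda>t. g (x(i := t))) has_real_derivative f' x) (at (x i))) \<and> Ck_on n k' U f'" if i: "i < n" for i
    proof -
      obtain f' where f': "\<forall>x\<in>U. ((\<lambda>t. f (x(i := t))) has_real_derivative f' x) (at (x i))" "Ck_on n k' U f'"
        using f i Suc by auto
      have "\<forall>x\<in>U. ((\<lambda>t. g (x(i := t))) has_real_derivative f' x) (at (x i))"
      proof
        fix x assume x: "x \<in> U"
        show "((\<lambda>t. g (x(i := t))) has_real_derivative f' x) (at (x i))"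
          by (rule has_real_derivative_line_cong[OF U x i eq bspec[OF f'(1) x]])
      qed
      then show ?thesis using f'(2) by blast
    qed
    then show ?thesis using c Suc by simp
  qed (use c in simp)
qed

lemma Ck_on_const: "Ck_on n k U (\<lambda>x. a)"
proof (induction k arbitrary: a)
  case (Suc k)
  have "\<exists>f'. (\<forall>x\<in>U. ((\<lambda>t. a) has_real_derivative f' x) (at (x i))) \<and> Ck_on n k U f'" for i
    by (rule exI[of _ "\<lambda>x. 0"]) (use Suc in auto)
  then show ?case by simp
qed simp

lemma Ck_on_coordinate: "Ck_on n k U (\<lambda>x. x j)"
proof (cases k)
  case (Suc k')
  have "\<exists>f'. (\<forall>x\<in>U. ((\<lambda>t. (x(i := t)) j) has_real_derivative f' x) (at (x i))) \<and> Ck_on n k' U f'" for i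
    by (rule exI[of _ "\<lambda>x. if i = j then 1 else 0"]) (auto simp: Ck_on_const)
  then show ?thesis
    using Suc continuous_map_from_subtopology[OF continuous_map_Euclidean_coordinate] by simp
qed (simp add: continuous_map_from_subtopology continuous_map_Euclidean_coordinate)

text \<open>Lowers the order of the undifferentiated factors in the product and quotient
  rules.\<close>

lemma Ck_on_Suc_imp: "Ck_on n (Suc k) U f \<Longrightarrow> Ck_on n k U f"
proof (induction k arbitrary: f)
  case (Suc k)
  have c: "continuous_map (subtopology (Euclidean_space n) U) euclideanreal f" by (rule Ck_on_continuous[OF Suc.prems])
  have "\<exists>f'. (\<forall>x\<in>U. ((\<lambda>t. f (x(i := t))) has_real_derivative f' x) (at (x i))) \<and> Ck_on n k U f'" if i: "i < n" for i
  proof -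
    obtain f' where f': "\<forall>x\<in>U. ((\<lambda>t. f (x(i := t))) has_real_derivative f' x) (at (x i))" "Ck_on n (Suc k) U f'"
      using Suc.prems i unfolding Ck_on.simps(2)[of n "Suc k"] by blast
    then show ?thesis using Suc.IH by blast
  qed
  then show ?case using c by simp
qed simp

lemma Ck_on_add: "Ck_on n k U f \<Longrightarrow> Ck_on n k U g \<Longrightarrow> Ck_on n k U (\<lambda>x. f x + g x)"
proof (induction k arbitrary: f g)
  case 0
  then show ?case by (simp add: continuous_map_add)
next
  case (Suc k)
  have c: "continuous_map (subtopology (Euclidean_space n) U) euclideanreal (\<lambda>x. f x + g x)"
    by (rule continuous_map_add[OF Ck_on_continuous[OF Suc.prems(1)] Ck_on_continuous[OF Suc.prems(2)]])
  have "\<exists>h'. (\<forall>x\<in>U. ((\<lambda>t. f (x(i := t)) + g (x(i := t))) has_real_derivative h' x) (at (x i))) \<and> Ck_on n k U h'" if i: "i < n" for i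
  proof -
    obtain f' where f': "\<forall>x\<in>U. ((\<lambda>t. f (x(i := t))) has_real_derivative f' x) (at (x i))" "Ck_on n k U f'"
      using Suc.prems(1) i by auto
    obtain g' where g': "\<forall>x\<in>U. ((\<lambda>t. g (x(i := t))) has_real_derivative g' x) (at (x i))" "Ck_on n k U g'"
      using Suc.prems(2) i by auto
    show ?thesis
      by (rule exI[of _ "\<lambda>x. f' x + g' x"]) (use f' g' Suc.IH in \<open>auto intro!: DERIV_add\<close>)
  qed
  then show ?case using c by simp
qed

lemma Ck_on_mult: "Ck_on n k U f \<Longrightarrow> Ck_on n k U g \<Longrightarrow> Ck_on n k U (\<lambda>x. f x * g x)"
proof (induction k arbitrary: f g)
  case 0
  then show ?case by (simp add: continuous_map_real_mult)
next
  case (Suc k)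
  have c: "continuous_map (subtopology (Euclidean_space n) U) euclideanreal (\<lambda>x. f x * g x)"
    by (rule continuous_map_real_mult[OF Ck_on_continuous[OF Suc.prems(1)] Ck_on_continuous[OF Suc.prems(2)]])
  have "\<exists>h'. (\<forall>x\<in>U. ((\<lambda>t. f (x(i := t)) * g (x(i := t))) has_real_derivative h' x) (at (x i))) \<and> Ck_on n k U h'" if i: "i < n" for i
  proof -
    obtain f' where f': "\<forall>x\<in>U. ((\<lambda>t. f (x(i := t))) has_real_derivative f' x) (at (x i))" "Ck_on n k U f'"
      using Suc.prems(1) i by auto
    obtain g' where g': "\<forall>x\<in>U. ((\<lambda>t. g (x(i := t))) has_real_derivative g' x) (at (x i))" "Ck_on n k U g'"
      using Suc.prems(2) i by auto
    have "Ck_on n k U (\<lambda>x. f' x * g x + g' x * f x)"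
      by (rule Ck_on_add[OF Suc.IH[OF f'(2) Ck_on_Suc_imp[OF Suc.prems(2)]] Suc.IH[OF g'(2) Ck_on_Suc_imp[OF Suc.prems(1)]]])
    moreover have "((\<lambda>t. f (x(i := t)) * g (x(i := t))) has_real_derivative f' x * g x + g' x * f x) (at (x i))"
      if x: "x \<in> U" for x
      using DERIV_mult[OF bspec[OF f'(1) x] bspec[OF g'(1) x]] unfolding fun_upd_triv .
    ultimately show ?thesis by (intro exI[of _ "\<lambda>x. f' x * g x + g' x * f x"]) simp
  qed
  then show ?case using c by simp
qed

text \<open>The derivative is a product of \<open>f'\<close> with the inverse itself at one order
  less, so the induction closes by the product rule.\<close>

lemma Ck_on_inverse: "Ck_on n k U f \<Longrightarrow> (\<And>x. x \<in> U \<Longrightarrow> f x \<noteq> 0) \<Longrightarrow> Ck_on n k U (\<lambda>x. inverse (f x))"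
proof (induction k)
  case 0
  then show ?case by (auto intro!: continuous_map_real_inverse)
next
  case (Suc k)
  have c: "continuous_map (subtopology (Euclidean_space n) U) euclideanreal (\<lambda>x. inverse (f x))"
    by (rule continuous_map_real_inverse[OF Ck_on_continuous[OF Suc.prems(1)]]) (use Suc.prems(2) in auto)
  have IH: "Ck_on n k U (\<lambda>x. inverse (f x))" by (rule Suc.IH[OF Ck_on_Suc_imp[OF Suc.prems(1)] Suc.prems(2)])
  have "\<exists>h'. (\<forall>x\<in>U. ((\<lambda>t. inverse (f (x(i := t)))) has_real_derivative h' x) (at (x i))) \<and> Ck_on n k U h'" if i: "i < n" for i
  proof -
    obtain f' where f': "\<forall>x\<in>U. ((\<lambda>t. f (x(i := t))) has_real_derivative f' x) (at (x i))" "Ck_on n k U f'"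
      using Suc.prems(1) i by auto
    have "Ck_on n k U (\<lambda>x. (-1) * (inverse (f x) * f' x * inverse (f x)))"
      by (rule Ck_on_mult[OF Ck_on_const Ck_on_mult[OF Ck_on_mult[OF IH f'(2)] IH]])
    moreover have "((\<lambda>t. inverse (f (x(i := t)))) has_real_derivative (-1) * (inverse (f x) * f' x * inverse (f x))) (at (x i))"
      if x: "x \<in> U" for x
    proof -
      have "f (x(i := x i)) \<noteq> 0" using Suc.prems(2)[OF x] by simp
      then have "((\<lambda>t. inverse (f (x(i := t)))) has_real_derivative
          - (inverse (f (x(i := x i))) * f' x * inverse (f (x(i := x i))))) (at (x i))"
        by (rule DERIV_inverse'[OF bspec[OF f'(1) x]])
      then show ?thesis unfolding fun_upd_triv by (simp only: mult_minus1)
    qed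
    ultimately show ?thesis by (intro exI[of _ "\<lambda>x. (-1) * (inverse (f x) * f' x * inverse (f x))"]) simp
  qed
  then show ?case using c by simp
qed

lemma Ck_on_prod: "finite A \<Longrightarrow> (\<And>a. a \<in> A \<Longrightarrow> Ck_on n k U (f a)) \<Longrightarrow> Ck_on n k U (\<lambda>x. \<Prod>a\<in>A. f a x)"
proof (induction A rule: finite_induct)
  case (insert b A)
  have "Ck_on n k U (\<lambda>x. f b x * (\<Prod>a\<in>A. f a x))"
    by (rule Ck_on_mult) (use insert in simp_all)
  then show ?case using insert.hyps by simp
qed (simp add: Ck_on_const)

text \<open>Provides the locally constant signs in the changes of charts: off the hyperplane the
  function is continuous and all its derivatives vanish.\<close>

lemma Ck_on_sign:
  assumes U: "openin (Euclidean_space n) U" and nz: "\<And>x. x \<in> U \<Longrightarrow> x j \<noteq> 0"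
  shows "Ck_on n k U (\<lambda>x. if x j < 0 then a else b)"
proof -
  let ?f = "\<lambda>x. if x j < 0 then a else b :: real"
  have oc: "continuous_map (subtopology (Euclidean_space n) U) euclideanreal (\<lambda>x. x j)"
    by (rule continuous_map_from_subtopology[OF continuous_map_Euclidean_coordinate])
  \<comment> \<open>The quotient is the sign of \<open>x j\<close>, and this affine expression takes
    it to \<open>a\<close> or \<open>b\<close>.\<close>
  have "continuous_map (subtopology (Euclidean_space n) U) euclideanreal (\<lambda>x. (a + b) / 2 + (b - a) / 2 * (x j / \<bar>x j\<bar>))"
    by (intro continuous_map_add continuous_map_real_mult continuous_map_real_divide continuous_map_real_abs oc)
      (use nz in auto)
  then have c: "continuous_map (subtopology (Euclidean_space n) U) euclideanreal ?f"
  proof (rule continuous_map_eq)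
    fix x assume "x \<in> topspace (subtopology (Euclidean_space n) U)"
    then have "x j \<noteq> 0" using nz by auto
    then consider "x j < 0" | "x j > 0" by linarith
    then show "(a + b) / 2 + (b - a) / 2 * (x j / \<bar>x j\<bar>) = ?f x"
      by cases (auto simp: field_simps)
  qed
  show ?thesis
  proof (cases k)
    case (Suc k')
    have "(\<forall>x\<in>U. ((\<lambda>t. ?f (x(i := t))) has_real_derivative 0) (at (x i)))" if i: "i < n" for i
    proof
      fix x assume x: "x \<in> U"
      show "((\<lambda>t. ?f (x(i := t))) has_real_derivative 0) (at (x i))"
      proof (cases "i = j")
        case False
        then show ?thesis by simp
      next
        case True
        have "eventually (\<lambda>t. (t < 0) = (x j < 0)) (nhds (x j))"
        proof (cases "x j < 0")
          case True
          then have "eventually (\<lambda>t. t \<in> {..<0}) (nhds (x j))" by (intro eventually_nhds_in_open) auto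
          then show ?thesis by eventually_elim (use True in auto)
        next
          case False
          then have "x j > 0" using nz[OF x] by simp
          then have "eventually (\<lambda>t. t \<in> {0<..}) (nhds (x j))" by (intro eventually_nhds_in_open) auto
          then show ?thesis by eventually_elim (use False in auto)
        qed
        then have "eventually (\<lambda>t. ?f (x(i := t)) = ?f x) (nhds (x i))"
          unfolding True by eventually_elim simp
        moreover have "((\<lambda>t. ?f x) has_real_derivative 0) (at (x i))" by (rule DERIV_const)
        ultimately show ?thesis using DERIV_cong_ev[of "x i" "x i" "\<lambda>t. ?f (x(i := t))" "\<lambda>t. ?f x" 0 0] by simp
      qed
    qed
    then have "\<exists>f'. (\<forall>x\<in>U. ((\<lambda>t. ?f (x(i := t))) has_real_derivative f' x) (at (x i))) \<and> Ck_on n k' U f'" if "i < n" for i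
      using that by (intro exI[of _ "\<lambda>x. 0"]) (auto simp: Ck_on_const)
    then show ?thesis using c Suc by simp
  qed (use c in simp)
qed

section \<open>The small cover of a characteristic function\<close>

definition sg :: "int \<Rightarrow> real" where "sg b = (if b = 1 then - 1 else 1)"

text \<open>\<open>sg\<close> is the nontrivial character of the group with two elements, so it
  turns sums into products.\<close>

lemma sg_sum:
  assumes "finite A" "\<And>x. x \<in> A \<Longrightarrow> f x = 0 \<or> f x = (1::int)"
  shows "sg ((\<Sum>x\<in>A. f x) mod 2) = (\<Prod>x\<in>A. sg (f x))"
  using assms
proof (induction A rule: finite_induct)
  case (insert a A)
  define s where "s = (\<Sum>x\<in>A. f x) mod 2"
  have s: "s = 0 \<or> s = 1" by (auto simp: s_def)
  have "(\<Sum>x\<in>insert a A. f x) mod 2 = (f a + s) mod 2"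
    using insert.hyps by (simp add: s_def mod_add_right_eq)
  moreover have "sg ((f a + s) mod 2) = sg (f a) * sg s"
    using s insert.prems[of a] by (auto simp: sg_def)
  moreover have "sg s = (\<Prod>x\<in>A. sg (f x))" using insert.IH insert.prems by (simp add: s_def)
  ultimately show ?case using insert.hyps by simp
qed (simp add: sg_def)

text \<open>\<open>q p g\<close> encodes the class of \<open>(p, g)\<close> in the quotient of \<open>P \<times> \<int>\<^sub>2\<^sup>n\<close> by the stabilizers that
  \<open>lam\<close> prescribes.\<close>

locale char_model = simplex_coords P m \<omega> u
  for P :: "'p topology" and m \<omega> u +
  fixes lam :: "nat \<times> nat \<Rightarrow> nat \<Rightarrow> int" and q :: "'p \<Rightarrow> (nat \<Rightarrow> int) \<Rightarrow> 'a"
  assumes lamG: "\<And>F. F \<in> I \<Longrightarrow> lam F \<in> carrier (Z2_pow dim)"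
    and lam_indep: "\<And>p. p \<in> topspace P \<Longrightarrow> zindep dim lam (zeros p)"
    and q_eq: "\<And>p p' g g'. p \<in> topspace P \<Longrightarrow> p' \<in> topspace P \<Longrightarrow> g \<in> carrier (Z2_pow dim) \<Longrightarrow> g' \<in> carrier (Z2_pow dim) \<Longrightarrow>
      q p g = q p' g' \<longleftrightarrow> p = p' \<and> g \<otimes>\<^bsub>Z2_pow dim\<^esub> g' \<in> zsum dim lam ` Pow (zeros p)"
begin

abbreviation "G \<equiv> Z2_pow dim"
abbreviation "E \<equiv> Euclidean_space dim"

section \<open>The quotient space and its action\<close>

definition pts where "pts = (\<lambda>(p, g). q p g) ` (topspace P \<times> carrier G)"

text \<open>The quotient topology of \<open>P\<close> times a discrete group, tested on the sheet of
  each \<open>g\<close>.\<close>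

definition mtop where "mtop = topology (\<lambda>U. U \<subseteq> pts \<and> (\<forall>g\<in>carrier G. openin P {p\<in>topspace P. q p g \<in> U}))"

lemma q_in: "p \<in> topspace P \<Longrightarrow> g \<in> carrier G \<Longrightarrow> q p g \<in> pts"
  by (auto simp: pts_def)

lemma openin_mtop: "openin mtop U \<longleftrightarrow> U \<subseteq> pts \<and> (\<forall>g\<in>carrier G. openin P {p\<in>topspace P. q p g \<in> U})"
proof -
  have "istopology (\<lambda>U. U \<subseteq> pts \<and> (\<forall>g\<in>carrier G. openin P {p\<in>topspace P. q p g \<in> U}))"
    unfolding istopology_def
  proof (intro conjI allI impI ballI)
    fix U V g assume U: "U \<subseteq> pts \<and> (\<forall>g\<in>carrier G. openin P {p\<in>topspace P. q p g \<in> U})"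
      and V: "V \<subseteq> pts \<and> (\<forall>g\<in>carrier G. openin P {p\<in>topspace P. q p g \<in> V})"
    show "U \<inter> V \<subseteq> pts" using U by blast
    assume g: "g \<in> carrier G"
    have e: "{p\<in>topspace P. q p g \<in> U \<inter> V} = {p\<in>topspace P. q p g \<in> U} \<inter> {p\<in>topspace P. q p g \<in> V}" by blast
    show "openin P {p\<in>topspace P. q p g \<in> U \<inter> V}"
      unfolding e by (rule openin_Int) (use U V g in auto)
  next
    fix K g assume K: "\<forall>U\<in>K. U \<subseteq> pts \<and> (\<forall>g\<in>carrier G. openin P {p\<in>topspace P. q p g \<in> U})"
    show "\<Union>K \<subseteq> pts" using K by blast
    assume g: "g \<in> carrier G"
    have "{p\<in>topspace P. q p g \<in> \<Union>K} = (\<Union>U\<in>K. {p\<in>topspace P. q p g \<in> U})" by blast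
    moreover have "openin P (\<Union>U\<in>K. {p\<in>topspace P. q p g \<in> U})" using K g by (intro openin_Union) blast
    ultimately show "openin P {p\<in>topspace P. q p g \<in> \<Union>K}" by simp
  qed
  then show ?thesis unfolding mtop_def by simp
qed

lemma topspace_mtop: "topspace mtop = pts"
proof
  show "topspace mtop \<subseteq> pts" unfolding topspace_def using openin_mtop by blast
  have "openin mtop pts"
    unfolding openin_mtop
  proof (intro conjI ballI)
    fix g assume "g \<in> carrier G"
    then have "{p\<in>topspace P. q p g \<in> pts} = topspace P" using q_in by blast
    then show "openin P {p\<in>topspace P. q p g \<in> pts}" by simp
  qed simp
  then show "pts \<subseteq> topspace mtop" by (rule openin_subset)
qed

definition prj where "prj x = (SOME p. p \<in> topspace P \<and> (\<exists>g\<in>carrier G. x = q p g))"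
text \<open>Determined by the class only modulo the subgroup at \<open>prj x\<close>, see
  \<open>gr_q\<close>.\<close>

definition gr where "gr x = (SOME g. g \<in> carrier G \<and> x = q (prj x) g)"

lemma prj_q:
  assumes "p \<in> topspace P" "g \<in> carrier G" shows "prj (q p g) = p"
proof -
  have "\<exists>p'. p' \<in> topspace P \<and> (\<exists>g'\<in>carrier G. q p g = q p' g')" using assms by blast
  from someI_ex[OF this] have "prj (q p g) \<in> topspace P \<and> (\<exists>g'\<in>carrier G. q p g = q (prj (q p g)) g')"
    unfolding prj_def .
  then obtain g' where "prj (q p g) \<in> topspace P" "g' \<in> carrier G" "q p g = q (prj (q p g)) g'" by blast
  then show ?thesis using q_eq[of p "prj (q p g)" g g'] assms by simp
qed

lemma pts_cases:
  assumes "x \<in> pts"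
  shows "prj x \<in> topspace P" "gr x \<in> carrier G" "x = q (prj x) (gr x)"
proof -
  obtain p g where pg: "p \<in> topspace P" "g \<in> carrier G" "x = q p g" using assms by (auto simp: pts_def)
  then have "prj x = p" using prj_q by simp
  then have "\<exists>g. g \<in> carrier G \<and> x = q (prj x) g" using pg by blast
  from someI_ex[OF this] have "gr x \<in> carrier G \<and> x = q (prj x) (gr x)" unfolding gr_def .
  then show "prj x \<in> topspace P" "gr x \<in> carrier G" "x = q (prj x) (gr x)" using \<open>prj x = p\<close> pg by auto
qed

lemma gr_q:
  assumes "p \<in> topspace P" "g \<in> carrier G"
  shows "gr (q p g) \<otimes>\<^bsub>G\<^esub> g \<in> zsum dim lam ` Pow (zeros p)"
proof -
  note x = pts_cases[OF q_in[OF assms]]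
  have "q p (gr (q p g)) = q p g" using x(3) unfolding prj_q[OF assms] by simp
  then show ?thesis using q_eq[OF assms(1,1) x(2) assms(2)] by simp
qed

lemma continuous_map_mtopI:
  assumes "\<And>g. g \<in> carrier G \<Longrightarrow> continuous_map P Y (\<lambda>p. f (q p g))"
  shows "continuous_map mtop Y f"
  unfolding continuous_map_def topspace_mtop
proof (intro conjI allI impI)
  show "f \<in> pts \<rightarrow> topspace Y"
  proof
    fix x assume "x \<in> pts"
    note x = pts_cases[OF this]
    have "f (q (prj x) (gr x)) \<in> topspace Y"
      using continuous_map_image_subset_topspace[OF assms[OF x(2)]] x(1) by blast
    then show "f x \<in> topspace Y" using x(3) by simp
  qed
  fix U assume U: "openin Y U"
  show "openin mtop {x \<in> pts. f x \<in> U}"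
    unfolding openin_mtop
  proof (intro conjI ballI)
    fix g assume g: "g \<in> carrier G"
    have "{p \<in> topspace P. q p g \<in> {x \<in> pts. f x \<in> U}} = {p \<in> topspace P. f (q p g) \<in> U}" using q_in g by blast
    then show "openin P {p \<in> topspace P. q p g \<in> {x \<in> pts. f x \<in> U}}"
      using openin_continuous_map_preimage[OF assms[OF g] U] by simp
  qed auto
qed

lemma q_cont: "g \<in> carrier G \<Longrightarrow> continuous_map P mtop (\<lambda>p. q p g)"
  unfolding continuous_map_def topspace_mtop using q_in by (auto simp: openin_mtop)

lemma prj_cont: "continuous_map mtop P prj"
proof (rule continuous_map_mtopI)
  fix g assume g: "g \<in> carrier G"
  show "continuous_map P P (\<lambda>p. prj (q p g))"
    by (rule continuous_map_eq[OF continuous_map_id]) (simp add: prj_q g)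
qed

text \<open>The sheet of the neutral element is a section of \<open>prj\<close>; restricting to it
  shows that a set with open preimage is open.\<close>

lemma prj_quotient: "quotient_map mtop P prj"
  unfolding quotient_map_def topspace_mtop
proof (intro conjI allI impI)
  show im: "prj ` pts = topspace P"
  proof
    show "prj ` pts \<subseteq> topspace P" using pts_cases(1) by blast
    show "topspace P \<subseteq> prj ` pts"
    proof
      fix p assume p: "p \<in> topspace P"
      then have "prj (q p \<one>\<^bsub>G\<^esub>) = p" by (simp add: prj_q)
      then show "p \<in> prj ` pts" using q_in[OF p Z2_one_closed] by (metis imageI)
    qed
  qed
  fix U assume U: "U \<subseteq> topspace P"
  show "openin mtop {x \<in> pts. prj x \<in> U} = openin P U"
  proof
    assume "openin P U"
    then show "openin mtop {x \<in> pts. prj x \<in> U}"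
      using openin_continuous_map_preimage[OF prj_cont] by (simp add: topspace_mtop)
  next
    assume "openin mtop {x \<in> pts. prj x \<in> U}"
    then have "openin P {p \<in> topspace P. q p \<one>\<^bsub>G\<^esub> \<in> {x \<in> pts. prj x \<in> U}}"
      unfolding openin_mtop using Z2_one_closed by blast
    moreover have "{p \<in> topspace P. q p \<one>\<^bsub>G\<^esub> \<in> {x \<in> pts. prj x \<in> U}} = U"
      using U q_in[OF _ Z2_one_closed] prj_q[OF _ Z2_one_closed] by auto
    ultimately show "openin P U" by simp
  qed
qed

lemma compact_mtop: "compact_space mtop"
proof -
  have "pts = (\<Union>g\<in>carrier G. (\<lambda>p. q p g) ` topspace P)" by (auto simp: pts_def)
  moreover have "compactin mtop (\<Union>g\<in>carrier G. (\<lambda>p. q p g) ` topspace P)"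
  proof (rule compactin_Union)
    show "finite ((\<lambda>g. (\<lambda>p. q p g) ` topspace P) ` carrier G)" by simp
    fix S assume "S \<in> (\<lambda>g. (\<lambda>p. q p g) ` topspace P) ` carrier G"
    then obtain g where g: "g \<in> carrier G" "S = (\<lambda>p. q p g) ` topspace P" by blast
    have "compactin P (topspace P)" using compact_P by (simp add: compact_space_def)
    then show "compactin mtop S" unfolding g(2) by (rule image_compactin[OF _ q_cont[OF g(1)]])
  qed
  ultimately show ?thesis by (simp add: compact_space_def topspace_mtop)
qed

text \<open>Restricted to \<open>pts\<close> because the elements of \<open>BijGroup pts\<close> are
  extensional.\<close>

definition mact where "mact h = (\<lambda>x\<in>pts. q (prj x) (h \<otimes>\<^bsub>G\<^esub> gr x))"

lemma mact_q:
  assumes "h \<in> carrier G" "p \<in> topspace P" "g \<in> carrier G"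
  shows "mact h (q p g) = q p (h \<otimes>\<^bsub>G\<^esub> g)"
proof -
  note x = pts_cases[OF q_in[OF assms(2,3)]]
  have "(h \<otimes>\<^bsub>G\<^esub> gr (q p g)) \<otimes>\<^bsub>G\<^esub> (h \<otimes>\<^bsub>G\<^esub> g) = gr (q p g) \<otimes>\<^bsub>G\<^esub> g"
    using assms x(2) by (metis Z2_assoc Z2_cancel Z2_closed Z2_comm)
  then have "q p (h \<otimes>\<^bsub>G\<^esub> gr (q p g)) = q p (h \<otimes>\<^bsub>G\<^esub> g)"
    using q_eq[OF assms(2,2) Z2_closed[OF assms(1) x(2)] Z2_closed[OF assms(1,3)]] gr_q[OF assms(2,3)] by simp
  then show ?thesis using q_in[OF assms(2,3)] by (simp add: mact_def prj_q[OF assms(2,3)])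
qed

lemma mact_in: "h \<in> carrier G \<Longrightarrow> x \<in> pts \<Longrightarrow> mact h x \<in> pts"
  using pts_cases[of x] by (simp add: mact_def q_in)

lemma prj_mact: "h \<in> carrier G \<Longrightarrow> x \<in> pts \<Longrightarrow> prj (mact h x) = prj x"
  using pts_cases[of x] by (simp add: mact_def prj_q)

lemma mact_mult:
  assumes "g \<in> carrier G" "h \<in> carrier G" "x \<in> pts" shows "mact (g \<otimes>\<^bsub>G\<^esub> h) x = mact g (mact h x)"
proof -
  note x = pts_cases[OF assms(3)]
  have "mact (g \<otimes>\<^bsub>G\<^esub> h) (q (prj x) (gr x)) = mact g (mact h (q (prj x) (gr x)))"
    using assms(1,2) x(1,2) by (simp add: mact_q Z2_assoc)
  then show ?thesis unfolding x(3)[symmetric] .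
qed

lemma mact_one: "x \<in> pts \<Longrightarrow> mact \<one>\<^bsub>G\<^esub> x = x"
  using pts_cases[of x] by (simp add: mact_def)

lemma mact_group_action: "group_action G pts mact"
proof -
  have inv: "mact h (mact h x) = x" if "h \<in> carrier G" "x \<in> pts" for h x
    using mact_mult[OF that(1,1,2)] mact_one[OF that(2)] Z2_square[OF that(1)] by simp
  have bij: "mact h \<in> Bij pts" if h: "h \<in> carrier G" for h
  proof -
    have "bij_betw (mact h) pts pts"
      by (rule bij_betw_byWitness[where f'="mact h"]) (use inv[OF h] mact_in[OF h] in auto)
    then show ?thesis by (simp add: Bij_def mact_def)
  qed
  have "mact \<in> hom G (BijGroup pts)"
  proof (rule homI)
    fix g assume "g \<in> carrier G" then show "mact g \<in> carrier (BijGroup pts)" using bij by (simp add: BijGroup_def)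
  next
    fix g h assume gh: "g \<in> carrier G" "h \<in> carrier G"
    have "mact (g \<otimes>\<^bsub>G\<^esub> h) = compose pts (mact g) (mact h)"
    proof
      fix x show "mact (g \<otimes>\<^bsub>G\<^esub> h) x = compose pts (mact g) (mact h) x"
        using mact_mult[OF gh, of x] by (cases "x \<in> pts") (simp_all add: compose_def mact_def)
    qed
    then show "mact (g \<otimes>\<^bsub>G\<^esub> h) = mact g \<otimes>\<^bsub>BijGroup pts\<^esub> mact h" using bij gh by (simp add: BijGroup_def)
  qed
  then show ?thesis
    by (simp add: group_action_def group_hom_def group_hom_axioms_def Z2_group group_BijGroup)
qed

lemma mact_cont: "h \<in> carrier G \<Longrightarrow> continuous_map mtop mtop (mact h)"
proof (rule continuous_map_mtopI)
  fix g assume h: "h \<in> carrier G" and g: "g \<in> carrier G"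
  show "continuous_map P mtop (\<lambda>p. mact h (q p g))"
    by (rule continuous_map_eq[OF q_cont[OF Z2_closed[OF h g]]]) (simp add: mact_q h g)
qed

lemma mact_fix:
  assumes "g \<in> carrier G" "x \<in> pts" shows "mact g x = x \<longleftrightarrow> g \<in> zsum dim lam ` Pow (zeros (prj x))"
proof -
  note x = pts_cases[OF assms(2)]
  have "mact g x = x \<longleftrightarrow> q (prj x) (g \<otimes>\<^bsub>G\<^esub> gr x) = q (prj x) (gr x)"
    using x(3) assms by (simp add: mact_def)
  also have "\<dots> \<longleftrightarrow> g \<otimes>\<^bsub>G\<^esub> gr x \<otimes>\<^bsub>G\<^esub> gr x \<in> zsum dim lam ` Pow (zeros (prj x))"
    using q_eq[OF x(1,1) Z2_closed[OF assms(1) x(2)] x(2)] by simp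
  also have "g \<otimes>\<^bsub>G\<^esub> gr x \<otimes>\<^bsub>G\<^esub> gr x = g"
    using assms x(2) by (simp add: Z2_assoc Z2_square)
  finally show ?thesis .
qed

lemma mact_orbit:
  assumes "x \<in> pts" shows "{y \<in> pts. prj y = prj x} = orbit G mact x"
proof (intro equalityI subsetI)
  note x = pts_cases[OF assms]
  fix y assume y: "y \<in> {y \<in> pts. prj y = prj x}"
  note y' = pts_cases[of y]
  have "mact (gr y \<otimes>\<^bsub>G\<^esub> gr x) x = q (prj x) (gr y \<otimes>\<^bsub>G\<^esub> gr x \<otimes>\<^bsub>G\<^esub> gr x)"
    using assms by (simp add: mact_def)
  also have "\<dots> = y" using y y' x(2) by (simp add: Z2_assoc Z2_square)
  finally show "y \<in> orbit G mact x" unfolding orbit_def using y y'(2) x(2) by (metis (mono_tags, lifting) Z2_closed mem_Collect_eq)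
next
  fix y assume "y \<in> orbit G mact x"
  then obtain g where "g \<in> carrier G" "y = mact g x" unfolding orbit_def by blast
  then show "y \<in> {y \<in> pts. prj y = prj x}" using mact_in prj_mact assms by simp
qed

end

context char_model
begin

section \<open>The vertices of \<open>P\<close> and their charts\<close>

definition choices where "choices = {c :: nat \<Rightarrow> nat. \<forall>k\<in>{1..m}. c k \<le> \<omega> k}"

definition vert where "vert c = {F\<in>I. snd F \<noteq> c (fst F)}" for c :: "nat \<Rightarrow> nat"

definition vpos where "vpos c = (SOME h. bij_betw h (vert c) {..<dim})"

definition vfac where "vfac c i = inv_into (vert c) (vpos c) i"

text \<open>The vectors at a vertex form a basis; this automorphism straightens them and is the one
  by which the chart at \<open>c\<close> is equivariant.\<close>

definition vaut where "vaut c = (SOME \<theta>. \<theta> \<in> iso G G \<and> (\<forall>F\<in>vert c. \<theta> (lam F) = zunit dim (vpos c F)))"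

lemma vert_subset: "vert c \<subseteq> I" and finite_vert [simp]: "finite (vert c)"
  by (auto simp: vert_def)

lemma lam_vert: "F \<in> vert c \<Longrightarrow> lam F \<in> carrier G"
  using lamG vert_subset by blast

lemma vpos_bij:
  assumes c: "c \<in> choices" shows "bij_betw (vpos c) (vert c) {..<dim}"
proof -
  have e: "vert c = (SIGMA k:{1..m}. {..\<omega> k} - {c k})" by (auto simp: vert_def I_def)
  have "card (vert c) = (\<Sum>k\<in>{1..m}. card ({..\<omega> k} - {c k}))" unfolding e by (rule card_SigmaI) auto
  also have "\<dots> = dim" unfolding dim_def by (rule sum.cong) (use c in \<open>auto simp: choices_def card_Diff_singleton\<close>)
  finally have "\<exists>h. bij_betw h (vert c) {..<dim}" by (intro finite_same_card_bij) auto
  then show ?thesis unfolding vpos_def by (rule someI_ex)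
qed

lemma vpos_less: "c \<in> choices \<Longrightarrow> F \<in> vert c \<Longrightarrow> vpos c F < dim"
  using vpos_bij[of c] by (auto simp: bij_betw_def)

lemma vpos_eq_iff: "c \<in> choices \<Longrightarrow> F \<in> vert c \<Longrightarrow> F' \<in> vert c \<Longrightarrow> vpos c F = vpos c F' \<longleftrightarrow> F = F'"
  using vpos_bij[of c] by (auto simp: bij_betw_def inj_on_eq_iff)

lemma vfac:
  assumes "c \<in> choices" "i < dim" shows "vfac c i \<in> vert c" "vpos c (vfac c i) = i"
proof -
  have "i \<in> vpos c ` vert c" using vpos_bij[OF assms(1)] assms(2) by (simp add: bij_betw_def)
  then show "vfac c i \<in> vert c" "vpos c (vfac c i) = i" unfolding vfac_def by (rule inv_into_into, rule f_inv_into_f)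
qed

lemma vfac_vpos: "c \<in> choices \<Longrightarrow> F \<in> vert c \<Longrightarrow> vfac c (vpos c F) = F"
  unfolding vfac_def using vpos_bij[of c] by (auto simp: bij_betw_def)

lemma vert_indep:
  assumes c: "c \<in> choices" shows "zindep dim lam (vert c)"
proof -
  obtain p where p: "p \<in> topspace P" "zeros p = {(k, t). (k, t) \<in> I \<and> t \<noteq> c k}"
    by (rule ex_zeros_vertex[of c]) (use c in \<open>auto simp: choices_def\<close>)
  have "vert c = zeros p" unfolding p(2) vert_def by auto
  then show ?thesis using lam_indep[OF p(1)] by simp
qed

lemma vaut:
  assumes c: "c \<in> choices"
  shows "vaut c \<in> iso G G" "F \<in> vert c \<Longrightarrow> vaut c (lam F) = zunit dim (vpos c F)"
proof -
  have "\<exists>\<theta>. \<theta> \<in> iso G G \<and> (\<forall>F\<in>vert c. \<theta> (lam F) = zunit dim (vpos c F))"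
  proof -
    obtain \<theta> where "\<theta> \<in> iso G G" "\<And>F. F \<in> vert c \<Longrightarrow> \<theta> (lam F) = zunit dim (vpos c F)"
      by (rule zindep_basis_iso[OF vpos_bij[OF c] vert_indep[OF c]]) (auto simp: lam_vert)
    then show ?thesis by blast
  qed
  from someI_ex[OF this] have a: "vaut c \<in> iso G G \<and> (\<forall>F\<in>vert c. vaut c (lam F) = zunit dim (vpos c F))"
    unfolding vaut_def .
  then show "vaut c \<in> iso G G" by simp
  show "F \<in> vert c \<Longrightarrow> vaut c (lam F) = zunit dim (vpos c F)" using a by simp
qed

lemma vaut_closed: "c \<in> choices \<Longrightarrow> g \<in> carrier G \<Longrightarrow> vaut c g \<in> carrier G"
  using Z2_iso_closed[OF vaut(1)] .

lemma vaut_zsum_coord: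
  assumes c: "c \<in> choices" and A: "A \<subseteq> vert c" and F: "F \<in> vert c"
  shows "vaut c (zsum dim lam A) (vpos c F) = 1 \<longleftrightarrow> F \<in> A"
proof -
  have fA: "finite A" by (rule finite_subset[OF A finite_vert])
  have "vaut c (zsum dim lam A) = zsum dim (\<lambda>F. vaut c (lam F)) A"
    by (rule zsum_hom[OF fA]) (use vaut(1)[OF c] A lam_vert in \<open>simp add: iso_iff, blast\<close>)
  also have "\<dots> = zsum dim (\<lambda>F. zunit dim (vpos c F)) A"
    by (rule zsum_cong) (use vaut(2)[OF c] A in blast)
  also have "\<dots> = zsum dim (zunit dim) (vpos c ` A)"
    by (rule zsum_reindex[symmetric]) (use vpos_bij[OF c] A inj_on_subset in \<open>auto simp: bij_betw_def\<close>)
  finally have e: "vaut c (zsum dim lam A) = zsum dim (zunit dim) (vpos c ` A)" .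
  have sub: "vpos c ` A \<subseteq> {..<dim}" using vpos_less[OF c] A by blast
  have "vpos c F \<in> vpos c ` A \<longleftrightarrow> F \<in> A"
    using vpos_eq_iff[OF c F] A by blast
  then show ?thesis unfolding e zsum_zunit_coord[OF sub vpos_less[OF c F]] .
qed

lemma vaut_eqI:
  assumes c: "c \<in> choices" and g: "g \<in> carrier G" "h \<in> carrier G"
    and e: "\<And>F. F \<in> vert c \<Longrightarrow> vaut c g (vpos c F) = 1 \<longleftrightarrow> vaut c h (vpos c F) = 1"
  shows "g = h"
proof -
  have "vaut c g = vaut c h"
  proof (rule Z2_eqI[OF vaut_closed[OF c g(1)] vaut_closed[OF c g(2)]])
    fix i assume i: "i < dim"
    show "vaut c g i = 1 \<longleftrightarrow> vaut c h i = 1" using e[OF vfac(1)[OF c i]] unfolding vfac(2)[OF c i] .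
  qed
  then show ?thesis using Z2_iso_eq_iff[OF vaut(1)[OF c] g] by simp
qed

text \<open>The open star of the vertex \<open>c\<close>: the complement of the facets that miss
  it.\<close>

definition Pc where "Pc c = {p \<in> topspace P. \<forall>k\<in>{1..m}. 0 < u (k, c k) p}"
definition Uc where "Uc c = {x \<in> pts. prj x \<in> Pc c}"

text \<open>The folding of a line onto a half-line is squaring, so coordinates are square roots of
  barycentric coordinates relative to the pivot \<open>c k\<close> of the same factor; the group
  element supplies the signs after straightening by \<open>vaut\<close>.\<close>

definition phi :: "(nat \<Rightarrow> nat) \<Rightarrow> 'a \<Rightarrow> nat \<Rightarrow> real" where
  "phi c x = (\<lambda>i. if i < dim then sg (vaut c (gr x) i) *
     sqrt (u (vfac c i) (prj x) / u (fst (vfac c i), c (fst (vfac c i))) (prj x)) else 0)"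

lemma zeros_Pc: "c \<in> choices \<Longrightarrow> p \<in> Pc c \<Longrightarrow> zeros p \<subseteq> vert c"
  by (force simp: zeros_def vert_def Pc_def I_def)

lemma phi_in: "phi c x \<in> topspace E"
  by (auto simp: phi_def topspace_Euclidean_space)

text \<open>The representative chosen by \<open>gr\<close> differs from \<open>g\<close> by vectors
  of facets through \<open>p\<close>; each of these flips one sign, at a coordinate that vanishes
  there.\<close>

lemma phi_q:
  assumes c: "c \<in> choices" and p: "p \<in> Pc c" and g: "g \<in> carrier G" and i: "i < dim"
  shows "phi c (q p g) i = sg (vaut c g i) * sqrt (u (vfac c i) p / u (fst (vfac c i), c (fst (vfac c i))) p)"
proof -
  have pP: "p \<in> topspace P" using p by (simp add: Pc_def)
  note x = pts_cases[OF q_in[OF pP g]]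
  define F where "F = vfac c i"
  have F: "F \<in> vert c" "vpos c F = i" using vfac[OF c i] by (simp_all add: F_def)
  show ?thesis
  proof (cases "u F p = 0")
    case True
    then show ?thesis using i by (simp add: phi_def prj_q[OF pP g] F_def)
  next
    case False
    obtain A where A: "A \<subseteq> zeros p" "gr (q p g) \<otimes>\<^bsub>G\<^esub> g = zsum dim lam A" using gr_q[OF pP g] by blast
    have Av: "A \<subseteq> vert c" using A(1) zeros_Pc[OF c p] by blast
    have "F \<notin> A" using A(1) False by (auto simp: zeros_def)
    then have "vaut c (gr (q p g) \<otimes>\<^bsub>G\<^esub> g) i \<noteq> 1" using vaut_zsum_coord[OF c Av F(1)] unfolding A(2) F(2) by simp
    then have "(vaut c (gr (q p g)) i = 1) = (vaut c g i = 1)"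
      using Z2_iso_mult[OF vaut(1)[OF c] x(2) g] Z2_mult_coord[OF vaut_closed[OF c x(2)] vaut_closed[OF c g] i] by simp
    then have "sg (vaut c (gr (q p g)) i) = sg (vaut c g i)" by (simp add: sg_def)
    then show ?thesis using i by (simp add: phi_def prj_q[OF pP g])
  qed
qed

section \<open>Homogeneous coordinates\<close>

definition homog :: "(nat \<times> nat \<Rightarrow> real) \<Rightarrow> bool" where "homog z \<longleftrightarrow> (\<forall>k\<in>{1..m}. \<exists>t\<le>\<omega> k. z (k, t) \<noteq> 0)"
definition nrm where "nrm z k = (\<Sum>t\<le>\<omega> k. (z (k, t))\<^sup>2)" for z :: "nat \<times> nat \<Rightarrow> real"
definition pt where "pt z = (SOME p. p \<in> topspace P \<and> (\<forall>F\<in>I. u F p = (z F)\<^sup>2 / nrm z (fst F)))"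
definition gz where "gz z = zsum dim lam {F\<in>I. z F < 0}" for z :: "nat \<times> nat \<Rightarrow> real"
text \<open>Invariant under positive scaling in each factor, hence determined on a product of
  spheres, the real moment-angle manifold over \<open>P\<close>: squares give the point of
  \<open>P\<close>, and signs select the vectors to be added.\<close>

definition Phi where "Phi z = q (pt z) (gz z)"

lemma nrm_pos:
  assumes "homog z" "k \<in> {1..m}" shows "0 < nrm z k"
proof -
  obtain t where t: "t \<le> \<omega> k" "z (k, t) \<noteq> 0" using assms unfolding homog_def by blast
  have "0 < (z (k, t))\<^sup>2" using t by simp
  also have "\<dots> \<le> nrm z k" unfolding nrm_def by (rule member_le_sum) (use t in auto)
  finally show ?thesis .
qed

lemma pt:
  assumes "homog z" shows "pt z \<in> topspace P" "F \<in> I \<Longrightarrow> u F (pt z) = (z F)\<^sup>2 / nrm z (fst F)"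
proof -
  have "\<exists>p\<in>topspace P. \<forall>F\<in>I. u F p = (z F)\<^sup>2 / nrm z (fst F)"
  proof (rule ex_point)
    fix F assume "F \<in> I"
    then have "fst F \<in> {1..m}" by (cases F) (simp add: I_iff)
    then show "0 \<le> (z F)\<^sup>2 / nrm z (fst F)" using nrm_pos[OF assms] by (intro divide_nonneg_pos) auto
  next
    fix k assume k: "k \<in> {1..m}"
    have "(\<Sum>t\<le>\<omega> k. (z (k, t))\<^sup>2 / nrm z (fst (k, t))) = (\<Sum>t\<le>\<omega> k. (z (k, t))\<^sup>2) / nrm z k"
      by (simp add: sum_divide_distrib)
    also have "\<dots> = nrm z k / nrm z k" by (simp add: nrm_def)
    finally have "(\<Sum>t\<le>\<omega> k. (z (k, t))\<^sup>2 / nrm z (fst (k, t))) = nrm z k / nrm z k" .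
    then show "(\<Sum>t\<le>\<omega> k. (z (k, t))\<^sup>2 / nrm z (fst (k, t))) = 1" using nrm_pos[OF assms k] by simp
  qed
  then have "\<exists>p. p \<in> topspace P \<and> (\<forall>F\<in>I. u F p = (z F)\<^sup>2 / nrm z (fst F))" by blast
  from someI_ex[OF this] have a: "pt z \<in> topspace P \<and> (\<forall>F\<in>I. u F (pt z) = (z F)\<^sup>2 / nrm z (fst F))"
    unfolding pt_def .
  then show "pt z \<in> topspace P" by simp
  show "F \<in> I \<Longrightarrow> u F (pt z) = (z F)\<^sup>2 / nrm z (fst F)" using a by simp
qed

lemma zeros_pt: "homog z \<Longrightarrow> zeros (pt z) = {F\<in>I. z F = 0}"
proof -
  assume h: "homog z"
  have "u F (pt z) = 0 \<longleftrightarrow> z F = 0" if F: "F \<in> I" for F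
  proof -
    have "fst F \<in> {1..m}" using F by (cases F) (simp add: I_iff)
    then have "nrm z (fst F) \<noteq> 0" using nrm_pos[OF h] by force
    then show ?thesis using pt(2)[OF h F] by simp
  qed
  then show ?thesis by (auto simp: zeros_def)
qed

lemma gz_closed [simp]: "gz z \<in> carrier G" by (simp add: gz_def)

lemma homogI: "c \<in> choices \<Longrightarrow> (\<And>k. k \<in> {1..m} \<Longrightarrow> z (k, c k) \<noteq> 0) \<Longrightarrow> homog z"
  unfolding homog_def choices_def by blast

lemma pt_Pc:
  assumes c: "c \<in> choices" and z: "\<And>k. k \<in> {1..m} \<Longrightarrow> z (k, c k) \<noteq> 0"
  shows "pt z \<in> Pc c"
proof -
  have h: "homog z" by (rule homogI[of c z, OF c z])
  have "0 < u (k, c k) (pt z)" if k: "k \<in> {1..m}" for k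
  proof -
    have "(k, c k) \<in> I" using c k by (simp add: I_iff choices_def)
    then show ?thesis using pt(2)[OF h, of "(k, c k)"] z[OF k] nrm_pos[OF h k] by simp
  qed
  then show ?thesis using pt(1)[OF h] by (simp add: Pc_def)
qed

lemma Phi_Uc:
  assumes c: "c \<in> choices" and z: "\<And>k. k \<in> {1..m} \<Longrightarrow> z (k, c k) \<noteq> 0"
  shows "Phi z \<in> Uc c"
  using pt_Pc[of c z] assms q_in[of "pt z" "gz z"] by (simp add: Phi_def Uc_def Pc_def prj_q)

lemma Phi_Uc_iff:
  assumes h: "homog z" and d: "d \<in> choices"
  shows "Phi z \<in> Uc d \<longleftrightarrow> (\<forall>k\<in>{1..m}. z (k, d k) \<noteq> 0)"
proof
  assume "Phi z \<in> Uc d"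
  then have p: "pt z \<in> Pc d" using pt(1)[OF h] by (simp add: Phi_def Uc_def prj_q)
  show "\<forall>k\<in>{1..m}. z (k, d k) \<noteq> 0"
  proof
    fix k assume k: "k \<in> {1..m}"
    have "(k, d k) \<in> I" using d k by (simp add: I_iff choices_def)
    moreover have "0 < u (k, d k) (pt z)" using p k by (simp add: Pc_def)
    ultimately show "z (k, d k) \<noteq> 0" using pt(2)[OF h, of "(k, d k)"] by auto
  qed
qed (use Phi_Uc[OF d] in blast)

text \<open>In homogeneous coordinates \<open>z\<close>, the chart at the vertex \<open>c\<close> is \<open>z F / z (k, c k)\<close> up to signs
  that are locally constant where all \<open>z (k, c k)\<close> are nonzero.\<close>

lemma phi_Phi:
  assumes c: "c \<in> choices" and z: "\<And>k. k \<in> {1..m} \<Longrightarrow> z (k, c k) \<noteq> 0" and F: "F \<in> vert c"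
  shows "phi c (Phi z) (vpos c F) = z F * inverse (z (fst F, c (fst F))) *
    (if z (fst F, c (fst F)) < 0 then - 1 else 1) *
    (\<Prod>k\<in>{1..m}. if z (k, c k) < 0 then sg (vaut c (lam (k, c k)) (vpos c F)) else 1)"
proof -
  let ?i = "vpos c F" and ?k = "fst F"
  have i: "?i < dim" by (rule vpos_less[OF c F])
  have FI: "F \<in> I" using F vert_subset by blast
  have k: "?k \<in> {1..m}" using FI by (cases F) (simp add: I_iff)
  have h: "homog z" by (rule homogI[of c z, OF c z])
  have ckI: "(k, c k) \<in> I" if "k \<in> {1..m}" for k using c that by (simp add: I_iff choices_def)
  define N where "N = {F\<in>I. z F < 0}"
  have fN: "finite N" by (simp add: N_def)
  have th01: "vaut c (lam F') ?i = 0 \<or> vaut c (lam F') ?i = 1" if "F' \<in> I" for F'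
    by (rule Z2_coord[OF vaut_closed[OF c lamG[OF that]] i])
  have "vaut c (gz z) = zsum dim (\<lambda>F. vaut c (lam F)) N"
    unfolding gz_def N_def by (rule zsum_hom) (use vaut(1)[OF c] lamG in \<open>auto simp: iso_iff\<close>)
  then have "vaut c (gz z) ?i = (\<Sum>F\<in>N. vaut c (lam F) ?i) mod 2" using i by (simp add: zsum_def)
  then have s1: "sg (vaut c (gz z) ?i) = (\<Prod>F'\<in>N. sg (vaut c (lam F') ?i))"
    using sg_sum[OF fN, of "\<lambda>F'. vaut c (lam F') ?i"] th01 by (simp add: N_def)
  \<comment> \<open>Negative entries at facets of the vertex contribute unit vectors after
    \<open>vaut\<close>; those at the pivots \<open>z (k, c k)\<close> contribute the remaining sign
    factors of the product.\<close>
  have Nsplit: "N = {F'\<in>vert c. z F' < 0} \<union> (\<lambda>k. (k, c k)) ` {k\<in>{1..m}. z (k, c k) < 0}"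
  proof (intro equalityI subsetI)
    fix F' assume F': "F' \<in> N"
    show "F' \<in> {F'\<in>vert c. z F' < 0} \<union> (\<lambda>k. (k, c k)) ` {k\<in>{1..m}. z (k, c k) < 0}"
    proof (cases "snd F' = c (fst F')")
      case True
      then have e: "F' = (fst F', c (fst F'))" by (simp add: prod_eq_iff)
      have "fst F' \<in> {k\<in>{1..m}. z (k, c k) < 0}" using F' e by (cases F') (auto simp: N_def I_iff)
      then show ?thesis using e by blast
    qed (use F' in \<open>simp add: N_def vert_def\<close>)
  next
    fix F' assume "F' \<in> {F'\<in>vert c. z F' < 0} \<union> (\<lambda>k. (k, c k)) ` {k\<in>{1..m}. z (k, c k) < 0}"
    then show "F' \<in> N" using vert_subset ckI by (auto simp: N_def)
  qed
  have "(\<Prod>F'\<in>N. sg (vaut c (lam F') ?i)) = (\<Prod>F'\<in>{F'\<in>vert c. z F' < 0}. sg (vaut c (lam F') ?i)) *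
      (\<Prod>F'\<in>(\<lambda>k. (k, c k)) ` {k\<in>{1..m}. z (k, c k) < 0}. sg (vaut c (lam F') ?i))"
    unfolding Nsplit by (rule prod.union_disjoint) (auto simp: vert_def)
  also have "(\<Prod>F'\<in>{F'\<in>vert c. z F' < 0}. sg (vaut c (lam F') ?i)) =
      (\<Prod>F'\<in>{F'\<in>vert c. z F' < 0}. if F' = F then - 1 else 1)"
  proof (rule prod.cong[OF refl])
    fix F' assume "F' \<in> {F'\<in>vert c. z F' < 0}"
    then have F': "F' \<in> vert c" by simp
    show "sg (vaut c (lam F') ?i) = (if F' = F then - 1 else 1)"
      using vpos_eq_iff[OF c F F'] i by (auto simp: vaut(2)[OF c F'] zunit_coord sg_def)
  qed
  also have "\<dots> = (if z F < 0 then - 1 else 1)" using F by simp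
  also have "(\<Prod>F'\<in>(\<lambda>k. (k, c k)) ` {k\<in>{1..m}. z (k, c k) < 0}. sg (vaut c (lam F') ?i)) =
      (\<Prod>k\<in>{k\<in>{1..m}. z (k, c k) < 0}. sg (vaut c (lam (k, c k)) ?i))"
    by (subst prod.reindex) (auto simp: inj_on_def)
  also have "\<dots> = (\<Prod>k\<in>{1..m}. if z (k, c k) < 0 then sg (vaut c (lam (k, c k)) ?i) else 1)"
    by (rule prod.inter_filter) simp
  finally have s2: "sg (vaut c (gz z) ?i) = (if z F < 0 then - 1 else 1) *
      (\<Prod>k\<in>{1..m}. if z (k, c k) < 0 then sg (vaut c (lam (k, c k)) ?i) else 1)" using s1 by simp
  have np: "0 < nrm z ?k" by (rule nrm_pos[OF h k])
  have "u F (pt z) / u (?k, c ?k) (pt z) = (z F / z (?k, c ?k))\<^sup>2"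
    using pt(2)[OF h FI] pt(2)[OF h ckI[OF k]] np by (simp add: power_divide)
  then have sq: "sqrt (u F (pt z) / u (?k, c ?k) (pt z)) = \<bar>z F\<bar> / \<bar>z (?k, c ?k)\<bar>" by simp
  have "phi c (Phi z) ?i = sg (vaut c (gz z) ?i) * (\<bar>z F\<bar> / \<bar>z (?k, c ?k)\<bar>)"
    using phi_q[OF c pt_Pc[of c z, OF c z] gz_closed i] unfolding Phi_def vfac_vpos[OF c F] sq .
  also have "\<dots> = z F * inverse (z (?k, c ?k)) * (if z (?k, c ?k) < 0 then - 1 else 1) *
    (\<Prod>k\<in>{1..m}. if z (k, c k) < 0 then sg (vaut c (lam (k, c k)) ?i) else 1)"
    unfolding s2 using z[OF k] by (auto simp: divide_inverse abs_if)
  finally show ?thesis .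
qed

end

section \<open>Charts\<close>

lemma card_zsum_Pow:
  assumes "finite Z" "zindep n f Z" shows "card (zsum n f ` Pow Z) = 2 ^ card Z"
proof -
  have "inj_on (zsum n f) (Pow Z)"
    by (rule inj_onI) (rule zindep_inj[OF assms(2,1)], auto)
  then show ?thesis by (simp add: card_image card_Pow assms(1))
qed

lemma sg_mult: "(x = 1) = ((a = 1) \<noteq> (b = 1)) \<Longrightarrow> sg x = sg a * sg b"
  by (auto simp: sg_def)

context char_model
begin

text \<open>The pivot of each factor is filled in as 1, as in the standard affine charts of
  projective space.\<close>

definition Yc :: "(nat \<Rightarrow> nat) \<Rightarrow> (nat \<Rightarrow> real) \<Rightarrow> nat \<times> nat \<Rightarrow> real" where
  "Yc c y F = (if snd F = c (fst F) then 1 else y (vpos c F))"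

definition psi where "psi c y = Phi (Yc c y)"

lemma Yc_vertex [simp]: "Yc c y (k, c k) = 1"
  by (simp add: Yc_def)

lemma homog_Yc: "c \<in> choices \<Longrightarrow> homog (Yc c y)"
  by (rule homogI) auto

lemma psi_Uc: "c \<in> choices \<Longrightarrow> psi c y \<in> Uc c"
  unfolding psi_def by (rule Phi_Uc) auto

lemma phi_psi:
  assumes c: "c \<in> choices" and y: "y \<in> topspace E" shows "phi c (psi c y) = y"
proof
  fix i show "phi c (psi c y) i = y i"
  proof (cases "i < dim")
    case True
    note F = vfac[OF c True]
    have "phi c (psi c y) (vpos c (vfac c i)) = Yc c y (vfac c i)"
      unfolding psi_def by (subst phi_Phi[OF c _ F(1)]) auto
    also have "\<dots> = y i" using F by (simp add: Yc_def vert_def)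
    finally show ?thesis unfolding F(2) .
  qed (use y in \<open>simp add: phi_def topspace_Euclidean_space\<close>)
qed

text \<open>The homogeneous vector of \<open>phi c x\<close> recovers the point of \<open>P\<close>.
  A vanishing coordinate has forgotten its sign, so the group element is recovered only up to
  vectors of facets through that point, which is what the quotient divides out.\<close>

lemma psi_phi:
  assumes c: "c \<in> choices" and x: "x \<in> Uc c" shows "psi c (phi c x) = x"
proof -
  have xp: "x \<in> pts" and p: "prj x \<in> Pc c" using x by (auto simp: Uc_def)
  note x' = pts_cases[OF xp]
  define p where "p = prj x"
  define g where "g = gr x"
  define z where "z = Yc c (phi c x)"
  have pP: "p \<in> topspace P" and pc: "p \<in> Pc c" and g: "g \<in> carrier G" and xq: "x = q p g"
    using x' p by (simp_all add: p_def g_def)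
  have up: "0 < u (k, c k) p" if "k \<in> {1..m}" for k using pc that by (simp add: Pc_def)
  have h: "homog z" unfolding z_def by (rule homog_Yc[OF c])
  have zF: "z F = sg (vaut c g (vpos c F)) * sqrt (u F p / u (fst F, c (fst F)) p)" if F: "F \<in> vert c" for F
  proof -
    have "z F = phi c x (vpos c F)" using F by (simp add: z_def Yc_def vert_def)
    also have "\<dots> = sg (vaut c g (vpos c F)) * sqrt (u F p / u (fst F, c (fst F)) p)"
      unfolding xq using phi_q[OF c pc g vpos_less[OF c F]] by (simp add: vfac_vpos[OF c F])
    finally show ?thesis .
  qed
  have k: "fst F \<in> {1..m}" if "F \<in> I" for F using that by (cases F) (simp add: I_iff)
  have z2: "(z F)\<^sup>2 = u F p / u (fst F, c (fst F)) p" if F: "F \<in> I" for F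
  proof (cases "F \<in> vert c")
    case True
    have "0 \<le> u F p / u (fst F, c (fst F)) p" using coord_nonneg[OF pP F] up[OF k[OF F]] by simp
    then show ?thesis unfolding zF[OF True] power_mult_distrib by (simp add: sg_def)
  next
    case False
    then have e: "F = (fst F, c (fst F))" using F by (simp add: vert_def prod_eq_iff)
    have "z F = 1" by (subst e) (simp add: z_def)
    moreover have "u F p / u (fst F, c (fst F)) p = 1" using up[OF k[OF F]] e by simp
    ultimately show ?thesis by simp
  qed
  have nz: "nrm z j = 1 / u (j, c j) p" if j: "j \<in> {1..m}" for j
  proof -
    have "nrm z j = (\<Sum>t\<le>\<omega> j. u (j, t) p / u (j, c j) p)"
      unfolding nrm_def by (rule sum.cong) (use z2 j in \<open>auto simp: I_iff\<close>)
    also have "\<dots> = (\<Sum>t\<le>\<omega> j. u (j, t) p) / u (j, c j) p" by (simp add: sum_divide_distrib)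
    finally show ?thesis using u_sum[OF pP j] by simp
  qed
  have ptz: "pt z = p"
  proof (rule point_eqI[OF pt(1)[OF h] pP])
    fix F assume F: "F \<in> I"
    show "u F (pt z) = u F p" unfolding pt(2)[OF h F] z2[OF F] nz[OF k[OF F]] using up[OF k[OF F]] by simp
  qed
  \<comment> \<open>The facets through \<open>p\<close> at which \<open>g\<close> carries a sign
    that the vanishing coordinate cannot show.\<close>
  define A where "A = {F\<in>zeros p. vaut c g (vpos c F) = 1}"
  have Av: "A \<subseteq> vert c" using zeros_Pc[OF c pc] by (auto simp: A_def)
  define N where "N = {F\<in>I. z F < 0}"
  have Nv: "N \<subseteq> vert c"
  proof
    fix F assume F: "F \<in> N"
    show "F \<in> vert c"
    proof (rule ccontr)
      assume "F \<notin> vert c"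
      then have e: "F = (fst F, c (fst F))" using F by (simp add: vert_def prod_eq_iff N_def)
      have "z F = 1" by (subst e) (simp add: z_def)
      then show False using F by (simp add: N_def)
    qed
  qed
  have "gz z \<otimes>\<^bsub>G\<^esub> g = zsum dim lam A"
  proof (rule vaut_eqI[OF c Z2_closed[OF gz_closed g] zsum_closed])
    fix F assume F: "F \<in> vert c"
    have FI: "F \<in> I" using F vert_subset by blast
    have i: "vpos c F < dim" by (rule vpos_less[OF c F])
    have 1: "vaut c (gz z) (vpos c F) = 1 \<longleftrightarrow> z F < 0"
      using vaut_zsum_coord[OF c Nv F] FI by (simp add: gz_def N_def)
    have 2: "vaut c (gz z \<otimes>\<^bsub>G\<^esub> g) (vpos c F) = 1 \<longleftrightarrow> (z F < 0) \<noteq> (vaut c g (vpos c F) = 1)"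
      using Z2_mult_coord[OF vaut_closed[OF c gz_closed] vaut_closed[OF c g] i] 1
        Z2_iso_mult[OF vaut(1)[OF c] gz_closed g] by simp
    have up': "0 < u (fst F, c (fst F)) p" by (rule up[OF k[OF FI]])
    have uF: "0 \<le> u F p" by (rule coord_nonneg[OF pP FI])
    have 3: "z F < 0 \<longleftrightarrow> vaut c g (vpos c F) = 1 \<and> F \<notin> zeros p"
    proof (cases "u F p = 0")
      case True
      then show ?thesis using zF[OF F] FI by (simp add: zeros_def)
    next
      case False
      then have "0 < sqrt (u F p / u (fst F, c (fst F)) p)" using uF up' by simp
      then show ?thesis using zF[OF F] False by (auto simp: zeros_def sg_def mult_less_0_iff)
    qed
    show "vaut c (gz z \<otimes>\<^bsub>G\<^esub> g) (vpos c F) = 1 \<longleftrightarrow> vaut c (zsum dim lam A) (vpos c F) = 1"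
      unfolding 2 3 vaut_zsum_coord[OF c Av F] by (auto simp: A_def)
  qed
  moreover have "A \<in> Pow (zeros p)" by (auto simp: A_def)
  ultimately have "gz z \<otimes>\<^bsub>G\<^esub> g \<in> zsum dim lam ` Pow (zeros p)" by (metis imageI)
  then have "q p (gz z) = q p g" using q_eq[OF pP pP gz_closed g] by simp
  then show ?thesis unfolding psi_def Phi_def z_def[symmetric] ptz using xq by simp
qed

lemma phi_image:
  assumes c: "c \<in> choices" shows "phi c ` Uc c = topspace E"
proof
  show "phi c ` Uc c \<subseteq> topspace E" using phi_in by blast
  show "topspace E \<subseteq> phi c ` Uc c"
  proof
    fix y assume "y \<in> topspace E"
    then have "y = phi c (psi c y)" using phi_psi[OF c] by simp
    then show "y \<in> phi c ` Uc c" using psi_Uc[OF c] by (rule image_eqI)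
  qed
qed

lemma Pc_open: assumes c: "c \<in> choices" shows "openin P (Pc c)"
proof -
  have "Pc c = {p \<in> topspace P. \<forall>k\<in>{1..m}. u (k, c k) p \<in> {0<..}}" by (simp add: Pc_def)
  moreover have "openin P {p \<in> topspace P. \<forall>k\<in>{1..m}. u (k, c k) p \<in> {0<..}}"
  proof (rule openin_Collect_ball_finite)
    fix k assume "k \<in> {1..m}"
    then have "(k, c k) \<in> I" using c by (simp add: choices_def I_iff)
    from openin_continuous_map_preimage[OF coord_cont[OF this], of "{0<..}"]
    show "openin P {p \<in> topspace P. u (k, c k) p \<in> {0<..}}" by simp
  qed auto
  ultimately show ?thesis by simp
qed

lemma Uc_sub: "Uc c \<subseteq> pts" by (auto simp: Uc_def)

lemma Uc_open: assumes c: "c \<in> choices" shows "openin mtop (Uc c)"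
  using openin_continuous_map_preimage[OF prj_cont Pc_open[OF c]] by (simp add: Uc_def topspace_mtop)

lemma phi_cont:
  assumes c: "c \<in> choices" shows "continuous_map (subtopology mtop (Uc c)) E (phi c)"
  unfolding continuous_map_def
proof (intro conjI allI impI)
  show "phi c \<in> topspace (subtopology mtop (Uc c)) \<rightarrow> topspace E" using phi_in by auto
  fix O' assume O': "openin E O'"
  have "openin mtop {x \<in> Uc c. phi c x \<in> O'}"
    unfolding openin_mtop
  proof (intro conjI ballI)
    show "{x \<in> Uc c. phi c x \<in> O'} \<subseteq> pts" using Uc_sub by blast
    fix g assume g: "g \<in> carrier G"
    have cont: "continuous_map (subtopology P (Pc c)) E (\<lambda>p i. if i < dim then sg (vaut c g i) * sqrt (u (vfac c i) p / u (fst (vfac c i), c (fst (vfac c i))) p) else 0)"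
      unfolding continuous_map_componentwise_Euclidean_space
    proof (intro allI impI)
      fix i assume i: "i < dim"
      let ?F = "vfac c i"
      have F: "?F \<in> I" using vfac(1)[OF c i] vert_subset by blast
      then have k: "fst ?F \<in> {1..m}" by (cases "?F") (simp add: I_iff)
      then have F2: "(fst ?F, c (fst ?F)) \<in> I" using c by (simp add: choices_def I_iff)
      have "continuous_map (subtopology P (Pc c)) euclideanreal (\<lambda>p. u ?F p / u (fst ?F, c (fst ?F)) p)"
      proof (intro continuous_map_real_divide continuous_map_from_subtopology coord_cont F F2)
        fix p assume "p \<in> topspace (subtopology P (Pc c))"
        then have "0 < u (fst ?F, c (fst ?F)) p" using k by (simp add: Pc_def)
        then show "u (fst ?F, c (fst ?F)) p \<noteq> 0" by simp
      qed
      then have "continuous_map (subtopology P (Pc c)) euclideanreal (sqrt \<circ> (\<lambda>p. u ?F p / u (fst ?F, c (fst ?F)) p))"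
        by (rule continuous_map_compose) (simp add: continuous_on_real_sqrt)
      then have "continuous_map (subtopology P (Pc c)) euclideanreal (\<lambda>p. sqrt (u ?F p / u (fst ?F, c (fst ?F)) p))"
        by (simp add: o_def)
      then show "continuous_map (subtopology P (Pc c)) euclideanreal
          (\<lambda>p. sg (vaut c g i) * sqrt (u ?F p / u (fst ?F, c (fst ?F)) p))"
        by (intro continuous_map_real_mult) auto
    qed
    have "continuous_map (subtopology P (Pc c)) E (\<lambda>p. phi c (q p g))"
    proof (rule continuous_map_eq[OF cont])
      fix p assume "p \<in> topspace (subtopology P (Pc c))"
      then have p: "p \<in> Pc c" by simp
      show "(\<lambda>i. if i < dim then sg (vaut c g i) * sqrt (u (vfac c i) p / u (fst (vfac c i), c (fst (vfac c i))) p) else 0) = phi c (q p g)"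
      proof
        fix i show "(if i < dim then sg (vaut c g i) * sqrt (u (vfac c i) p / u (fst (vfac c i), c (fst (vfac c i))) p) else 0) = phi c (q p g) i"
          using phi_q[OF c p g, of i] by (cases "i < dim") (simp_all add: phi_def)
      qed
    qed
    from openin_continuous_map_preimage[OF this O']
    have "openin (subtopology P (Pc c)) {p \<in> topspace (subtopology P (Pc c)). phi c (q p g) \<in> O'}" .
    then have "openin P {p \<in> topspace (subtopology P (Pc c)). phi c (q p g) \<in> O'}"
      using Pc_open[OF c] openin_trans_full by blast
    moreover have "{p \<in> topspace (subtopology P (Pc c)). phi c (q p g) \<in> O'} = {p \<in> topspace P. q p g \<in> {x \<in> Uc c. phi c x \<in> O'}}"
      using q_in[OF _ g] prj_q[OF _ g] by (auto simp: Uc_def)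
    ultimately show "openin P {p \<in> topspace P. q p g \<in> {x \<in> Uc c. phi c x \<in> O'}}" by simp
  qed
  moreover have "{x \<in> topspace (subtopology mtop (Uc c)). phi c x \<in> O'} = {x \<in> Uc c. phi c x \<in> O'}"
    using Uc_sub by (auto simp: topspace_mtop)
  ultimately show "openin (subtopology mtop (Uc c)) {x \<in> topspace (subtopology mtop (Uc c)). phi c x \<in> O'}"
    by (simp add: openin_open_subtopology[OF Uc_open[OF c]])
qed

lemma Yc_cont: "continuous_map E euclideanreal (\<lambda>y. Yc c y F)"
  by (cases "snd F = c (fst F)") (simp_all add: Yc_def continuous_map_Euclidean_coordinate)

lemma pt_Yc_cont:
  assumes c: "c \<in> choices" shows "continuous_map E P (\<lambda>y. pt (Yc c y))"
proof (rule continuous_map_coordI)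
  show "pt (Yc c y) \<in> topspace P" for y by (rule pt(1)[OF homog_Yc[OF c]])
  fix F assume F: "F \<in> I"
  then have k: "fst F \<in> {1..m}" by (cases F) (simp add: I_iff)
  have "continuous_map E euclideanreal (\<lambda>y. (Yc c y F * Yc c y F) / (\<Sum>t\<le>\<omega> (fst F). Yc c y (fst F, t) * Yc c y (fst F, t)))"
  proof (intro continuous_map_real_divide continuous_map_real_mult continuous_map_sum Yc_cont)
    fix y
    have "nrm (Yc c y) (fst F) > 0" by (rule nrm_pos[OF homog_Yc[OF c] k])
    then show "(\<Sum>t\<le>\<omega> (fst F). Yc c y (fst F, t) * Yc c y (fst F, t)) \<noteq> 0" by (simp add: nrm_def power2_eq_square)
  qed simp
  then show "continuous_map E euclideanreal (\<lambda>y. u F (pt (Yc c y)))"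
    by (rule continuous_map_eq) (simp add: pt(2)[OF homog_Yc[OF c] F] nrm_def power2_eq_square)
qed

text \<open>The group element of \<open>Yc c y\<close> jumps across coordinate hyperplanes. On a
  closed orthant it may be replaced by a constant one, as the difference involves only facets whose
  coordinates vanish; the finitely many closed orthants are then pasted.\<close>

lemma psi_cont:
  assumes c: "c \<in> choices" shows "continuous_map E mtop (psi c)"
proof -
  \<comment> \<open>A hyperplane belongs to the orthants on both of its sides, and there the pieces
    have to agree.\<close>
  define T where "T A = {y \<in> topspace E. \<forall>i<dim. y i \<in> (if i \<in> A then {..0} else {0..})}" for A
  define f where "f A y = q (pt (Yc c y)) (zsum dim lam (vfac c ` A))" for A y
  have eq: "psi c y = f A y" if y: "y \<in> T A" and A: "A \<subseteq> {..<dim}" for y A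
  proof -
    let ?z = "Yc c y"
    let ?N = "{F\<in>I. ?z F < 0}"
    have fA: "finite (vfac c ` A)" by (rule finite_imageI[OF finite_subset[OF A]]) simp
    have e1: "gz ?z \<otimes>\<^bsub>G\<^esub> zsum dim lam (vfac c ` A) = zsum dim lam ((?N - vfac c ` A) \<union> (vfac c ` A - ?N))"
      unfolding gz_def by (rule zsum_symdiff) (use fA in auto)
    have e2: "(?N - vfac c ` A) \<union> (vfac c ` A - ?N) \<in> Pow (zeros (pt ?z))"
    proof -
      have "F \<in> vfac c ` A" if F: "F \<in> ?N" for F
      proof -
        have zF: "?z F < 0" "F \<in> I" using F by auto
        then have "snd F \<noteq> c (fst F)" by (auto simp: Yc_def)
        then have Fv: "F \<in> vert c" using zF by (simp add: vert_def)
        have "y (vpos c F) < 0" using zF \<open>snd F \<noteq> c (fst F)\<close> by (simp add: Yc_def)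
        moreover have "y (vpos c F) \<in> (if vpos c F \<in> A then {..0} else {0..})"
          using y vpos_less[OF c Fv] unfolding T_def by blast
        ultimately have "vpos c F \<in> A" by (simp split: if_splits)
        then show ?thesis using vfac_vpos[OF c Fv] by (metis imageI)
      qed
      moreover have "F \<in> I \<and> ?z F = 0" if F: "F \<in> vfac c ` A - ?N" for F
      proof -
        obtain i where i: "i \<in> A" "F = vfac c i" using F by blast
        have il: "i < dim" using i A by blast
        have Fv: "F \<in> vert c" "vpos c F = i" using vfac[OF c il] i by simp_all
        have "y i \<le> 0" using y i il by (auto simp: T_def)
        moreover have "?z F = y i" using Fv by (simp add: Yc_def vert_def)
        moreover have "\<not> ?z F < 0" "F \<in> I" using F Fv vert_subset by auto
        ultimately show ?thesis by simp
      qed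
      ultimately have "(?N - vfac c ` A) \<union> (vfac c ` A - ?N) \<subseteq> {F\<in>I. ?z F = 0}" by blast
      then show ?thesis unfolding zeros_pt[OF homog_Yc[OF c]] by simp
    qed
    have "gz ?z \<otimes>\<^bsub>G\<^esub> zsum dim lam (vfac c ` A) \<in> zsum dim lam ` Pow (zeros (pt ?z))"
      unfolding e1 by (rule imageI[OF e2])
    moreover have pp: "pt ?z \<in> topspace P" by (rule pt(1)[OF homog_Yc[OF c]])
    ultimately have "q (pt ?z) (gz ?z) = q (pt ?z) (zsum dim lam (vfac c ` A))"
      using q_eq[OF pp pp gz_closed[of ?z] zsum_closed[of dim lam "vfac c ` A"]] by blast
    then show ?thesis unfolding psi_def Phi_def f_def .
  qed
  show ?thesis
  proof (rule pasting_lemma_closed[where I="Pow {..<dim}" and T=T and f=f])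
    fix A
    have TA: "T A = topspace E - (\<Union>i\<in>{..<dim}. {y \<in> topspace E. y i \<in> - (if i \<in> A then {..0} else {0..})})"
      unfolding T_def by blast
    have "openin E {y \<in> topspace E. y i \<in> - (if i \<in> A then {..0} else {0..})}" for i
      by (rule openin_continuous_map_preimage[OF continuous_map_Euclidean_coordinate]) auto
    then have "openin E (\<Union>i\<in>{..<dim}. {y \<in> topspace E. y i \<in> - (if i \<in> A then {..0} else {0..})})"
      by (intro openin_Union) blast
    then show "closedin E (T A)" unfolding TA by (intro closedin_diff closedin_topspace)
    have "continuous_map E mtop ((\<lambda>p. q p (zsum dim lam (vfac c ` A))) \<circ> (\<lambda>y. pt (Yc c y)))"
      by (rule continuous_map_compose[OF pt_Yc_cont[OF c] q_cont[OF zsum_closed]])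
    then have "continuous_map E mtop (f A)" by (simp add: o_def f_def[abs_def])
    then show "continuous_map (subtopology E (T A)) mtop (f A)" by (rule continuous_map_from_subtopology)
  next
    fix A B y assume "A \<in> Pow {..<dim}" "B \<in> Pow {..<dim}" "y \<in> topspace E \<inter> T A \<inter> T B"
    then show "f A y = f B y" using eq[of y A] eq[of y B] by simp
  next
    fix y assume y: "y \<in> topspace E"
    let ?A = "{i. i < dim \<and> y i \<le> 0}"
    have "y \<in> T ?A" using y by (auto simp: T_def)
    moreover have "?A \<in> Pow {..<dim}" by auto
    ultimately show "\<exists>A. A \<in> Pow {..<dim} \<and> y \<in> T A \<and> psi c y = f A y" using eq by blast
  qed simp
qed

lemma phi_homeo:
  assumes c: "c \<in> choices" shows "homeomorphic_map (subtopology mtop (Uc c)) E (phi c)"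
proof -
  have "homeomorphic_maps (subtopology mtop (Uc c)) E (phi c) (psi c)"
    unfolding homeomorphic_maps_def
  proof (intro conjI ballI)
    show "continuous_map E (subtopology mtop (Uc c)) (psi c)"
      unfolding continuous_map_in_subtopology using psi_cont[OF c] psi_Uc[OF c] by auto
    show "psi c (phi c x) = x" if "x \<in> topspace (subtopology mtop (Uc c))" for x
      using psi_phi[OF c] that by simp
  qed (use phi_cont[OF c] phi_psi[OF c] in auto)
  then show ?thesis using homeomorphic_maps_map by blast
qed

lemma chart_at:
  assumes p: "p \<in> topspace P" obtains c where "c \<in> choices" "p \<in> Pc c"
proof -
  obtain c where c: "\<forall>k\<in>{1..m}. c k \<le> \<omega> k \<and> (k, c k) \<notin> zeros p" using ex_nonzero_coord[OF p] ..
  have cc: "c \<in> choices" using c by (simp add: choices_def)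
  have "0 < u (k, c k) p" if k: "k \<in> {1..m}" for k
  proof -
    have I: "(k, c k) \<in> I" using cc k by (simp add: choices_def I_iff)
    have "(k, c k) \<notin> zeros p" using c k by blast
    then have "u (k, c k) p \<noteq> 0" using I by (simp add: zeros_def)
    then show ?thesis using coord_nonneg[OF p I] by simp
  qed
  then have "p \<in> Pc c" using p by (simp add: Pc_def)
  then show ?thesis using that cc by blast
qed

text \<open>Classes over different points of \<open>P\<close> are separated there; classes over one
  point lie in a common vertex chart, which is open and Hausdorff.\<close>

lemma Hausdorff_mtop: "Hausdorff_space mtop"
  unfolding Hausdorff_space_def topspace_mtop
proof (intro allI impI)
  fix x y assume xy: "x \<in> pts \<and> y \<in> pts \<and> x \<noteq> y"
  then have x: "x \<in> pts" and y: "y \<in> pts" and ne: "x \<noteq> y" by auto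
  show "\<exists>U V. openin mtop U \<and> openin mtop V \<and> x \<in> U \<and> y \<in> V \<and> disjnt U V"
  proof (cases "prj x = prj y")
    case False
    obtain U V where UV: "openin P U" "openin P V" "prj x \<in> U" "prj y \<in> V" "disjnt U V"
      using Hausdorff_P pts_cases(1)[OF x] pts_cases(1)[OF y] False unfolding Hausdorff_space_def by metis
    have "openin mtop {x \<in> topspace mtop. prj x \<in> U}" "openin mtop {x \<in> topspace mtop. prj x \<in> V}"
      using openin_continuous_map_preimage[OF prj_cont] UV by auto
    moreover have "disjnt {x \<in> topspace mtop. prj x \<in> U} {x \<in> topspace mtop. prj x \<in> V}"
      using UV(5) by (auto simp: disjnt_iff)
    ultimately show ?thesis using UV x y topspace_mtop by blast
  next
    case True
    obtain c where c: "c \<in> choices" "prj x \<in> Pc c" by (rule chart_at[OF pts_cases(1)[OF x]])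
    have "Hausdorff_space (subtopology mtop (Uc c))"
      using homeomorphic_Hausdorff_space[OF homeomorphic_map_imp_homeomorphic_space[OF phi_homeo[OF c(1)]]]
        Hausdorff_Euclidean_space by blast
    moreover have "x \<in> topspace (subtopology mtop (Uc c))" "y \<in> topspace (subtopology mtop (Uc c))"
      using x y True c by (auto simp: Uc_def topspace_mtop)
    ultimately obtain U V where UV: "openin (subtopology mtop (Uc c)) U" "openin (subtopology mtop (Uc c)) V"
      "x \<in> U" "y \<in> V" "disjnt U V" using ne unfolding Hausdorff_space_def by metis
    then show ?thesis using openin_open_subtopology[OF Uc_open[OF c(1)]] by blast
  qed
qed

lemma phi_mact:
  assumes c: "c \<in> choices" and g: "g \<in> carrier G" and x: "x \<in> Uc c" and i: "i < dim"
  shows "phi c (mact g x) i = sg (vaut c g i) * phi c x i"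
proof -
  have xp: "x \<in> pts" and p: "prj x \<in> Pc c" using x by (auto simp: Uc_def)
  note x' = pts_cases[OF xp]
  have "phi c (mact g x) i = phi c (q (prj x) (g \<otimes>\<^bsub>G\<^esub> gr x)) i" using xp by (simp add: mact_def)
  also have "\<dots> = sg (vaut c (g \<otimes>\<^bsub>G\<^esub> gr x) i) * sqrt (u (vfac c i) (prj x) / u (fst (vfac c i), c (fst (vfac c i))) (prj x))"
    by (rule phi_q[OF c p Z2_closed[OF g x'(2)] i])
  also have "sg (vaut c (g \<otimes>\<^bsub>G\<^esub> gr x) i) = sg (vaut c g i) * sg (vaut c (gr x) i)"
    unfolding Z2_iso_mult[OF vaut(1)[OF c] g x'(2)]
    by (rule sg_mult) (rule Z2_mult_coord[OF vaut_closed[OF c g] vaut_closed[OF c x'(2)] i])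
  finally show ?thesis using i by (simp add: phi_def)
qed

lemma mact_Uc: "g \<in> carrier G \<Longrightarrow> x \<in> pts \<Longrightarrow> mact g x \<in> Uc c \<longleftrightarrow> x \<in> Uc c"
  using mact_in prj_mact by (simp add: Uc_def)

section \<open>Smooth transition maps\<close>

definition overlap where "overlap c d = {y \<in> topspace E. \<forall>k\<in>{1..m}. Yc c y (k, d k) \<in> - {0}}"

lemma overlap_open: "openin E (overlap c d)"
  unfolding overlap_def
proof (rule openin_Collect_ball_finite)
  show "openin E {y \<in> topspace E. Yc c y (k, d k) \<in> - {0}}" for k
    by (rule openin_continuous_map_preimage[OF Yc_cont]) auto
qed auto

lemma Ck_on_Yc: "Ck_on n r U (\<lambda>y. Yc c y F)"
  by (cases "snd F = c (fst F)") (simp_all add: Yc_def Ck_on_const Ck_on_coordinate)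

lemma Ck_on_Yc_sign:
  assumes "k \<in> {1..m}" shows "Ck_on dim r (overlap c d) (\<lambda>y. if Yc c y (k, d k) < 0 then a else b)"
proof (cases "d k = c k")
  case True
  then show ?thesis by (simp add: Yc_def Ck_on_const)
next
  case False
  have "y (vpos c (k, d k)) \<noteq> 0" if "y \<in> overlap c d" for y
  proof -
    have "Yc c y (k, d k) \<in> - {0}" using that assms unfolding overlap_def by blast
    then show ?thesis using False by (simp add: Yc_def)
  qed
  from Ck_on_sign[OF overlap_open this] show ?thesis using False by (simp add: Yc_def)
qed

text \<open>The map \<open>f\<close> enters only through constant signs in the target chart, which
  treats the identity and the group elements together. What remains is \<open>phi_Phi\<close> with
  the pivots changed from \<open>c\<close> to \<open>d\<close>: quotients with nonvanishing
  denominators times locally constant signs.\<close>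

lemma smooth_transition:
  assumes c: "c \<in> choices" and d: "d \<in> choices"
    and f: "\<And>x i. x \<in> Uc d \<Longrightarrow> i < dim \<Longrightarrow> phi d (f x) i = s i * phi d x i"
    and U: "\<And>x. x \<in> pts \<Longrightarrow> f x \<in> Uc d \<longleftrightarrow> x \<in> Uc d"
  shows "smooth_in_charts dim (Uc c, phi c) (Uc d, phi d) f"
proof -
  have psi_Ud: "psi c y \<in> Uc d \<longleftrightarrow> (\<forall>k\<in>{1..m}. Yc c y (k, d k) \<noteq> 0)" for y
    unfolding psi_def by (rule Phi_Uc_iff[OF homog_Yc[OF c] d])
  have dom: "phi c ` {x \<in> Uc c. f x \<in> Uc d} = overlap c d"
  proof (intro equalityI subsetI)
    fix y assume "y \<in> phi c ` {x \<in> Uc c. f x \<in> Uc d}"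
    then obtain x where x: "x \<in> Uc c" "f x \<in> Uc d" "y = phi c x" by blast
    have "x \<in> Uc d" using U x Uc_sub by blast
    then have "psi c y \<in> Uc d" using psi_phi[OF c x(1)] x(3) by simp
    then show "y \<in> overlap c d" using psi_Ud phi_in x(3) by (simp add: overlap_def)
  next
    fix y assume y: "y \<in> overlap c d"
    then have yE: "y \<in> topspace E" by (simp add: overlap_def)
    have "psi c y \<in> Uc d" unfolding psi_Ud using y by (simp add: overlap_def)
    then have "f (psi c y) \<in> Uc d" using U Uc_sub psi_Uc[OF c] by blast
    then show "y \<in> phi c ` {x \<in> Uc c. f x \<in> Uc d}"
      using phi_psi[OF c yE] psi_Uc[OF c, of y] by (metis (mono_tags, lifting) imageI mem_Collect_eq)
  qed
  have inv: "inv_into (Uc c) (phi c) y = psi c y" if y: "y \<in> topspace E" for y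
  proof -
    have "inj_on (phi c) (Uc c)" by (rule inj_on_inverseI[of _ "psi c"]) (rule psi_phi[OF c])
    then have "inv_into (Uc c) (phi c) (phi c (psi c y)) = psi c y" by (rule inv_into_f_f[OF _ psi_Uc[OF c]])
    then show ?thesis unfolding phi_psi[OF c y] .
  qed
  have "Ck_on dim r (overlap c d) (\<lambda>y. (phi d \<circ> f \<circ> inv_into (Uc c) (phi c)) y i)" if i: "i < dim" for r i
  proof -
    define F where "F = vfac d i"
    have F: "F \<in> vert d" "vpos d F = i" using vfac[OF d i] by (simp_all add: F_def)
    have FI: "F \<in> I" using F vert_subset by blast
    then have k: "fst F \<in> {1..m}" by (cases F) (simp add: I_iff)
    have nz: "Yc c y (k, d k) \<noteq> 0" if "y \<in> overlap c d" "k \<in> {1..m}" for y k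
      using that unfolding overlap_def by blast
    let ?h = "\<lambda>y. s i * (Yc c y F * inverse (Yc c y (fst F, d (fst F))) *
      (if Yc c y (fst F, d (fst F)) < 0 then - 1 else 1) *
      (\<Prod>k\<in>{1..m}. if Yc c y (k, d k) < 0 then sg (vaut d (lam (k, d k)) i) else 1))"
    have "Ck_on dim r (overlap c d) ?h"
    proof (rule Ck_on_mult[OF Ck_on_const Ck_on_mult[OF Ck_on_mult[OF Ck_on_mult[OF Ck_on_Yc Ck_on_inverse[OF Ck_on_Yc]]]]])
      show "Yc c y (fst F, d (fst F)) \<noteq> 0" if "y \<in> overlap c d" for y by (rule nz[OF that k])
      show "Ck_on dim r (overlap c d) (\<lambda>y. if Yc c y (fst F, d (fst F)) < 0 then - 1 else 1)"
        by (rule Ck_on_Yc_sign[OF k])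
      show "Ck_on dim r (overlap c d) (\<lambda>y. \<Prod>k\<in>{1..m}. if Yc c y (k, d k) < 0 then sg (vaut d (lam (k, d k)) i) else 1)"
        by (rule Ck_on_prod) (auto intro: Ck_on_Yc_sign)
    qed
    then show ?thesis
    proof (rule Ck_on_cong[OF overlap_open, rotated])
      fix y assume y: "y \<in> overlap c d"
      have yE: "y \<in> topspace E" using y by (simp add: overlap_def)
      have pd: "psi c y \<in> Uc d" unfolding psi_Ud using nz[OF y] by blast
      have "phi d (f (psi c y)) i = s i * phi d (Phi (Yc c y)) (vpos d F)"
        using f[OF pd i] F(2) by (simp add: psi_def)
      also have "\<dots> = ?h y" by (subst phi_Phi[OF d _ F(1)]) (use nz[OF y] F(2) in auto)
      finally show "?h y = (phi d \<circ> f \<circ> inv_into (Uc c) (phi c)) y i" by (simp add: inv[OF yE])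
    qed
  qed
  then show ?thesis unfolding smooth_in_charts_def smooth_on_def by (simp add: dom)
qed

section \<open>The model is a small cover\<close>

definition model :: "('a, 'p) small_cover" where
  "model = \<lparr>sc_top = mtop, sc_atlas = (\<lambda>c. (Uc c, phi c)) ` choices, sc_act = mact, sc_proj = prj\<rparr>"

lemma is_chart_phi:
  assumes c: "c \<in> choices" shows "is_chart dim mtop (Uc c, phi c)"
  using Uc_open[OF c] phi_homeo[OF c] by (simp add: is_chart_def phi_image[OF c])

lemma smooth_id:
  assumes c: "c \<in> choices" "d \<in> choices" shows "smooth_in_charts dim (Uc c, phi c) (Uc d, phi d) (\<lambda>x. x)"
  by (rule smooth_transition[OF c, of _ "\<lambda>_. 1"]) auto

lemma smooth_mact:
  assumes c: "c \<in> choices" "d \<in> choices" and g: "g \<in> carrier G"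
  shows "smooth_in_charts dim (Uc c, phi c) (Uc d, phi d) (mact g)"
  by (rule smooth_transition[OF c, of _ "\<lambda>i. sg (vaut d g i)"]) (auto simp: phi_mact[OF c(2) g] mact_Uc[OF g])

lemma standard_chart_phi:
  assumes c: "c \<in> choices" shows "standard_chart dim model (Uc c, phi c)"
proof -
  have "smooth_chart dim mtop ((\<lambda>c. (Uc c, phi c)) ` choices) (Uc c, phi c)"
    unfolding smooth_chart_def using is_chart_phi[OF c] smooth_id c by auto
  moreover have "\<forall>g\<in>carrier G. \<forall>x\<in>Uc c. mact g x \<in> Uc c \<and> phi c (mact g x) = sign_change dim (vaut c g) (phi c x)"
  proof (intro ballI conjI)
    fix g x assume g: "g \<in> carrier G" and x: "x \<in> Uc c"
    show "mact g x \<in> Uc c" using mact_Uc[OF g] x Uc_sub by blast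
    show "phi c (mact g x) = sign_change dim (vaut c g) (phi c x)"
    proof
      fix i show "phi c (mact g x) i = sign_change dim (vaut c g) (phi c x) i"
        using phi_mact[OF c g x, of i] by (cases "i < dim") (simp_all add: sign_change_def sg_def, simp add: phi_def)
    qed
  qed
  ultimately show ?thesis using vaut(1)[OF c] unfolding standard_chart_def model_def by auto
qed

text \<open>The codimension condition concerns every standard chart, not only those of the atlas. It
  follows by counting the stabilizer of \<open>x\<close> twice, as subset sums of facet vectors and
  as sign changes of vanishing coordinates: two powers of 2 agree, hence their exponents.\<close>

lemma standard_chart_zeros:
  assumes st: "standard_chart dim model (W, f)" and x: "x \<in> W"
  shows "card {i. i < dim \<and> f x i = 0} = card (zeros (prj x))"
proof -
  have ch: "is_chart dim mtop (W, f)" using st by (simp add: standard_chart_def smooth_chart_def model_def)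
  have W: "W \<subseteq> pts" using ch openin_subset[of mtop W] by (simp add: is_chart_def topspace_mtop)
  have inj: "inj_on f W"
    using ch homeomorphic_imp_injective_map[of "subtopology mtop W" "subtopology E (f ` W)" f] W
    by (simp add: is_chart_def topspace_mtop Int_absorb1)
  obtain \<theta> where \<theta>: "\<theta> \<in> iso G G"
    and eqv: "\<forall>g\<in>carrier G. \<forall>x\<in>W. mact g x \<in> W \<and> f (mact g x) = sign_change dim (\<theta> g) (f x)"
    using st unfolding standard_chart_def model_def by auto
  let ?Z = "{i. i < dim \<and> f x i = 0}"
  let ?S = "zsum dim lam ` Pow (zeros (prj x))"
  let ?B = "zsum dim (zunit dim) ` Pow ?Z"
  have xp: "x \<in> pts" using x W by blast
  have fix_iff: "mact g x = x \<longleftrightarrow> (\<forall>i<dim. \<theta> g i = 1 \<longrightarrow> f x i = 0)" if g: "g \<in> carrier G" for g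
  proof -
    have "mact g x \<in> W" using eqv g x by blast
    then have "mact g x = x \<longleftrightarrow> f (mact g x) = f x" using inj_on_eq_iff[OF inj _ x] by simp
    also have "\<dots> \<longleftrightarrow> sign_change dim (\<theta> g) (f x) = f x" using eqv g x by simp
    also have "\<dots> \<longleftrightarrow> (\<forall>i<dim. \<theta> g i = 1 \<longrightarrow> f x i = 0)" by (auto simp: fun_eq_iff sign_change_def)
    finally show ?thesis .
  qed
  have im: "\<theta> ` ?S = ?B"
  proof (intro equalityI subsetI)
    fix h assume "h \<in> \<theta> ` ?S"
    then obtain g where g: "g \<in> ?S" "h = \<theta> g" by blast
    have gG: "g \<in> carrier G" using g(1) zsum_closed by blast
    then have "mact g x = x" using mact_fix[OF _ xp] g(1) by blast
    then have "{i. i < dim \<and> h i = 1} \<in> Pow ?Z" using fix_iff[OF gG] g(2) by blast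
    moreover have "h = zsum dim (zunit dim) {i. i < dim \<and> h i = 1}"
      using zsum_zunit[OF Z2_iso_closed[OF \<theta> gG]] g(2) by simp
    ultimately show "h \<in> ?B" by (rule image_eqI[rotated])
  next
    fix h assume "h \<in> ?B"
    then obtain A where A: "A \<subseteq> ?Z" "h = zsum dim (zunit dim) A" by blast
    obtain g where g: "g \<in> carrier G" "\<theta> g = h" using Z2_iso_surj[OF \<theta>, of h] A(2) zsum_closed by blast
    have As: "A \<subseteq> {..<dim}" using A(1) by blast
    have "\<forall>i<dim. \<theta> g i = 1 \<longrightarrow> f x i = 0"
      unfolding g(2) A(2) using zsum_zunit_coord[OF As] A(1) by blast
    then have "g \<in> ?S" using fix_iff[OF g(1)] mact_fix[OF g(1) xp] by blast
    then show "h \<in> \<theta> ` ?S" using g(2) by blast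
  qed
  have "inj_on \<theta> ?S"
  proof (rule inj_on_subset[of \<theta> "carrier G"])
    show "inj_on \<theta> (carrier G)" using \<theta> by (simp add: iso_iff)
  qed auto
  from card_image[OF this] have "card ?B = card ?S" unfolding im .
  moreover have "card ?S = 2 ^ card (zeros (prj x))"
    by (rule card_zsum_Pow[OF finite_zeros lam_indep[OF pts_cases(1)[OF xp]]])
  moreover have "zindep dim (zunit dim) ?Z"
    using zindep_units[of "\<lambda>i. i" ?Z dim] by auto
  then have "card ?B = 2 ^ card ?Z" by (rule card_zsum_Pow[rotated]) simp
  ultimately show ?thesis by simp
qed

lemma model_small_cover: "model \<in> small_covers dim P facets"
proof -
  have cover: "(\<Union>c\<in>choices. Uc c) = pts"
  proof (intro equalityI subsetI)
    fix x assume x: "x \<in> pts"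
    obtain c where "c \<in> choices" "prj x \<in> Pc c" by (rule chart_at[OF pts_cases(1)[OF x]])
    then show "x \<in> (\<Union>c\<in>choices. Uc c)" using x by (auto simp: Uc_def)
  qed (use Uc_sub in blast)
  have atlas: "smooth_atlas dim mtop ((\<lambda>c. (Uc c, phi c)) ` choices)"
    unfolding smooth_atlas_def using is_chart_phi smooth_id cover by (auto simp: topspace_mtop)
  have "closed_smooth_manifold dim (sc_top model) (sc_atlas model)"
    using Hausdorff_mtop compact_mtop atlas by (simp add: closed_smooth_manifold_def model_def)
  moreover have "group_action G (topspace (sc_top model)) (sc_act model)"
    using mact_group_action by (simp add: model_def topspace_mtop)
  moreover have "\<forall>g\<in>carrier G. smooth_self_map dim (sc_top model) (sc_atlas model) (sc_act model g)"
    unfolding smooth_self_map_def using mact_cont smooth_mact by (auto simp: model_def)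
  moreover have "locally_standard dim model"
    unfolding locally_standard_def
  proof
    fix x assume "x \<in> topspace (sc_top model)"
    then have "x \<in> (\<Union>c\<in>choices. Uc c)" unfolding cover by (simp add: model_def topspace_mtop)
    then obtain c where "c \<in> choices" "x \<in> Uc c" by blast
    then show "\<exists>ch. standard_chart dim model ch \<and> x \<in> fst ch"
      using standard_chart_phi[of c] by (intro exI[of _ "(Uc c, phi c)"]) simp
  qed
  moreover have "orbit_space_is dim P facets model"
    unfolding orbit_space_is_def
  proof (intro conjI ballI allI impI)
    show "quotient_map (sc_top model) P (sc_proj model)" using prj_quotient by (simp add: model_def)
    show "{y \<in> topspace (sc_top model). sc_proj model y = sc_proj model x} = orbit G (sc_act model) x"
      if "x \<in> topspace (sc_top model)" for x
      using mact_orbit that by (simp add: model_def topspace_mtop)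
    fix W f x assume st: "standard_chart dim model (W, f)" and x: "x \<in> W"
    have "is_chart dim mtop (W, f)" using st by (simp add: standard_chart_def smooth_chart_def model_def)
    then have "x \<in> pts" using x openin_subset[of mtop W] by (auto simp: is_chart_def topspace_mtop)
    then show "card {i. i < dim \<and> f x i = 0} = card {F \<in> facets. sc_proj model x \<in> F}"
      using standard_chart_zeros[OF st x] card_facets_at[OF pts_cases(1)] by (simp add: model_def)
  qed
  ultimately show ?thesis by (simp add: small_covers_def)
qed

lemma model_char: "char_of model lam"
  unfolding char_of_def
  using lamG lam_indep mact_fix by (simp add: model_def topspace_mtop)

end

section \<open>The correspondence\<close>

text \<open>Countable families of reals are no more numerous than reals: a real is coded by a set of
  naturals, and a countable family of such sets by a single one through
  \<open>to_nat\<close>.\<close>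

lemma ex_inj_countable_real_functions:
  assumes "(UNIV :: real set) \<lesssim> (UNIV :: 'a set)"
  shows "\<exists>e :: ('x::countable \<Rightarrow> real) \<Rightarrow> 'a. inj e"
proof -
  obtain j1 :: "real \<Rightarrow> nat set" where j1: "inj j1"
    using eqpoll_imp_lepoll[OF eqpoll_sym[OF nat_sets_eqpoll_reals]] unfolding lepoll_def by auto
  obtain j2 :: "nat set \<Rightarrow> real" where j2: "inj j2"
    using eqpoll_imp_lepoll[OF nat_sets_eqpoll_reals] unfolding lepoll_def by auto
  obtain j3 :: "real \<Rightarrow> 'a" where j3: "inj j3" using assms unfolding lepoll_def by auto
  define j :: "('x \<Rightarrow> real) \<Rightarrow> nat set" where "j f = to_nat ` (SIGMA x:UNIV. j1 (f x))" for f
  have "inj j"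
  proof (rule injI)
    fix f g assume "j f = j g"
    then have e: "(SIGMA x:UNIV. j1 (f x)) = (SIGMA x:UNIV. j1 (g x))"
      unfolding j_def by (simp add: inj_image_eq_iff)
    have "j1 (f x) = j1 (g x)" for x
    proof -
      have "n \<in> j1 (f x) \<longleftrightarrow> n \<in> j1 (g x)" for n
        using arg_cong[OF e, of "\<lambda>S. (x, n) \<in> S"] by simp
      then show ?thesis by blast
    qed
    then show "f = g" using j1 by (auto simp: inj_eq)
  qed
  then have "inj (j3 \<circ> (j2 \<circ> j))" using j2 j3 by (intro inj_compose)
  then show ?thesis by blast
qed

context simplex_coords
begin

text \<open>A class in the quotient is coded by the coordinates of its point together with a
  representative of its coset, which are countably many real numbers; this places the manifold in
  any type as large as the reals.\<close>

lemma ex_coset_codes: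
  assumes real: "(UNIV :: real set) \<lesssim> (UNIV :: 'a set)"
  shows "\<exists>q :: 'p \<Rightarrow> (nat \<Rightarrow> int) \<Rightarrow> 'a. \<forall>p\<in>topspace P. \<forall>p'\<in>topspace P.
    \<forall>g\<in>carrier (Z2_pow dim). \<forall>g'\<in>carrier (Z2_pow dim).
      q p g = q p' g' \<longleftrightarrow> p = p' \<and> g \<otimes>\<^bsub>Z2_pow dim\<^esub> g' \<in> zsum dim lam ` Pow (zeros p)"
proof -
  let ?G = "Z2_pow dim"
  let ?S = "\<lambda>p. zsum dim lam ` Pow (zeros p)"
  obtain e :: "((nat \<times> nat) + nat \<Rightarrow> real) \<Rightarrow> 'a" where e: "inj e"
    using ex_inj_countable_real_functions[OF real] by blast
  have Sm: "g \<otimes>\<^bsub>?G\<^esub> h \<in> ?S p" if gh: "g \<in> ?S p" "h \<in> ?S p" for g h p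
  proof -
    obtain A B where AB: "A \<subseteq> zeros p" "g = zsum dim lam A" "B \<subseteq> zeros p" "h = zsum dim lam B" using gh by blast
    have "finite A" "finite B" using AB finite_subset[OF _ finite_zeros] by auto
    then have "g \<otimes>\<^bsub>?G\<^esub> h = zsum dim lam ((A - B) \<union> (B - A))" unfolding AB(2,4) by (rule zsum_symdiff)
    moreover have "(A - B) \<union> (B - A) \<in> Pow (zeros p)" using AB by blast
    ultimately show ?thesis by (rule image_eqI)
  qed
  have S1: "\<one>\<^bsub>?G\<^esub> \<in> ?S p" for p by (rule image_eqI[of _ _ "{}"]) auto
  \<comment> \<open>The predicate depends only on the coset of \<open>g\<close>, so elements of one
    coset choose the same representative.\<close>
  define rep where "rep p g = (SOME h. h \<in> carrier ?G \<and> g \<otimes>\<^bsub>?G\<^esub> h \<in> ?S p)" for p g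
  have rep: "rep p g \<in> carrier ?G" "g \<otimes>\<^bsub>?G\<^esub> rep p g \<in> ?S p" if g: "g \<in> carrier ?G" for p g
  proof -
    have "\<exists>h. h \<in> carrier ?G \<and> g \<otimes>\<^bsub>?G\<^esub> h \<in> ?S p" using g S1[of p] Z2_square[OF g] by (intro exI[of _ g]) simp
    from someI_ex[OF this] show "rep p g \<in> carrier ?G" "g \<otimes>\<^bsub>?G\<^esub> rep p g \<in> ?S p" unfolding rep_def by auto
  qed
  have rep_eq: "rep p g = rep p g' \<longleftrightarrow> g \<otimes>\<^bsub>?G\<^esub> g' \<in> ?S p" if g: "g \<in> carrier ?G" "g' \<in> carrier ?G" for p g g'
  proof
    assume r: "rep p g = rep p g'"
    have "g \<otimes>\<^bsub>?G\<^esub> rep p g \<otimes>\<^bsub>?G\<^esub> (g' \<otimes>\<^bsub>?G\<^esub> rep p g) \<in> ?S p"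
      using Sm[OF rep(2)[OF g(1)] rep(2)[OF g(2)], of p] r by simp
    moreover have "g \<otimes>\<^bsub>?G\<^esub> rep p g \<otimes>\<^bsub>?G\<^esub> (g' \<otimes>\<^bsub>?G\<^esub> rep p g) = g \<otimes>\<^bsub>?G\<^esub> g'"
      using g rep(1)[OF g(1), of p] Z2_comm[of dim g' "rep p g"] by (simp add: Z2_assoc Z2_cancel)
    ultimately show "g \<otimes>\<^bsub>?G\<^esub> g' \<in> ?S p" by simp
  next
    assume gg: "g \<otimes>\<^bsub>?G\<^esub> g' \<in> ?S p"
    have "g \<otimes>\<^bsub>?G\<^esub> h \<in> ?S p \<longleftrightarrow> g' \<otimes>\<^bsub>?G\<^esub> h \<in> ?S p" if h: "h \<in> carrier ?G" for h
    proof -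
      have "g \<otimes>\<^bsub>?G\<^esub> g' \<otimes>\<^bsub>?G\<^esub> (g \<otimes>\<^bsub>?G\<^esub> h) = g' \<otimes>\<^bsub>?G\<^esub> h"
        using g h Z2_comm[of dim g g'] by (simp add: Z2_assoc Z2_cancel)
      moreover have "g \<otimes>\<^bsub>?G\<^esub> g' \<otimes>\<^bsub>?G\<^esub> (g' \<otimes>\<^bsub>?G\<^esub> h) = g \<otimes>\<^bsub>?G\<^esub> h"
        using g h by (simp add: Z2_assoc Z2_cancel)
      ultimately show ?thesis using Sm[OF gg, of "g \<otimes>\<^bsub>?G\<^esub> h"] Sm[OF gg, of "g' \<otimes>\<^bsub>?G\<^esub> h"] by auto
    qed
    then have "(\<lambda>h. h \<in> carrier ?G \<and> g \<otimes>\<^bsub>?G\<^esub> h \<in> ?S p) = (\<lambda>h. h \<in> carrier ?G \<and> g' \<otimes>\<^bsub>?G\<^esub> h \<in> ?S p)"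
      by (intro ext conj_cong refl)
    then show "rep p g = rep p g'" unfolding rep_def by simp
  qed
  define code :: "'p \<Rightarrow> (nat \<Rightarrow> int) \<Rightarrow> (nat \<times> nat) + nat \<Rightarrow> real"
    where "code p g x = (case x of Inl F \<Rightarrow> if F \<in> I then u F p else 0 | Inr i \<Rightarrow> real_of_int (rep p g i))" for p g x
  have code: "code p g = code p' g' \<longleftrightarrow> p = p' \<and> rep p g = rep p' g'"
    if p: "p \<in> topspace P" "p' \<in> topspace P" for p p' g g'
  proof
    assume c: "code p g = code p' g'"
    have "u F p = u F p'" if "F \<in> I" for F using fun_cong[OF c, of "Inl F"] that by (simp add: code_def)
    then have "p = p'" by (rule point_eqI[OF p])
    moreover have "rep p g = rep p' g'"
    proof
      fix i show "rep p g i = rep p' g' i" using fun_cong[OF c, of "Inr i"] by (simp add: code_def)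
    qed
    ultimately show "p = p' \<and> rep p g = rep p' g'" by blast
  next
    assume a: "p = p' \<and> rep p g = rep p' g'"
    show "code p g = code p' g'" using a by (auto simp: code_def[abs_def])
  qed
  have "e (code p g) = e (code p' g') \<longleftrightarrow> p = p' \<and> g \<otimes>\<^bsub>?G\<^esub> g' \<in> ?S p"
    if "p \<in> topspace P" "p' \<in> topspace P" "g \<in> carrier ?G" "g' \<in> carrier ?G" for p p' g g'
    using code[OF that(1,2)] rep_eq[OF that(3,4)] inj_eq[OF e] by auto
  then show ?thesis by (intro exI[of _ "\<lambda>p g. e (code p g)"]) blast
qed

lemma ex_small_cover_with_char:
  assumes real: "(UNIV :: real set) \<lesssim> (UNIV :: 'a set)"
    and "\<And>F. F \<in> I \<Longrightarrow> lam F \<in> carrier (Z2_pow dim)" "\<And>p. p \<in> topspace P \<Longrightarrow> zindep dim lam (zeros p)"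
  shows "\<exists>M :: ('a, 'p) small_cover. M \<in> small_covers dim P facets \<and> char_of M lam"
proof -
  obtain q :: "'p \<Rightarrow> (nat \<Rightarrow> int) \<Rightarrow> 'a" where q: "\<forall>p\<in>topspace P. \<forall>p'\<in>topspace P.
    \<forall>g\<in>carrier (Z2_pow dim). \<forall>g'\<in>carrier (Z2_pow dim).
      q p g = q p' g' \<longleftrightarrow> p = p' \<and> g \<otimes>\<^bsub>Z2_pow dim\<^esub> g' \<in> zsum dim lam ` Pow (zeros p)"
    using ex_coset_codes[OF real, of lam] ..
  interpret char_model P m \<omega> u lam q
    by unfold_locales (use assms(2,3) q in blast)+
  show ?thesis using model_small_cover model_char by blast
qed

text \<open>Through characteristic functions the relation becomes the existence of a matching
  automorphism, so its properties are those of the automorphism group.\<close>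

lemma DJ_equiv: "equiv (small_covers dim P facets :: ('a, 'p) small_cover set)
   {(M, M'). M \<in> small_covers dim P facets \<and> M' \<in> small_covers dim P facets \<and> DJ_equivalent dim M M'}"
proof (rule equivI)
  let ?C = "small_covers dim P facets :: ('a, 'p) small_cover set"
  let ?R = "{(M, M'). M \<in> ?C \<and> M' \<in> ?C \<and> DJ_equivalent dim M M'}"
  let ?G = "Z2_pow dim"
  have ch: "\<exists>lam. char_of M lam" if "M \<in> ?C" for M
    using small_cover_over.ex_char[OF small_cover_overI[OF that]] .
  show "refl_on ?C ?R"
  proof (rule refl_onI)
    fix M assume M: "M \<in> ?C"
    obtain lam where "char_of M lam" using ch[OF M] ..
    then have "DJ_equivalent dim M M" by (intro iso_imp_DJ_equivalent[OF M M _ _ iso_set_refl]) auto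
    then show "(M, M) \<in> ?R" using M by simp
  qed
  show "sym ?R"
  proof (rule symI)
    fix M M' assume "(M, M') \<in> ?R"
    then have M: "M \<in> ?C" "M' \<in> ?C" "DJ_equivalent dim M M'" by auto
    obtain lam where l: "char_of M lam" using ch[OF M(1)] ..
    obtain lam' where l': "char_of M' lam'" using ch[OF M(2)] ..
    obtain \<alpha> where \<alpha>: "\<alpha> \<in> iso ?G ?G" "\<forall>F\<in>I. \<alpha> (lam F) = lam' F"
      using DJ_equivalent_imp_iso[OF M(1,2) l l' M(3)] by blast
    obtain \<beta> where \<beta>: "\<beta> \<in> iso ?G ?G" "\<And>g. g \<in> carrier ?G \<Longrightarrow> \<beta> (\<alpha> g) = g"
      using Z2_iso_inverse[OF \<alpha>(1)] by metis
    have "\<beta> (lam' F) = lam F" if F: "F \<in> I" for F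
    proof -
      have "lam F \<in> carrier ?G" using l F by (simp add: char_of_def)
      then show ?thesis using \<beta>(2)[of "lam F"] bspec[OF \<alpha>(2) F] by simp
    qed
    then have "DJ_equivalent dim M' M" by (intro iso_imp_DJ_equivalent[OF M(2,1) l' l \<beta>(1)]) blast
    then show "(M', M) \<in> ?R" using M by simp
  qed
  show "trans ?R"
  proof (rule transI)
    fix M M' M'' assume "(M, M') \<in> ?R"
      and "(M', M'') \<in> ?R"
    then have M: "M \<in> ?C" "M' \<in> ?C" "M'' \<in> ?C" "DJ_equivalent dim M M'" "DJ_equivalent dim M' M''" by auto
    obtain lam where l: "char_of M lam" using ch[OF M(1)] ..
    obtain lam' where l': "char_of M' lam'" using ch[OF M(2)] ..
    obtain lam'' where l'': "char_of M'' lam''" using ch[OF M(3)] ..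
    obtain \<alpha> where \<alpha>: "\<alpha> \<in> iso ?G ?G" "\<forall>F\<in>I. \<alpha> (lam F) = lam' F"
      using DJ_equivalent_imp_iso[OF M(1,2) l l' M(4)] by blast
    obtain \<beta> where \<beta>: "\<beta> \<in> iso ?G ?G" "\<forall>F\<in>I. \<beta> (lam' F) = lam'' F"
      using DJ_equivalent_imp_iso[OF M(2,3) l' l'' M(5)] by blast
    have "DJ_equivalent dim M M''"
      by (rule iso_imp_DJ_equivalent[OF M(1,3) l l'' iso_set_trans[OF \<alpha>(1) \<beta>(1)]]) (use \<alpha>(2) \<beta>(2) in simp)
    then show "(M, M'') \<in> ?R" using M by simp
  qed
qed auto

text \<open>Every digraph is realized by some small cover, and \<open>digraph_char_inj\<close>
  separates the classes; normalizing the characteristic function of a given cover shows that no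
  class is missed.\<close>

lemma DJ_classes_eqpoll:
  assumes real: "(UNIV :: real set) \<lesssim> (UNIV :: 'a set)"
  shows "(DJ_classes dim P facets :: ('a, 'p) small_cover set set) \<approx> acyclic_weighted_digraphs m \<omega>"
proof -
  let ?C = "small_covers dim P facets :: ('a, 'p) small_cover set"
  let ?D = "acyclic_weighted_digraphs m \<omega>"
  let ?R = "{(M, M'). M \<in> ?C \<and> M' \<in> ?C \<and> DJ_equivalent dim M M'}"
  have "\<forall>D\<in>?D. \<exists>M. M \<in> ?C \<and> char_of M (digraph_char D)"
    using ex_small_cover_with_char[OF real] digraph_char_closed digraph_char_indep by blast
  from bchoice[OF this] obtain f where f: "\<forall>D\<in>?D. f D \<in> ?C \<and> char_of (f D) (digraph_char D)" ..
  have f1: "f D \<in> ?C" "char_of (f D) (digraph_char D)" if "D \<in> ?D" for D using f that by auto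
  have "bij_betw (\<lambda>D. ?R `` {f D}) ?D (?C // ?R)"
    unfolding bij_betw_def
  proof
    show "inj_on (\<lambda>D. ?R `` {f D}) ?D"
    proof
      fix D D' assume D: "D \<in> ?D" "D' \<in> ?D" "?R `` {f D} = ?R `` {f D'}"
      have "(f D, f D') \<in> ?R" by (rule eq_equiv_class[OF D(3) DJ_equiv f1(1)[OF D(2)]])
      then have "DJ_equivalent dim (f D) (f D')" by simp
      from DJ_equivalent_imp_iso[OF f1(1)[OF D(1)] f1(1)[OF D(2)] f1(2)[OF D(1)] f1(2)[OF D(2)] this]
      obtain \<alpha> where \<alpha>: "\<alpha> \<in> iso (Z2_pow dim) (Z2_pow dim)" "\<forall>F\<in>I. \<alpha> (digraph_char D F) = digraph_char D' F" by blast
      show "D = D'" by (rule digraph_char_inj[OF D(1,2) \<alpha>])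
    qed
    show "(\<lambda>D. ?R `` {f D}) ` ?D = ?C // ?R"
    proof (intro equalityI subsetI)
      fix K assume "K \<in> (\<lambda>D. ?R `` {f D}) ` ?D"
      then obtain D where "D \<in> ?D" "K = ?R `` {f D}" by blast
      then show "K \<in> ?C // ?R" using quotientI[OF f1(1)] by (simp only:)
    next
      fix K assume "K \<in> ?C // ?R"
      then obtain M where M: "M \<in> ?C" "K = ?R `` {M}" by (rule quotientE)
      obtain lam where l: "char_of M lam" using small_cover_over.ex_char[OF small_cover_overI[OF M(1)]] ..
      have "\<exists>D \<in> ?D. \<exists>\<alpha>\<in>iso (Z2_pow dim) (Z2_pow dim). \<forall>F\<in>I. \<alpha> (lam F) = digraph_char D F"
        by (rule ex_digraph_char) (use l in \<open>simp_all add: char_of_def\<close>)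
      then obtain D \<alpha> where D: "D \<in> ?D" and \<alpha>: "\<alpha> \<in> iso (Z2_pow dim) (Z2_pow dim)" "\<forall>F\<in>I. \<alpha> (lam F) = digraph_char D F" by blast
      have "DJ_equivalent dim M (f D)" by (rule iso_imp_DJ_equivalent[OF M(1) f1(1)[OF D] l f1(2)[OF D] \<alpha>])
      then have "(M, f D) \<in> ?R" using M(1) f1(1)[OF D] by simp
      then have "?R `` {M} = ?R `` {f D}" by (rule equiv_class_eq[OF DJ_equiv])
      then show "K \<in> (\<lambda>D. ?R `` {f D}) ` ?D" using M(2) D by blast
    qed
  qed
  then have "?D \<approx> ?C // ?R" unfolding eqpoll_def by blast
  then show ?thesis unfolding DJ_classes_def by (rule eqpoll_sym)
qed

end

text \<open>By induction on \<open>l\<close>: the new block occupies the \<open>ms (Suc l)\<close>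
  numbers that follow the labels used so far.\<close>

lemma block_index_bij:
  "bij_betw (\<lambda>(i, j). block_index ms i j) (SIGMA i:{1..l}. {1..ms i}) {1..\<Sum>i=1..l. ms i}"
proof (induction l)
  case 0
  then show ?case by (simp add: bij_betw_def)
next
  case (Suc l)
  let ?s = "\<Sum>i=1..l. ms i"
  have e1: "(SIGMA i:{1..Suc l}. {1..ms i}) = (SIGMA i:{1..l}. {1..ms i}) \<union> {Suc l} \<times> {1..ms (Suc l)}"
    by (auto simp: le_Suc_eq)
  have e2: "{1..\<Sum>i=1..Suc l. ms i} = {1..?s} \<union> {?s + 1..?s + ms (Suc l)}" by auto
  have b: "block_index ms (Suc l) j = ?s + j" for j
    unfolding block_index_def by (simp add: atLeastLessThanSuc_atLeastAtMost)
  have "bij_betw (\<lambda>(i, j). block_index ms i j) ({Suc l} \<times> {1..ms (Suc l)}) {?s + 1..?s + ms (Suc l)}"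
  proof (rule bij_betw_byWitness[where f'="\<lambda>k. (Suc l, k - ?s)"])
    show "(\<lambda>k. (Suc l, k - ?s)) ` {?s + 1..?s + ms (Suc l)} \<subseteq> {Suc l} \<times> {1..ms (Suc l)}" by auto
  qed (auto simp: b)
  then show ?case unfolding e1 e2 by (rule bij_betw_combine[OF Suc.IH]) auto
qed

lemma compact_simplex_space: "compact_space (simplex_space d)"
  unfolding simplex_space_def using compactin_standard_simplex compact_space_subtopology by blast

lemma Hausdorff_simplex_space: "Hausdorff_space (simplex_space d)"
  unfolding simplex_space_def
  by (intro Hausdorff_space_subtopology) (simp add: Hausdorff_space_product_topology)

lemma topspace_simplex_space: "topspace (simplex_space d) = standard_simplex d"
  by (simp add: simplex_space_def)

lemma topspace_simplex_product:
  "topspace (simplex_product l ns ms) = (\<Pi>\<^sub>E i\<in>{1..l}. \<Pi>\<^sub>E j\<in>{1..ms i}. standard_simplex (ns i))"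
  by (simp add: simplex_product_def topspace_simplex_space)

theorem corollary4p1:
  fixes l n m :: nat and ns ms \<omega> :: "nat \<Rightarrow> nat"
  assumes "1 \<le> l"
    and "1 \<le> ns 1"
    and "strict_mono_on {1..l} ns"
    and "\<forall>i\<in>{1..l}. 1 \<le> ms i"
    and "n = (\<Sum>i=1..l. ns i * ms i)"
    and "m = (\<Sum>i=1..l. ms i)"
    and "\<forall>i\<in>{1..l}. \<forall>j\<in>{1..ms i}. \<omega> (block_index ms i j) = ns i"
    \<comment> \<open>the type of points of the manifolds is large enough to carry all closed manifolds\<close>
    and "(UNIV :: real set) \<lesssim> (UNIV :: 'a set)"
  shows "(DJ_classes n (simplex_product l ns ms) (simplex_product_facets l ns ms)
            :: ('a, nat \<Rightarrow> nat \<Rightarrow> nat \<Rightarrow> real) small_cover set set)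
         \<approx> acyclic_weighted_digraphs m \<omega>"
proof -
  let ?P = "simplex_product l ns ms"
  define K where "K = (SIGMA i:{1..l}. {1..ms i})"
  define B where "B = (\<lambda>(i, j). block_index ms i j)"
  have bij: "bij_betw B K {1..m}" unfolding B_def K_def assms(6) by (rule block_index_bij)
  define b where "b = inv_into K B"
  have bK: "b k \<in> K" "B (b k) = k" if "k \<in> {1..m}" for k
    using bij that by (auto simp: b_def bij_betw_def inv_into_into f_inv_into_f)
  have bB: "b (B x) = x" if "x \<in> K" for x using bij that by (simp add: b_def bij_betw_def)
  have Bm: "B x \<in> {1..m}" if "x \<in> K" for x using bij that by (auto simp: bij_betw_def)
  have wB: "\<omega> (B x) = ns (fst x)" if "x \<in> K" for x
    using assms(7) that by (cases x) (simp add: B_def K_def)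
  have wb: "\<omega> k = ns (fst (b k))" if "k \<in> {1..m}" for k using wB[OF bK(1)[OF that]] bK(2)[OF that] by simp
  have bk: "fst (b k) \<in> {1..l}" "snd (b k) \<in> {1..ms (fst (b k))}" if "k \<in> {1..m}" for k
    using bK(1)[OF that] by (auto simp: K_def)
  have ns1: "1 \<le> ns i" if i: "i \<in> {1..l}" for i
  proof (cases "i = 1")
    case False
    then have "ns 1 < ns i" using assms(3) i by (intro strict_mono_onD[OF assms(3)]) auto
    then show ?thesis using assms(2) by simp
  qed (use assms(2) in simp)
  \<comment> \<open>\<open>b\<close> turns a label \<open>k\<close> back into its block and
    position, so \<open>u (k, t)\<close> reads the \<open>t\<close>-th barycentric coordinate on the
    \<open>k\<close>-th simplex.\<close>
  define u where "u F p = p (fst (b (fst F))) (snd (b (fst F))) (snd F)"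
    for F :: "nat \<times> nat" and p :: "nat \<Rightarrow> nat \<Rightarrow> nat \<Rightarrow> real"
  have simp_pt: "p (fst (b k)) (snd (b k)) \<in> standard_simplex (\<omega> k)" if "p \<in> topspace ?P" "k \<in> {1..m}" for p k
    using that bk[OF that(2)] wb[OF that(2)] unfolding topspace_simplex_product by (auto simp: PiE_iff)
  interpret simplex_coords ?P m \<omega> u
  proof unfold_locales
    show "compact_space ?P"
      by (simp add: simplex_product_def compact_space_product_topology compact_simplex_space)
    show "Hausdorff_space ?P"
      by (simp add: simplex_product_def Hausdorff_space_product_topology Hausdorff_simplex_space)
    show "1 \<le> \<omega> k" if "k \<in> {1..m}" for k using wb[OF that] ns1[OF bk(1)[OF that]] by simp
    show "continuous_map ?P euclideanreal (u F)" if F: "F \<in> (SIGMA k:{1..m}. {..\<omega> k})" for F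
    proof -
      have k: "fst F \<in> {1..m}" using F by auto
      let ?i = "fst (b (fst F))" and ?j = "snd (b (fst F))"
      have 1: "continuous_map ?P (product_topology (\<lambda>j. simplex_space (ns ?i)) {1..ms ?i}) (\<lambda>p. p ?i)"
        unfolding simplex_product_def
        by (rule continuous_map_product_projection[of ?i "{1..l}" "\<lambda>i. product_topology (\<lambda>j. simplex_space (ns i)) {1..ms i}"]) (rule bk(1)[OF k])
      have 2: "continuous_map (product_topology (\<lambda>j. simplex_space (ns ?i)) {1..ms ?i}) (simplex_space (ns ?i)) (\<lambda>p. p ?j)"
        by (rule continuous_map_product_projection[of ?j "{1..ms ?i}" "\<lambda>j. simplex_space (ns ?i)"]) (rule bk(2)[OF k])
      have 3: "continuous_map (simplex_space (ns ?i)) euclideanreal (\<lambda>x. x (snd F))"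
        unfolding simplex_space_def
        by (rule continuous_map_from_subtopology, rule continuous_map_product_coordinates) simp
      have "continuous_map ?P euclideanreal ((\<lambda>x. x (snd F)) \<circ> ((\<lambda>p. p ?j) \<circ> (\<lambda>p. p ?i)))"
        by (rule continuous_map_compose[OF continuous_map_compose[OF 1 2] 3])
      then show ?thesis by (simp add: o_def u_def[abs_def])
    qed
    show "p = p'" if p: "p \<in> topspace ?P" "p' \<in> topspace ?P"
      and e: "\<And>F. F \<in> (SIGMA k:{1..m}. {..\<omega> k}) \<Longrightarrow> u F p = u F p'" for p p'
    proof -
      have "p i j t = p' i j t" if ij: "i \<in> {1..l}" "j \<in> {1..ms i}" for i j t
      proof -
        have K: "(i, j) \<in> K" using ij by (simp add: K_def)
        have st: "p i j \<in> standard_simplex (ns i)" "p' i j \<in> standard_simplex (ns i)"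
          using p ij unfolding topspace_simplex_product by (auto simp: PiE_iff)
        show ?thesis
        proof (cases "t \<le> ns i")
          case True
          then have "(B (i, j), t) \<in> (SIGMA k:{1..m}. {..\<omega> k})" using Bm[OF K] wB[OF K] by simp
          from e[OF this] show ?thesis by (simp add: u_def bB[OF K])
        qed (use st in \<open>simp add: standard_simplex_def\<close>)
      qed
      then have pij: "p i j = p' i j" if "i \<in> {1..l}" "j \<in> {1..ms i}" for i j using that by blast
      have pi: "p i = p' i" if i: "i \<in> {1..l}" for i
        by (rule PiE_ext[of _ "{1..ms i}" "\<lambda>_. standard_simplex (ns i)"])
          (use p i pij[OF i] in \<open>auto simp: topspace_simplex_product PiE_iff\<close>)
      show ?thesis
        using p unfolding topspace_simplex_product by (rule PiE_ext) (rule pi)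
    qed
    show "0 \<le> u F p" if p: "p \<in> topspace ?P" and F: "F \<in> (SIGMA k:{1..m}. {..\<omega> k})" for p F
    proof -
      have k: "fst F \<in> {1..m}" using F by auto
      show ?thesis using simp_pt[OF p k] by (simp add: u_def standard_simplex_def)
    qed
    show "(\<Sum>t\<le>\<omega> k. u (k, t) p) = 1" if p: "p \<in> topspace ?P" and k: "k \<in> {1..m}" for p k
      using simp_pt[OF p k] by (simp add: u_def standard_simplex_def)
    show "\<exists>p\<in>topspace ?P. \<forall>F\<in>SIGMA k:{1..m}. {..\<omega> k}. u F p = v F"
      if v0: "\<And>F. F \<in> (SIGMA k:{1..m}. {..\<omega> k}) \<Longrightarrow> 0 \<le> v F"
        and v1: "\<And>k. k \<in> {1..m} \<Longrightarrow> (\<Sum>t\<le>\<omega> k. v (k, t)) = 1" for v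
    proof -
      \<comment> \<open>Points are extensional in \<open>i\<close> and \<open>j\<close> but
        functions of all \<open>t\<close>, and \<open>standard_simplex\<close> demands zeros beyond
        \<open>ns i\<close>.\<close>
      define p where "p = (\<lambda>i\<in>{1..l}. \<lambda>j\<in>{1..ms i}. \<lambda>t. if t \<le> ns i then v (B (i, j), t) else 0)"
      have "(\<lambda>t. if t \<le> ns i then v (B (i, j), t) else 0) \<in> standard_simplex (ns i)"
        if ij: "i \<in> {1..l}" "j \<in> {1..ms i}" for i j
      proof -
        have K: "(i, j) \<in> K" using ij by (simp add: K_def)
        have w: "\<omega> (B (i, j)) = ns i" using wB[OF K] by simp
        have nn: "0 \<le> v (B (i, j), t)" if "t \<le> ns i" for t
          by (rule v0) (use that w Bm[OF K] in simp)
        have s1: "(\<Sum>t\<le>ns i. v (B (i, j), t)) = 1" using v1[OF Bm[OF K]] w by simp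
        have "v (B (i, j), t) \<le> 1" if "t \<le> ns i" for t
          unfolding s1[symmetric] by (rule member_le_sum) (use that nn in auto)
        then show ?thesis using nn s1 by (auto simp: standard_simplex_def)
      qed
      then have pP: "p \<in> topspace ?P" unfolding topspace_simplex_product p_def by (auto simp: PiE_iff)
      have "u F p = v F" if F: "F \<in> (SIGMA k:{1..m}. {..\<omega> k})" for F
      proof -
        obtain k t where kt: "F = (k, t)" "k \<in> {1..m}" "t \<le> \<omega> k" using F by blast
        have "B (fst (b k), snd (b k)) = k" using bK(2)[OF kt(2)] by simp
        then show ?thesis using bk[OF kt(2)] wb[OF kt(2)] kt by (simp add: u_def p_def)
      qed
      then show ?thesis using pP by blast
    qed
  qed
  have "dim = (\<Sum>x\<in>K. \<omega> (B x))" unfolding dim_def by (rule sum.reindex_bij_betw[OF bij, symmetric])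
  also have "\<dots> = (\<Sum>x\<in>K. ns (fst x))" by (rule sum.cong) (use wB in auto)
  also have "\<dots> = (\<Sum>i=1..l. \<Sum>j=1..ms i. ns i)" unfolding K_def by (subst sum.Sigma) (auto simp: case_prod_beta)
  also have "\<dots> = n" by (simp add: assms(5) mult.commute)
  finally have dim: "dim = n" .
  have fac: "facets = simplex_product_facets l ns ms"
  proof (intro equalityI subsetI)
    fix S assume "S \<in> facets"
    then obtain F where F: "F \<in> I" "S = {p \<in> topspace ?P. u F p = 0}" unfolding facets_def by blast
    obtain k t where kt: "F = (k, t)" "k \<in> {1..m}" "t \<le> \<omega> k" using F(1) by (cases F) (auto simp: I_iff)
    have "S = {p \<in> topspace ?P. p (fst (b k)) (snd (b k)) t = 0}" using F(2) kt(1) by (simp add: u_def)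
    then show "S \<in> simplex_product_facets l ns ms"
      unfolding simplex_product_facets_def using bk[OF kt(2)] wb[OF kt(2)] kt(3) by auto
  next
    fix S assume "S \<in> simplex_product_facets l ns ms"
    then obtain i j t where S: "S = {p \<in> topspace ?P. p i j t = 0}" and ij: "i \<in> {1..l}" "j \<in> {1..ms i}" "t \<le> ns i"
      unfolding simplex_product_facets_def by blast
    have K: "(i, j) \<in> K" using ij by (simp add: K_def)
    have "(B (i, j), t) \<in> I" using Bm[OF K] wB[OF K] ij by (simp add: I_iff)
    moreover have "S = {p \<in> topspace ?P. u (B (i, j), t) p = 0}" by (simp add: S u_def bB[OF K])
    ultimately show "S \<in> facets" unfolding facets_def by blast
  qed
  show ?thesis using DJ_classes_eqpoll[OF assms(8)] unfolding dim fac .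
qed

end
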